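(* For all non-negative integers $i,j,k,l$, the Barrett–Crane 4-vertices satisfy $$v^{i,j}_{k,l}=\bigl(\mathrm{id}_{V_{(k,k)}}\otimes \mathrm{id}_{V_{(l,l)}}\otimes \eta_{(j,j)}\bigr)\circ\bigl(\mathrm{id}_{V_{(k,k)}}\otimes v^{k,i}_{l,j}\otimes \mathrm{id}_{V_{(j,j)}}\bigr)\circ\bigl(\epsilon_{(k,k)}\otimes \mathrm{id}_{V_{(i,i)}}\otimes \mathrm{id}_{V_{(j,j)}}\bigr),$$ as maps $V_{(i,i)}\otimes V_{(j,j)}\to V_{(k,k)}\otimes V_{(l,l)}$ (associators and unit isomorphisms suppressed).
   Context: Temperley–Lieb recoupling. Fix $A\in\mathbb{C}\setminus\{0\}$ such that $\Delta_n:=(-1)^n\sum_{s=0}^n A^{2n-4s}\neq 0$ for all integers $n\ge 0$; the deformation parameter is $q=A^4$, and replacing $q$ by $q^{-1}$ means replacing $A$ by $A^{-1}$. The Temperley–Lieb category $TL_A$ has objects the non-negative integers and morphisms $m\to n$ the $\mathbb{C}$-linear combinations of crossingless planar tangle diagrams with $m$ top and $n$ bottom endpoints (read from top to bottom), modulo isotopy rel endpoints and deletion of a closed loop at the cost of a factor $-A^2-A^{-2}$; tensor product is juxtaposition. An edge labelled $n$ means $n$ parallel strands with the Jones–Wenzl idempotent $f_n$ (the unique non-zero idempotent of $\mathrm{End}(n)$ killed by composition with every turn-back) inserted; $V_n$ denotes the corresponding object of the idempotent completion $\mathcal{C}_A$ of $TL_A$ (the irreducible representation of $U_q(\mathfrak{sl}_2)$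 of dimension $n+1$). A triple $(a,b,c)$ is admissible if $a+b+c$ is even and each of $a,b,c$ is at most the sum of the other two. The Kauffman–Lins 3-vertex with legs labelled $a,b,c$ is obtained by planarly joining the legs pairwise by $\frac{a+b-c}{2},\frac{b+c-a}{2},\frac{a+c-b}{2}$ strands, with idempotents on the legs; it is $0$ if $(a,b,c)$ is not admissible. $\Delta_n$ is the value of a closed loop labelled $n$, and $\theta(a,b,c)$ is the value of the planar theta graph with edges labelled $a,b,c$ (non-zero for admissible triples). $\Delta_n$ and $\theta$ are unchanged under $A\mapsto A^{-1}$. Balanced theory. We work in $\mathrm{Rep}(U_q^{\rm bal}(\mathfrak{so}_4))=\mathcal{C}_A\boxtimes\mathcal{C}_{A^{-1}}$, where $U_q^{\rm bal}(\mathfrak{so}_4)=U_q(\mathfrak{sl}_2)\otimes U_{q^{-1}}(\mathfrak{sl}_2)$. Its irreducibles are $V_{(i,j)}=V_i\otimes W_j$, with $V_i$ from $\mathcal{C}_A$ and $W_j$ from $\mathcal{C}_{A^{-1}}$. A diagram with edges labelled by pairs denotes the tensor product of the diagram with the first labels, evaluated with parameter $A$, and the diagram with the second labels, evaluated with parameter $A^{-1}$. Irreducibles $V_{(j,j)}$ are called balanced. Duality maps. $\epsilon_{(k,k)}:\mathbf{1}\to V_{(k,k)}\otimes V_{(k,k)}$ and $\eta_{(k,k)}:V_{(k,k)}\otimes V_{(k,k)}\to\mathbf{1}$ are the maps given by the single arc diagrams labelled $(k,k)$ with both ends at the bottom, respectively both ends at the top. Barrett–Crane 4-vertex. $v^{i,j}_{k,l}:V_{(i,i)}\otimes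 V_{(j,j)}\to V_{(k,k)}\otimes V_{(l,l)}$ is $$v^{i,j}_{k,l}=\sum_n \frac{\Delta_n}{\theta(i,j,n)\,\theta(k,l,n)}\,D_n,$$ where the sum is over all $n\ge0$ with $(i,j,n)$ and $(k,l,n)$ admissible (a finite sum), and $D_n$ is the pair-labelled planar diagram in which two top legs labelled $(i,i)$ and $(j,j)$ (left to right) meet at a 3-vertex joined by a vertical edge labelled $(n,n)$ to a 3-vertex with bottom legs $(k,k)$ and $(l,l)$ (left to right). *)

theory Defs
  imports Complex_Main "HOL-Library.Poly_Mapping"
begin

section \<open>Crossingless diagrams\<close>

text \<open>
  A crossingless tangle diagram without closed loops is determined up to isotopy rel endpoints by
  which endpoints it joins.  The point \<open>(0, i)\<close> is the \<open>i\<close>-th top endpoint and \<open>(1, i)\<close> the \<open>i\<close>-th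
  bottom endpoint, both counted from the left starting at 0; \<open>arcs\<close> is the symmetric relation
  ``joined by a strand''.
\<close>

type_synonym point = "nat \<times> nat"

datatype diagram = Diagram (tops: nat) (bots: nat) (arcs: "(point \<times> point) set")

definition points :: "nat \<Rightarrow> nat \<Rightarrow> point set" where
  "points m n = {0} \<times> {..<m} \<union> {1} \<times> {..<n}"

text \<open>Position on the boundary of the rectangle, read clockwise from the top left corner.\<close>

definition pos :: "nat \<Rightarrow> nat \<Rightarrow> point \<Rightarrow> nat" where
  "pos m n p = (if fst p = 0 then snd p else m + (n - 1 - snd p))"

definition noncrossing :: "nat \<Rightarrow> nat \<Rightarrow> (point \<times> point) set \<Rightarrow> bool" where
  "noncrossing m n R \<longleftrightarrow>
     (\<forall>(a, b) \<in> R. \<forall>(c, d) \<in> R.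
        \<not> (pos m n a < pos m n c \<and> pos m n c < pos m n b \<and> pos m n b < pos m n d))"

definition diagrams :: "nat \<Rightarrow> nat \<Rightarrow> diagram set" where
  "diagrams m n = {Diagram m n R | R.
     R \<subseteq> points m n \<times> points m n \<and> sym R \<and> irrefl R \<and>
     (\<forall>p \<in> points m n. \<exists>!q. (p, q) \<in> R) \<and> noncrossing m n R}"

definition id_diagram :: "nat \<Rightarrow> diagram" where
  "id_diagram n = Diagram n n
     ({((0, i), (1, i)) | i. i < n} \<union> {((1, i), (0, i)) | i. i < n})"

text \<open>\<open>n\<close> nested arcs with all ends at the top, respectively at the bottom.\<close>

definition cap_diagram :: "nat \<Rightarrow> diagram" where
  "cap_diagram n = Diagram (2 * n) 0 {((0, i), (0, 2 * n - 1 - i)) | i. i < 2 * n}"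

definition cup_diagram :: "nat \<Rightarrow> diagram" where
  "cup_diagram n = Diagram 0 (2 * n) {((1, i), (1, 2 * n - 1 - i)) | i. i < 2 * n}"

text \<open>
  Stacking \<open>d\<close> on top of \<open>e\<close> (with \<open>bots d = tops e\<close>): the points of \<open>e\<close> move one level down, so
  level 1 holds the glued points and levels 0 and 2 the outer ones.  Strands of the composite are
  the components of the resulting graph with outer ends; a component consisting of glued points
  only is a closed loop.
\<close>

definition stack :: "diagram \<Rightarrow> diagram \<Rightarrow> (point \<times> point) set" where
  "stack d e = arcs d \<union> map_prod (map_prod Suc id) (map_prod Suc id) ` arcs e"

definition stack_diagram :: "diagram \<Rightarrow> diagram \<Rightarrow> diagram" where
  "stack_diagram d e = Diagram (tops d) (bots e)
     {(p, q). p \<in> points (tops d) (bots e) \<and> q \<in> points (tops d) (bots e) \<and> p \<noteq> q \<and>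
              ((2 * fst p, snd p), (2 * fst q, snd q)) \<in> (stack d e)\<^sup>*}"

definition stack_loops :: "diagram \<Rightarrow> diagram \<Rightarrow> nat" where
  "stack_loops d e =
     card {C \<in> ({1} \<times> {..<bots d}) // (stack d e)\<^sup>*. C \<subseteq> {1} \<times> {..<bots d}}"

definition shift_right :: "diagram \<Rightarrow> point \<Rightarrow> point" where
  "shift_right d p = (fst p, (if fst p = 0 then tops d else bots d) + snd p)"

definition juxtapose :: "diagram \<Rightarrow> diagram \<Rightarrow> diagram" where
  "juxtapose d e = Diagram (tops d + tops e) (bots d + bots e)
     (arcs d \<union> map_prod (shift_right d) (shift_right d) ` arcs e)"


section \<open>The Temperley--Lieb category\<close>

definition scale :: "complex \<Rightarrow> ('a \<Rightarrow>\<^sub>0 complex) \<Rightarrow> ('a \<Rightarrow>\<^sub>0 complex)" where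
  "scale c x = Poly_Mapping.map ((*) c) x"

text \<open>Bilinear extension of a map given on basis elements.\<close>

definition bilinear_ext ::
  "('a \<Rightarrow> 'b \<Rightarrow> ('c \<Rightarrow>\<^sub>0 complex)) \<Rightarrow> ('a \<Rightarrow>\<^sub>0 complex) \<Rightarrow> ('b \<Rightarrow>\<^sub>0 complex) \<Rightarrow> ('c \<Rightarrow>\<^sub>0 complex)" where
  "bilinear_ext h x y =
     (\<Sum>a \<in> Poly_Mapping.keys x. \<Sum>b \<in> Poly_Mapping.keys y.
        scale (Poly_Mapping.lookup x a * Poly_Mapping.lookup y b) (h a b))"

type_synonym tl = "diagram \<Rightarrow>\<^sub>0 complex"

definition tl_hom :: "nat \<Rightarrow> nat \<Rightarrow> tl set" where
  "tl_hom m n = {x. Poly_Mapping.keys x \<subseteq> diagrams m n}"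

abbreviation basis :: "'a \<Rightarrow> ('a \<Rightarrow>\<^sub>0 complex)" where
  "basis d \<equiv> Poly_Mapping.single d 1"

definition compose_basis :: "complex \<Rightarrow> diagram \<Rightarrow> diagram \<Rightarrow> tl" where
  "compose_basis A e d =
     (if bots d = tops e
      then scale ((- (A ^ 2) - inverse A ^ 2) ^ stack_loops d e) (basis (stack_diagram d e))
      else 0)"

definition tl_comp :: "tl \<Rightarrow> complex \<Rightarrow> tl \<Rightarrow> tl"  ("(_ \<circ>\<^bsub>_\<^esub>/ _)" [56, 0, 55] 55) where
  "y \<circ>\<^bsub>A\<^esub> x = bilinear_ext (compose_basis A) y x"

definition tl_tensor :: "tl \<Rightarrow> tl \<Rightarrow> tl"  (infixr "\<otimes>" 70) where
  "x \<otimes> y = bilinear_ext (\<lambda>d e. basis (juxtapose d e)) x y"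

definition tl_id :: "nat \<Rightarrow> tl" where "tl_id n = basis (id_diagram n)"
definition tl_cap :: "nat \<Rightarrow> tl" where "tl_cap n = basis (cap_diagram n)"
definition tl_cup :: "nat \<Rightarrow> tl" where "tl_cup n = basis (cup_diagram n)"

text \<open>The complex number by which an endomorphism of 0 multiplies the empty diagram.\<close>

definition tl_value :: "tl \<Rightarrow> complex" where
  "tl_value x = Poly_Mapping.lookup x (Diagram 0 0 {})"

definition turn_back_top :: "nat \<Rightarrow> nat \<Rightarrow> tl" where
  "turn_back_top n s = tl_id s \<otimes> tl_cap 1 \<otimes> tl_id (n - 2 - s)"

definition turn_back_bot :: "nat \<Rightarrow> nat \<Rightarrow> tl" where
  "turn_back_bot n s = tl_id s \<otimes> tl_cup 1 \<otimes> tl_id (n - 2 - s)"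

definition jones_wenzl :: "complex \<Rightarrow> nat \<Rightarrow> tl" where
  "jones_wenzl A n = (THE f. f \<in> tl_hom n n \<and> f \<noteq> 0 \<and> f \<circ>\<^bsub>A\<^esub> f = f \<and>
     (\<forall>s. s + 2 \<le> n \<longrightarrow> turn_back_top n s \<circ>\<^bsub>A\<^esub> f = 0 \<and> f \<circ>\<^bsub>A\<^esub> turn_back_bot n s = 0))"


section \<open>Labelled diagrams\<close>

definition Delta :: "complex \<Rightarrow> nat \<Rightarrow> complex" where
  "Delta A n = (- 1) ^ n * (\<Sum>s = 0..n. A powi (2 * int n - 4 * int s))"

definition admissible :: "nat \<Rightarrow> nat \<Rightarrow> nat \<Rightarrow> bool" where
  "admissible a b c \<longleftrightarrow> even (a + b + c) \<and> a \<le> b + c \<and> b \<le> a + c \<and> c \<le> a + b"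

text \<open>
  Arcs labelled \<open>k\<close>.  The idempotent is written at both ends, so that these are visibly morphisms
  between \<open>\<one>\<close> and \<open>V\<^sub>k \<otimes> V\<^sub>k\<close> in the idempotent completion; since idempotents slide along arcs,
  one insertion would give the same morphism.
\<close>

definition arc_bot :: "nat \<Rightarrow> complex \<Rightarrow> tl" where
  "arc_bot k A = (jones_wenzl A k \<otimes> jones_wenzl A k) \<circ>\<^bsub>A\<^esub> tl_cup k"

definition arc_top :: "nat \<Rightarrow> complex \<Rightarrow> tl" where
  "arc_top k A = tl_cap k \<circ>\<^bsub>A\<^esub> (jones_wenzl A k \<otimes> jones_wenzl A k)"

text \<open>The 3-vertex with top legs \<open>a\<close>, \<open>b\<close> and bottom leg \<open>c\<close>, and its reflection.\<close>

definition vertex_merge :: "nat \<Rightarrow> nat \<Rightarrow> nat \<Rightarrow> complex \<Rightarrow> tl" where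
  "vertex_merge a b c A =
     (if admissible a b c
      then jones_wenzl A c \<circ>\<^bsub>A\<^esub>
             (tl_id ((a + c - b) div 2) \<otimes> tl_cap ((a + b - c) div 2) \<otimes> tl_id ((b + c - a) div 2)) \<circ>\<^bsub>A\<^esub>
             (jones_wenzl A a \<otimes> jones_wenzl A b)
      else 0)"

definition vertex_split :: "nat \<Rightarrow> nat \<Rightarrow> nat \<Rightarrow> complex \<Rightarrow> tl" where
  "vertex_split c a b A =
     (if admissible a b c
      then (jones_wenzl A a \<otimes> jones_wenzl A b) \<circ>\<^bsub>A\<^esub>
             (tl_id ((a + c - b) div 2) \<otimes> tl_cup ((a + b - c) div 2) \<otimes> tl_id ((b + c - a) div 2)) \<circ>\<^bsub>A\<^esub>
             jones_wenzl A c
      else 0)"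

text \<open>The theta graph, with the edge \<open>c\<close> closed up around the right-hand side.\<close>

definition theta :: "complex \<Rightarrow> nat \<Rightarrow> nat \<Rightarrow> nat \<Rightarrow> complex" where
  "theta A a b c = tl_value
     (arc_top c A \<circ>\<^bsub>A\<^esub>
      ((vertex_merge a b c A \<circ>\<^bsub>A\<^esub> vertex_split c a b A) \<otimes> jones_wenzl A c) \<circ>\<^bsub>A\<^esub>
      arc_bot c A)"


section \<open>The balanced theory\<close>

text \<open>
  Morphisms \<open>(m, m') \<rightarrow> (n, n')\<close> in the product category form the tensor product of a morphism
  space at parameter \<open>A\<close> and one at parameter \<open>A\<^sup>-\<^sup>1\<close>, which has the pairs of diagrams as a basis.
  In its idempotent completion, the identity morphism of an object given by an idempotent \<open>e\<close> is
  \<open>e\<close> itself.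
\<close>

type_synonym tl2 = "diagram \<times> diagram \<Rightarrow>\<^sub>0 complex"

definition box :: "tl \<Rightarrow> tl \<Rightarrow> tl2"  (infix "\<boxtimes>" 60) where
  "x \<boxtimes> y = bilinear_ext (\<lambda>d d'. basis (d, d')) x y"

definition tl2_comp :: "tl2 \<Rightarrow> complex \<Rightarrow> tl2 \<Rightarrow> tl2"  ("(_ \<bullet>\<^bsub>_\<^esub>/ _)" [56, 0, 55] 55) where
  "y \<bullet>\<^bsub>A\<^esub> x = bilinear_ext
     (\<lambda>(e, e') (d, d'). compose_basis A e d \<boxtimes> compose_basis (inverse A) e' d') y x"

definition tl2_tensor :: "tl2 \<Rightarrow> tl2 \<Rightarrow> tl2"  (infixr "\<odot>" 70) where
  "x \<odot> y = bilinear_ext (\<lambda>(d, d') (e, e'). basis (juxtapose d e, juxtapose d' e')) x y"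

text \<open>A diagram all of whose labels are balanced pairs.\<close>

definition balanced :: "complex \<Rightarrow> (complex \<Rightarrow> tl) \<Rightarrow> tl2" where
  "balanced A D = D A \<boxtimes> D (inverse A)"

definition idV :: "complex \<Rightarrow> nat \<Rightarrow> tl2" where
  "idV A k = balanced A (\<lambda>B. jones_wenzl B k)"

definition epsilon :: "complex \<Rightarrow> nat \<Rightarrow> tl2" where
  "epsilon A k = balanced A (arc_bot k)"

definition eta :: "complex \<Rightarrow> nat \<Rightarrow> tl2" where
  "eta A k = balanced A (arc_top k)"

text \<open>The Barrett--Crane 4-vertex with top legs \<open>i\<close>, \<open>j\<close> and bottom legs \<open>k\<close>, \<open>l\<close>.\<close>

definition bc_vertex :: "complex \<Rightarrow> nat \<Rightarrow> nat \<Rightarrow> nat \<Rightarrow> nat \<Rightarrow> tl2" where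
  "bc_vertex A i j k l =
     (\<Sum>n | admissible i j n \<and> admissible k l n.
        scale (Delta A n / (theta A i j n * theta A k l n))
          (balanced A (\<lambda>B. vertex_split n k l B \<circ>\<^bsub>B\<^esub> vertex_merge i j n B)))"

end

theory Submission
  imports Defs
begin

text \<open>
  Composition of diagrams depends on \<open>A\<close> only through the value \<open>- A\<^sup>2 - A\<^sup>-\<^sup>2\<close> of a loop, so both tensor factors
  live in the same Temperley--Lieb category.  There the ladders \<open>D\<^sub>n\<close> form an orthogonal basis of
  \<open>Hom(V\<^sub>i \<otimes> V\<^sub>j, V\<^sub>k \<otimes> V\<^sub>l)\<close> for the bilinear form \<open>(x, y) \<mapsto> tr(y\<^sup>* x)\<close>, where \<open>*\<close> is the reflection exchanging
  top and bottom, and \<open>D\<^sub>n\<close> has square norm \<open>\<theta>(i,j,n) \<theta>(k,l,n) / \<Delta>\<^sub>n\<close>.  Hence the Barrett--Crane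
  4-vertex is the canonical tensor of this form.  Rotation by one leg is an isometry, because the
  trace is spherical, and an isometry carries one canonical tensor to the other.

  Identities between diagrams are checked by counting colourings: giving every strand one of two
  colours embeds the diagrams into matrices of natural numbers, in which a loop counts 2.
\<close>

text \<open>Gluing is defined through a reflexive transitive closure, and two such closures are hard
  to compare directly. Counting colourings turns gluing into a product of matrices: once the outer
  ends are coloured, a component that reaches one of them has its colour forced, while every closed
  loop doubles the count. The support of the matrix records the diagram and the power of 2 records
  the loops, so equal counts give equal pairs of exponent and diagram, and hence an identity for
  every \<open>A\<close>.

  Colours do not see planarity, since crossing diagrams pass the same test. That composites of
  crossingless diagrams are crossingless is obtained by peeling off innermost arcs until single cups
  and caps remain. Planarity matters because it makes every non-identity endomorphism begin with a
  turn-back, and this is what pins down the Jones-Wenzl idempotent.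

  The non-vanishing of \<open>theta\<close> is a consequence of completeness: a vanishing bubble
  would kill all ladders and with them the 3-vertex. The isometry enters as an orthogonality
  relation for the rotation coefficients \<open>tet\<close>, which are the same in both tensor
  factors.\<close>

definition colour :: "bool list \<Rightarrow> bool list \<Rightarrow> point \<Rightarrow> bool" where
  "colour s t p = (if fst p = 0 then s ! snd p else t ! snd p)"

definition fits :: "diagram \<Rightarrow> bool list \<Rightarrow> bool list \<Rightarrow> bool" where
  "fits d s t \<longleftrightarrow> length s = tops d \<and> length t = bots d \<and>
     (\<forall>p q. (p, q) \<in> arcs d \<longrightarrow> colour s t p = colour s t q)"

text \<open>Set partitions of the endpoints, stored as an equivalence relation without its diagonal.
  Planarity and the size of the blocks are dropped: this weaker class is visibly closed under
  stacking, because a reflexive transitive closure restricted to the outer points is again an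
  equivalence relation, and colourings already separate its members.\<close>

definition partition_diagram :: "diagram \<Rightarrow> bool" where
  "partition_diagram d \<longleftrightarrow> arcs d \<subseteq> points (tops d) (bots d) \<times> points (tops d) (bots d) \<and>
     sym (arcs d) \<and> irrefl (arcs d) \<and>
     (\<forall>p q r. (p, q) \<in> arcs d \<longrightarrow> (q, r) \<in> arcs d \<longrightarrow> p \<noteq> r \<longrightarrow> (p, r) \<in> arcs d)"

lemma in_points_iff: "p \<in> points m n \<longleftrightarrow> fst p = 0 \<and> snd p < m \<or> fst p = 1 \<and> snd p < n"
  by (cases p) (auto simp: points_def)

text \<open>In a perfect matching a path \<open>p\<close>, \<open>q\<close>, \<open>r\<close> has
  \<open>p = r\<close>, so transitivity off the diagonal holds vacuously.\<close>

lemma diagrams_partition: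
  assumes "d \<in> diagrams m n"
  shows "partition_diagram d" "tops d = m" "bots d = n"
proof -
  from assms obtain R where d: "d = Diagram m n R" and R: "R \<subseteq> points m n \<times> points m n" "sym R" "irrefl R"
    "\<forall>p \<in> points m n. \<exists>!q. (p, q) \<in> R" by (auto simp: diagrams_def)
  have "p = r" if "(p, q) \<in> R" "(q, r) \<in> R" for p q r
    using that R(1,2,4) unfolding sym_def by blast
  then show "partition_diagram d" "tops d = m" "bots d = n"
    using R unfolding partition_diagram_def d by auto
qed

definition colour_list :: "nat \<Rightarrow> nat \<Rightarrow> (point \<Rightarrow> bool) \<Rightarrow> bool list" where
  "colour_list l n P = map (\<lambda>i. P (l, i)) [0..<n]"

lemma length_colour_list [simp]: "length (colour_list l n P) = n"
  by (simp add: colour_list_def)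

lemma colour_colour_list:
  "p \<in> points m n \<Longrightarrow> colour (colour_list 0 m P) (colour_list 1 n P) p = P p"
  by (cases p) (auto simp: points_def colour_def colour_list_def)

text \<open>If \<open>p\<close> and \<open>q\<close> lie in different blocks, painting the block of
  \<open>p\<close> in one colour and everything else in the other is a compatible colouring that
  separates them.\<close>

lemma partition_diagram_arc_iff:
  assumes d: "partition_diagram d" and p: "p \<in> points (tops d) (bots d)" and q: "q \<in> points (tops d) (bots d)"
  shows "p = q \<or> (p, q) \<in> arcs d \<longleftrightarrow> (\<forall>s t. fits d s t \<longrightarrow> colour s t p = colour s t q)"
proof
  assume "p = q \<or> (p, q) \<in> arcs d"
  then show "\<forall>s t. fits d s t \<longrightarrow> colour s t p = colour s t q" unfolding fits_def by metis
next
  assume r: "\<forall>s t. fits d s t \<longrightarrow> colour s t p = colour s t q"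
  define P where "P r \<longleftrightarrow> r = p \<or> (p, r) \<in> arcs d" for r
  let ?s = "colour_list 0 (tops d) P" and ?t = "colour_list 1 (bots d) P"
  have "P a = P b" if "(a, b) \<in> arcs d" for a b
    using that d unfolding P_def partition_diagram_def by (metis symD)
  then have "fits d ?s ?t"
    using d colour_colour_list unfolding fits_def partition_diagram_def
    by (metis (no_types, lifting) SigmaD1 SigmaD2 length_colour_list subsetD)
  with r have "P p = P q" using p q colour_colour_list by metis
  then show "p = q \<or> (p, q) \<in> arcs d" by (auto simp: P_def)
qed

lemma fits_faithful:
  assumes "partition_diagram d" "partition_diagram e" "tops d = tops e" "bots d = bots e"
    and "\<And>s t. length s = tops e \<Longrightarrow> length t = bots e \<Longrightarrow> fits d s t = fits e s t"
  shows "d = e"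
proof -
  have f: "fits d s t = fits e s t" for s t
  proof (cases "length s = tops e \<and> length t = bots e")
    case True
    then show ?thesis using assms(5) by blast
  next
    case False
    then show ?thesis using assms(3,4) unfolding fits_def by metis
  qed
  have sub: "x \<in> arcs e" if x: "x \<in> arcs d" and de: "partition_diagram d" "partition_diagram e"
      "tops d = tops e" "bots d = bots e" "\<And>s t. fits d s t = fits e s t" for x d e
  proof -
    obtain p q where pq: "x = (p, q)" by (cases x)
    have "p \<noteq> q" "p \<in> points (tops d) (bots d)" "q \<in> points (tops d) (bots d)"
      using x de(1) unfolding pq partition_diagram_def irrefl_def by blast+
    moreover have "\<forall>s t. fits e s t \<longrightarrow> colour s t p = colour s t q"
      using x fits_def pq de(5) by metis
    ultimately show ?thesis
      using partition_diagram_arc_iff[OF de(2), of p q] unfolding pq de(3,4) by blast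
  qed
  have "arcs d \<subseteq> arcs e" "arcs e \<subseteq> arcs d"
    using sub[OF _ assms(1-4) f] sub[OF _ assms(2,1) assms(3,4)[symmetric] f[symmetric]] by blast+
  then have "arcs d = arcs e" by auto
  then show ?thesis using assms(3,4) by (simp add: diagram.expand)
qed

section \<open>Stacking\<close>

text \<open>A diagram has levels 0 and 1, a stack has levels 0, 1 and 2; doubling the level sends
  the ends of the composite to the outer levels.\<close>

definition outer :: "point \<Rightarrow> point" where "outer p = (2 * fst p, snd p)"

lemma sym_stack:
  assumes "partition_diagram d" "partition_diagram e"
  shows "sym (stack d e)"
proof -
  have "sym (map_prod f f ` R)" if "sym R" for f :: "point \<Rightarrow> point" and R
    using that by (fastforce intro!: symI dest: symD)
  then show ?thesis using assms unfolding partition_diagram_def stack_def by (intro sym_Un) simp_all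
qed

lemma partition_stack:
  assumes d: "partition_diagram d" and e: "partition_diagram e"
  shows "partition_diagram (stack_diagram d e)"
proof -
  have s: "sym ((stack d e)\<^sup>*)" using sym_stack[OF assms] by (rule sym_rtrancl)
  then show ?thesis
    unfolding partition_diagram_def stack_diagram_def
    by (auto simp: sym_def irrefl_def intro: rtrancl_trans)
qed

lemma tops_stack [simp]: "tops (stack_diagram d e) = tops d"
  and bots_stack [simp]: "bots (stack_diagram d e) = bots e"
  by (simp_all add: stack_diagram_def)

definition colour3 :: "bool list \<Rightarrow> bool list \<Rightarrow> bool list \<Rightarrow> point \<Rightarrow> bool" where
  "colour3 s u t p = (if fst p = 0 then s ! snd p else if fst p = 1 then u ! snd p else t ! snd p)"

definition glued_points :: "nat \<Rightarrow> nat \<Rightarrow> nat \<Rightarrow> point set" where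
  "glued_points m k n = {0} \<times> {..<m} \<union> {1} \<times> {..<k} \<union> {2} \<times> {..<n}"

lemma stack_subset:
  assumes "partition_diagram d" "partition_diagram e" "bots d = tops e"
  shows "stack d e \<subseteq> glued_points (tops d) (bots d) (bots e) \<times> glued_points (tops d) (bots d) (bots e)"
proof -
  let ?G = "glued_points (tops d) (bots d) (bots e)"
  have 1: "p \<in> points (tops d) (bots d) \<Longrightarrow> p \<in> ?G" for p
    by (auto simp: glued_points_def points_def)
  have 2: "p \<in> points (tops e) (bots e) \<Longrightarrow> map_prod Suc id p \<in> ?G" for p
    by (auto simp: glued_points_def points_def assms(3))
  have "x \<in> ?G \<times> ?G" if "x \<in> arcs d" for x
    using that 1 assms(1) unfolding partition_diagram_def by (cases x) blast
  moreover have "map_prod (map_prod Suc id) (map_prod Suc id) x \<in> ?G \<times> ?G" if "x \<in> arcs e" for x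
    using that 2 assms(2) unfolding partition_diagram_def by (cases x) auto
  ultimately show ?thesis unfolding stack_def by (intro Un_least image_subsetI subsetI)
qed

lemma fits_both_iff:
  assumes "partition_diagram d" "partition_diagram e" "bots d = tops e"
    "length s = tops d" "length u = bots d" "length t = bots e"
  shows "fits d s u \<and> fits e u t \<longleftrightarrow> (\<forall>p q. (p, q) \<in> stack d e \<longrightarrow> colour3 s u t p = colour3 s u t q)"
proof -
  have 1: "colour s u p = colour3 s u t p" if "p \<in> points (tops d) (bots d)" for p
    using that by (auto simp: colour_def colour3_def in_points_iff)
  have 2: "colour u t p = colour3 s u t (map_prod Suc id p)" if "p \<in> points (tops e) (bots e)" for p
    using that by (cases p) (auto simp: colour_def colour3_def in_points_iff)
  have d: "p \<in> points (tops d) (bots d) \<and> q \<in> points (tops d) (bots d)" if "(p, q) \<in> arcs d" for p q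
    using that assms(1) by (auto simp: partition_diagram_def)
  have e: "p \<in> points (tops e) (bots e) \<and> q \<in> points (tops e) (bots e)" if "(p, q) \<in> arcs e" for p q
    using that assms(2) by (auto simp: partition_diagram_def)
  have fd: "fits d s u \<longleftrightarrow> (\<forall>p q. (p, q) \<in> arcs d \<longrightarrow> colour3 s u t p = colour3 s u t q)"
    unfolding fits_def using d 1 assms by metis
  have fe: "fits e u t \<longleftrightarrow> (\<forall>p q. (p, q) \<in> arcs e \<longrightarrow>
      colour3 s u t (map_prod Suc id p) = colour3 s u t (map_prod Suc id q))"
    unfolding fits_def using e 2 assms by metis
  show ?thesis unfolding fd fe stack_def by (fastforce simp del: split_paired_All)
qed

text \<open>The components of the glued graph decide everything. One that meets an outer end takes
  the colour of that end, which is consistent exactly when the boundary colours fit the composite;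
  one made of glued points only is a loop and is coloured freely. So the compatible \<open>u\<close>
  correspond to the sets \<open>S\<close> of loops that receive the colour
  \<open>True\<close>.\<close>

lemma card_fits:
  assumes d: "partition_diagram d" and e: "partition_diagram e" and k: "bots d = tops e"
    and s: "length s = tops d" and t: "length t = bots e"
  shows "card {u. fits d s u \<and> fits e u t} = of_bool (fits (stack_diagram d e) s t) * 2 ^ stack_loops d e"
proof -
  define R where "R = (stack d e)\<^sup>*"
  define G where "G = glued_points (tops d) (bots d) (bots e)"
  define inner where "inner = {1::nat} \<times> {..<bots d}"
  have symR: "(q, p) \<in> R" if "(p, q) \<in> R" for p q
    using sym_rtrancl[OF sym_stack[OF d e]] that unfolding R_def by (rule symD)
  have transR: "(p, r) \<in> R" if "(p, q) \<in> R" "(q, r) \<in> R" for p q r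
    using that unfolding R_def by (rule rtrancl_trans)
  have refR: "(p, p) \<in> R" for p by (simp add: R_def)
  have GR: "q \<in> G" if "(p, q) \<in> R" "p \<in> G" for p q
    using that unfolding R_def
    by (induction rule: rtrancl_induct) (use stack_subset[OF d e k] in \<open>auto simp: G_def\<close>)
  have cls: "R `` {p} = R `` {q} \<longleftrightarrow> (p, q) \<in> R" for p q
    using symR transR refR by blast
  define L where "L = {C \<in> inner // R. C \<subseteq> inner}"
  have loops: "stack_loops d e = card L" by (simp add: stack_loops_def L_def inner_def R_def)
  have "finite (inner // R)" unfolding quotient_def inner_def by simp
  then have finL: "finite L" by (simp add: L_def)
  define X where "X = {u. fits d s u \<and> fits e u t}"
  define const where "const u \<longleftrightarrow> (\<forall>p q. (p, q) \<in> R \<longrightarrow> colour3 s u t p = colour3 s u t q)" for u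
  have X: "u \<in> X \<longleftrightarrow> length u = bots d \<and> const u" for u
  proof -
    have "(\<forall>p q. (p, q) \<in> stack d e \<longrightarrow> colour3 s u t p = colour3 s u t q) \<longleftrightarrow> const u"
    proof
      assume a: "\<forall>p q. (p, q) \<in> stack d e \<longrightarrow> colour3 s u t p = colour3 s u t q"
      have "colour3 s u t p = colour3 s u t q" if "(p, q) \<in> R" for p q
        using that unfolding R_def by (induction rule: rtrancl_induct) (use a in \<open>auto simp del: split_paired_All\<close>)
      then show "const u" by (auto simp: const_def)
    next
      assume "const u"
      then show "\<forall>p q. (p, q) \<in> stack d e \<longrightarrow> colour3 s u t p = colour3 s u t q"
        unfolding const_def R_def by blast
    qed
    then show ?thesis
      using fits_both_iff[OF d e k s _ t, of u] unfolding X_def by (auto simp: fits_def)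
  qed
  have colour_outer: "colour3 s u t (outer p) = colour s t p" if "p \<in> points (tops d) (bots e)" for p u
    using that by (auto simp: in_points_iff outer_def colour3_def colour_def)
  have outer_G: "p \<in> G \<Longrightarrow> p \<notin> inner \<Longrightarrow> \<exists>q \<in> points (tops d) (bots e). p = outer q" for p
    unfolding G_def inner_def glued_points_def points_def outer_def by force
  have fits_stack: "fits (stack_diagram d e) s t \<longleftrightarrow>
     (\<forall>p\<in>points (tops d) (bots e). \<forall>q\<in>points (tops d) (bots e). (outer p, outer q) \<in> R \<longrightarrow> colour s t p = colour s t q)"
  proof -
    have "(p, q) \<in> arcs (stack_diagram d e) \<longleftrightarrow> p \<in> points (tops d) (bots e) \<and>
        q \<in> points (tops d) (bots e) \<and> p \<noteq> q \<and> (outer p, outer q) \<in> R" for p q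
      by (simp add: stack_diagram_def R_def outer_def)
    then show ?thesis using s t unfolding fits_def by (simp del: split_paired_All) metis
  qed
  show ?thesis
  proof (cases "fits (stack_diagram d e) s t")
    case False
    then obtain p q where pq: "p \<in> points (tops d) (bots e)" "q \<in> points (tops d) (bots e)"
      "(outer p, outer q) \<in> R" "colour s t p \<noteq> colour s t q" using fits_stack by blast
    have "\<not> const u" for u using pq colour_outer unfolding const_def by metis
    then have "X = {}" using X by auto
    then have "card X = 0" by simp
    then show ?thesis using False unfolding X_def by simp
  next
    case True
    \<comment> \<open>A point of a loop gets its colour from \<open>S\<close>; any other point
      copies an outer end of its component. The choice of that end is harmless because the boundary
      colours are constant on components.\<close>
    define h where "h S p = (if R `` {p} \<subseteq> inner then R `` {p} \<in> S
        else colour s t (SOME q. q \<in> points (tops d) (bots e) \<and> (p, outer q) \<in> R))" for S p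
    define g where "g S = map (\<lambda>i. h S (1, i)) [0..<bots d]" for S
    have ex: "\<exists>q. q \<in> points (tops d) (bots e) \<and> (p, outer q) \<in> R" if "p \<in> G" "\<not> R `` {p} \<subseteq> inner" for p
      using that outer_G GR by (metis Image_singleton_iff subsetI)
    have h_outer: "h S (outer q) = colour s t q" if q: "q \<in> points (tops d) (bots e)" for S q
    proof -
      have "outer q \<notin> inner" by (auto simp: outer_def inner_def)
      then have n: "\<not> R `` {outer q} \<subseteq> inner" using refR by blast
      define r where "r = (SOME r. r \<in> points (tops d) (bots e) \<and> (outer q, outer r) \<in> R)"
      have "r \<in> points (tops d) (bots e) \<and> (outer q, outer r) \<in> R"
        unfolding r_def by (rule someI[of _ q]) (use q refR in auto)
      then have "colour s t r = colour s t q" using True q unfolding fits_stack by metis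
      then show ?thesis using n unfolding h_def r_def by simp
    qed
    have h_const: "h S p = h S q" if "(p, q) \<in> R" for S p q
    proof -
      have a: "R `` {p} = R `` {q}" using that cls by blast
      then have "(p, x) \<in> R \<longleftrightarrow> (q, x) \<in> R" for x by blast
      with a show ?thesis unfolding h_def by simp
    qed
    have g_h: "colour3 s (g S) t p = h S p" if "p \<in> G" for S p
    proof (cases "p \<in> inner")
      case True
      then show ?thesis by (auto simp: colour3_def g_def inner_def)
    next
      case False
      then show ?thesis using outer_G that colour_outer h_outer by metis
    qed
    \<comment> \<open>Off \<open>G\<close> the function \<open>colour3\<close> may index its lists
      out of range, with arbitrary results; there every component is a single point, so constancy on
      components holds anyway.\<close>
    have diag: "colour3 s u t p = colour3 s u t q" if "(p, q) \<in> R" "p \<notin> G" for u p q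
    proof -
      from that(1) have "p = q" unfolding R_def
        by (cases rule: converse_rtranclE) (use stack_subset[OF d e k] that(2) in \<open>auto simp: G_def\<close>)
      then show ?thesis by simp
    qed
    have g_X: "g S \<in> X" for S
    proof -
      have "colour3 s (g S) t p = colour3 s (g S) t q" if "(p, q) \<in> R" for p q
      proof (cases "p \<in> G")
        case True
        then have "q \<in> G" using GR that by blast
        then show ?thesis using True g_h h_const that by simp
      next
        case False
        then show ?thesis using diag that by blast
      qed
      then show ?thesis unfolding X const_def by (simp add: g_def)
    qed
    have inner_G: "inner \<subseteq> G" by (auto simp: inner_def G_def glued_points_def)
    define f where "f u = {C \<in> L. \<forall>p\<in>C. colour3 s u t p}" for u
    have fg: "f (g S) = S" if "S \<subseteq> L" for S
    proof -
      have "(\<forall>p\<in>C. colour3 s (g S) t p) \<longleftrightarrow> C \<in> S" if C: "C \<in> L" for C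
      proof -
        obtain p where p: "p \<in> inner" "C = R `` {p}" using C by (auto simp: L_def quotient_def)
        have "colour3 s (g S) t q \<longleftrightarrow> C \<in> S" if "q \<in> C" for q
        proof -
          have "R `` {q} = C" using p that cls by blast
          moreover have "q \<in> G" using that C inner_G by (auto simp: L_def)
          ultimately show ?thesis using C g_h by (auto simp: h_def L_def)
        qed
        moreover have "p \<in> C" using p refR by blast
        ultimately show ?thesis by blast
      qed
      then show ?thesis using that by (auto simp: f_def)
    qed
    have gf: "g (f u) = u" if u: "u \<in> X" for u
    proof (rule nth_equalityI)
      show "length (g (f u)) = length u" using u X by (simp add: g_def)
      fix i assume "i < length (g (f u))"
      then have i: "i < bots d" by (simp add: g_def)
      then have iG: "(1, i) \<in> inner" by (simp add: inner_def)
      have c: "colour3 s u t p = colour3 s u t q" if "(p, q) \<in> R" for p q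
        using u X that unfolding const_def by blast
      have "h (f u) (1, i) = colour3 s u t (1, i)"
      proof (cases "R `` {(1, i)} \<subseteq> inner")
        case True
        then have "R `` {(1, i)} \<in> L" using iG by (auto simp: L_def quotient_def)
        then have "R `` {(1, i)} \<in> f u \<longleftrightarrow> (\<forall>q. ((1, i), q) \<in> R \<longrightarrow> colour3 s u t q)" by (auto simp: f_def)
        also have "\<dots> \<longleftrightarrow> colour3 s u t (1, i)" using c refR by blast
        finally show ?thesis using True by (simp add: h_def)
      next
        case False
        define r where "r = (SOME r. r \<in> points (tops d) (bots e) \<and> ((1, i), outer r) \<in> R)"
        have "r \<in> points (tops d) (bots e) \<and> ((1, i), outer r) \<in> R"
          unfolding r_def by (rule someI_ex[OF ex]) (use iG inner_G False in auto)
        then have "colour s t r = colour3 s u t (1, i)" using c colour_outer by metis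
        then show ?thesis using False unfolding h_def r_def by simp
      qed
      then show "g (f u) ! i = u ! i" using i by (simp add: g_def colour3_def)
    qed
    have "bij_betw g (Pow L) X"
      by (rule bij_betw_byWitness[where f' = f]) (use fg gf g_X in \<open>auto simp: f_def\<close>)
    then have "card X = card (Pow L)" by (metis bij_betw_same_card)
    then show ?thesis using True finL by (simp add: X_def loops card_Pow)
  qed
qed

section \<open>Weights of monomials\<close>

abbreviation bl :: "nat \<Rightarrow> bool list set" where "bl n \<equiv> {u. length u = n}"

lemma finite_bl [simp]: "finite (bl n)"
  using finite_lists_length_eq[of "UNIV :: bool set" n] by simp

lemma sum_bl_add: "(\<Sum>u\<in>bl (a + b). f u) = (\<Sum>u\<in>bl a. \<Sum>v\<in>bl b. f (u @ v))"
proof -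
  have "(\<Sum>u\<in>bl (a + b). f u) = (\<Sum>(u, v)\<in>bl a \<times> bl b. f (u @ v))"
    by (rule sum.reindex_bij_witness[where i = "\<lambda>(u, v). u @ v" and j = "\<lambda>u. (take a u, drop a u)"]) auto
  then show ?thesis by (simp add: sum.cartesian_product)
qed

lemma sum_bl_1: "(\<Sum>u\<in>bl (Suc 0). f u) = f [False] + f [True]"
proof -
  have "bl (Suc 0) = {[False], [True]}" by (auto simp: length_Suc_conv)
  then show ?thesis by simp
qed

text \<open>Nested arcs force a palindrome, and a palindrome of even length is
  \<open>w @ rev w\<close> for its first half \<open>w\<close>.\<close>

lemma sum_bl_pal: "(\<Sum>v\<in>bl (2 * k). of_bool (rev v = v) * f v) = (\<Sum>w\<in>bl k. f (w @ rev w))"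
  for f :: "bool list \<Rightarrow> nat"
proof -
  have "(\<Sum>v\<in>bl (2 * k). of_bool (rev v = v) * f v) = (\<Sum>v\<in>bl (2 * k) \<inter> {v. rev v = v}. f v)"
    by (rule sum.mono_neutral_cong_right) auto
  also have "\<dots> = (\<Sum>w\<in>bl k. f (w @ rev w))"
  proof (rule sum.reindex_bij_witness[where i = "\<lambda>w. w @ rev w" and j = "take k"])
    fix v assume v: "v \<in> bl (2 * k) \<inter> {v. rev v = v}"
    then have "rev (take k v) = drop k v" by (simp add: rev_take)
    then show "take k v @ rev (take k v) = v" "f (take k v @ rev (take k v)) = f v" by simp_all
    show "take k v \<in> bl k" using v by simp
  qed auto
  finally show ?thesis .
qed

lemma sum_bl_delta [simp]:
  fixes f :: "bool list \<Rightarrow> nat"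
  shows "(\<Sum>u\<in>bl n. of_bool (s = u) * f u) = of_bool (length s = n) * f s"
    "(\<Sum>u\<in>bl n. of_bool (u = s) * f u) = of_bool (length s = n) * f s"
    "(\<Sum>u\<in>bl n. f u * of_bool (s = u)) = of_bool (length s = n) * f s"
    "(\<Sum>u\<in>bl n. f u * of_bool (u = s)) = of_bool (length s = n) * f s"
  by (simp_all add: of_bool_def if_distrib[of "\<lambda>x. x * _"] if_distrib[of "\<lambda>x. _ * x"] cong: if_cong)

section \<open>Monomials: diagrams with a power of the loop value\<close>

type_synonym monomial = "nat \<times> diagram"

text \<open>The pair \<open>(a, d)\<close> stands for \<open>\<delta>\<^sup>a d\<close>, where \<open>\<delta>\<close> is the value of a loop.  Two colours
  give every loop the weight 2, which is enough to recover both \<open>a\<close> and \<open>d\<close>.\<close>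

definition wt :: "monomial \<Rightarrow> bool list \<Rightarrow> bool list \<Rightarrow> nat" where
  "wt x s t = 2 ^ fst x * of_bool (fits (snd x) s t)"

definition mcomp :: "monomial \<Rightarrow> monomial \<Rightarrow> monomial" where
  "mcomp y x = (fst y + fst x + stack_loops (snd x) (snd y), stack_diagram (snd x) (snd y))"

definition mtens :: "monomial \<Rightarrow> monomial \<Rightarrow> monomial" where
  "mtens x y = (fst x + fst y, juxtapose (snd x) (snd y))"

definition flip :: "diagram \<Rightarrow> diagram" where
  "flip d = Diagram (bots d) (tops d) {((1 - a, i), (1 - b, j)) | a i b j. ((a, i), (b, j)) \<in> arcs d}"

definition mflip :: "monomial \<Rightarrow> monomial" where "mflip x = (fst x, flip (snd x))"

definition mid :: "nat \<Rightarrow> monomial" where "mid n = (0, id_diagram n)"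
definition mcap :: "nat \<Rightarrow> monomial" where "mcap n = (0, cap_diagram n)"
definition mcup :: "nat \<Rightarrow> monomial" where "mcup n = (0, cup_diagram n)"

definition mtops :: "monomial \<Rightarrow> nat" where "mtops x = tops (snd x)"
definition mbots :: "monomial \<Rightarrow> nat" where "mbots x = bots (snd x)"
definition mgood :: "monomial \<Rightarrow> bool" where "mgood x \<longleftrightarrow> partition_diagram (snd x)"

lemma mtops_simps [simp]:
  "mtops (mcomp y x) = mtops x" "mtops (mtens x y) = mtops x + mtops y" "mtops (mflip x) = mbots x"
  "mtops (mid n) = n" "mtops (mcap n) = 2 * n" "mtops (mcup n) = 0"
  by (simp_all add: mtops_def mbots_def mcomp_def mtens_def mflip_def mid_def mcap_def mcup_def
      juxtapose_def flip_def id_diagram_def cap_diagram_def cup_diagram_def)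

lemma mbots_simps [simp]:
  "mbots (mcomp y x) = mbots y" "mbots (mtens x y) = mbots x + mbots y" "mbots (mflip x) = mtops x"
  "mbots (mid n) = n" "mbots (mcap n) = 0" "mbots (mcup n) = 2 * n"
  by (simp_all add: mtops_def mbots_def mcomp_def mtens_def mflip_def mid_def mcap_def mcup_def
      juxtapose_def flip_def id_diagram_def cap_diagram_def cup_diagram_def)

lemma partition_diagramI:
  assumes "\<And>p q. (p, q) \<in> arcs d \<Longrightarrow> p \<in> points (tops d) (bots d) \<and> q \<in> points (tops d) (bots d)"
    "sym (arcs d)" "\<And>p. (p, p) \<notin> arcs d"
    "\<And>p q r. (p, q) \<in> arcs d \<Longrightarrow> (q, r) \<in> arcs d \<Longrightarrow> p \<noteq> r \<Longrightarrow> (p, r) \<in> arcs d"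
  shows "partition_diagram d"
  using assms unfolding partition_diagram_def irrefl_def by (auto simp del: split_paired_All)

lemma partition_diagramD:
  assumes "partition_diagram d"
  shows "(p, q) \<in> arcs d \<Longrightarrow> p \<in> points (tops d) (bots d) \<and> q \<in> points (tops d) (bots d)"
    "sym (arcs d)" "(p, p) \<notin> arcs d" "(p, q) \<in> arcs d \<Longrightarrow> (q, p) \<in> arcs d"
    "(p, q) \<in> arcs d \<Longrightarrow> (q, r) \<in> arcs d \<Longrightarrow> p \<noteq> r \<Longrightarrow> (p, r) \<in> arcs d"
  using assms unfolding partition_diagram_def irrefl_def sym_def by blast+

lemma arcs_flip: "((a, i), (b, j)) \<in> arcs (flip d) \<longleftrightarrow> (\<exists>a' b'. a = 1 - a' \<and> b = 1 - b' \<and> ((a', i), (b', j)) \<in> arcs d)"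
  by (auto simp: flip_def)

text \<open>Truncated subtraction makes \<open>1 - a\<close> an involution on the levels 0 and 1
  only; elsewhere it would identify distinct points. The ends of a \<open>partition_diagram\<close>
  lie on these two levels, so the existential quantifiers of \<open>arcs_flip\<close> can be
  solved.\<close>

lemma arcs_flip_good:
  assumes "partition_diagram d"
  shows "(p, q) \<in> arcs (flip d) \<longleftrightarrow> fst p \<le> 1 \<and> fst q \<le> 1 \<and> ((1 - fst p, snd p), (1 - fst q, snd q)) \<in> arcs d"
proof -
  have "a \<le> 1 \<and> b \<le> 1" if "((a, i), (b, j)) \<in> arcs d" for a i b j
    using that assms unfolding partition_diagram_def by (force simp: in_points_iff)
  then show ?thesis using arcs_flip[of "fst p" "snd p" "fst q" "snd q" d]
    by (auto; metis diff_diff_cancel diff_le_self)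
qed

lemma flip_points: "fst p \<le> 1 \<Longrightarrow> (1 - fst p, snd p) \<in> points m n \<longleftrightarrow> p \<in> points n m"
  by (cases p) (auto simp: in_points_iff)

lemma tops_flip [simp]: "tops (flip d) = bots d" and bots_flip [simp]: "bots (flip d) = tops d"
  by (simp_all add: flip_def)

lemma partition_flip: 
  assumes d: "partition_diagram d"
  shows "partition_diagram (flip d)"
proof -
  note a = arcs_flip_good[OF d]
  have inj: "p = q" if "(1 - fst p, snd p) = (1 - fst q, snd q)" "fst p \<le> 1" "fst q \<le> 1" for p q :: point
    using that by (cases p; cases q) auto
  have "p \<in> points (bots d) (tops d) \<and> q \<in> points (bots d) (tops d)" if "(p, q) \<in> arcs (flip d)" for p q
    using that d flip_points unfolding a partition_diagram_def by blast
  moreover have "sym (arcs (flip d))"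
    using partition_diagramD(4)[OF d] unfolding sym_def a by blast
  moreover have "(p, p) \<notin> arcs (flip d)" for p
    using partition_diagramD(3)[OF d] unfolding a by blast
  moreover have "(p, r) \<in> arcs (flip d)" if "(p, q) \<in> arcs (flip d)" "(q, r) \<in> arcs (flip d)" "p \<noteq> r" for p q r
  proof -
    have "(1 - fst p, snd p) \<noteq> (1 - fst r, snd r)" using inj that unfolding a by blast
    then show ?thesis using partition_diagramD(5)[OF d] that(1,2) unfolding a by blast
  qed
  ultimately show ?thesis by (intro partition_diagramI) simp_all
qed

lemma fits_flip:
  assumes d: "partition_diagram d"
  shows "fits (flip d) s t = fits d t s"
proof -
  have c: "colour s t p = colour t s (1 - fst p, snd p)" if "fst p \<le> 1" for p
    using that by (cases p) (auto simp: colour_def)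
  have l: "fst p \<le> 1 \<and> fst q \<le> 1" if "(p, q) \<in> arcs d" for p q
    using that d unfolding partition_diagram_def by (force simp: in_points_iff)
  have m: "(1 - fst (1 - fst p, snd p), snd (1 - fst p, snd p)) = p" if "fst p \<le> 1" for p :: point
    using that by (cases p) auto
  have "(\<forall>p q. (p, q) \<in> arcs (flip d) \<longrightarrow> colour s t p = colour s t q) \<longleftrightarrow>
      (\<forall>p q. (p, q) \<in> arcs d \<longrightarrow> colour t s p = colour t s q)" (is "?L \<longleftrightarrow> ?R")
  proof
    assume L: ?L
    show ?R
    proof (intro allI impI)
      fix p q assume pq: "(p, q) \<in> arcs d"
      let ?p = "(1 - fst p, snd p)" and ?q = "(1 - fst q, snd q)"
      have "(?p, ?q) \<in> arcs (flip d)"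
        unfolding arcs_flip_good[OF d] using pq l[OF pq] m by simp
      then have "colour s t ?p = colour s t ?q" using L by blast
      then show "colour t s p = colour t s q" using c[of ?p] c[of ?q] m l[OF pq] by simp
    qed
  next
    assume R: ?R
    then show ?L unfolding arcs_flip_good[OF d] using c by metis
  qed
  then show ?thesis unfolding fits_def by auto
qed

lemma arcs_juxtapose: 
  "(p, q) \<in> arcs (juxtapose d e) \<longleftrightarrow> (p, q) \<in> arcs d \<or>
     (\<exists>p' q'. (p', q') \<in> arcs e \<and> p = shift_right d p' \<and> q = shift_right d q')"
  by (auto simp: juxtapose_def)

lemma shift_right_inj: "shift_right d p = shift_right d q \<longleftrightarrow> p = q"
  by (cases p; cases q) (auto simp: shift_right_def)

lemma shift_right_points:
  "shift_right d p \<in> points (tops d + m) (bots d + n) \<longleftrightarrow> p \<in> points m n"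
  "shift_right d p \<notin> points (tops d) (bots d)"
  by (auto simp: shift_right_def in_points_iff)

lemma points_mono: "p \<in> points m n \<Longrightarrow> p \<in> points (m + m') (n + n')"
  by (auto simp: in_points_iff)

lemma tops_juxtapose [simp]: "tops (juxtapose d e) = tops d + tops e"
  and bots_juxtapose [simp]: "bots (juxtapose d e) = bots d + bots e"
  by (simp_all add: juxtapose_def)

lemma partition_juxtapose:
  assumes d: "partition_diagram d" and e: "partition_diagram e"
  shows "partition_diagram (juxtapose d e)"
proof -
  have dp: "p \<in> points (tops d) (bots d) \<and> q \<in> points (tops d) (bots d)" if "(p, q) \<in> arcs d" for p q
    using that d unfolding partition_diagram_def by blast
  have ep: "p \<in> points (tops e) (bots e) \<and> q \<in> points (tops e) (bots e)" if "(p, q) \<in> arcs e" for p q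
    using that e unfolding partition_diagram_def by blast
  let ?P = "points (tops d + tops e) (bots d + bots e)"
  have "p \<in> ?P \<and> q \<in> ?P" if "(p, q) \<in> arcs (juxtapose d e)" for p q
    using that dp ep unfolding arcs_juxtapose by (metis points_mono shift_right_points(1))
  moreover have "sym (arcs (juxtapose d e))"
    using d e unfolding partition_diagram_def sym_def arcs_juxtapose by blast
  moreover have "(p, p) \<notin> arcs (juxtapose d e)" for p
    using partition_diagramD(3)[OF d] partition_diagramD(3)[OF e] unfolding arcs_juxtapose
    by (metis shift_right_inj)
  moreover have "(p, r) \<in> arcs (juxtapose d e)"
    if pq: "(p, q) \<in> arcs (juxtapose d e)" and qr: "(q, r) \<in> arcs (juxtapose d e)" and "p \<noteq> r" for p q r
  proof (cases "q \<in> points (tops d) (bots d)")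
    case True
    then have "(p, q) \<in> arcs d" "(q, r) \<in> arcs d"
      using pq qr shift_right_points(2) unfolding arcs_juxtapose by blast+
    then show ?thesis using partition_diagramD(5)[OF d] \<open>p \<noteq> r\<close> unfolding arcs_juxtapose by blast
  next
    case False
    then obtain p' q' q'' r' where *: "(p', q') \<in> arcs e" "p = shift_right d p'" "q = shift_right d q'"
       "(q'', r') \<in> arcs e" "q = shift_right d q''" "r = shift_right d r'"
      using pq qr dp unfolding arcs_juxtapose by blast
    then have "q' = q''" "p' \<noteq> r'" using \<open>p \<noteq> r\<close> shift_right_inj by blast+
    then have "(p', r') \<in> arcs e" using * partition_diagramD(5)[OF e] by blast
    then show ?thesis using * unfolding arcs_juxtapose by blast
  qed
  ultimately show ?thesis by (intro partition_diagramI) simp_all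
qed

lemma fits_juxtapose:
  assumes d: "partition_diagram d" and e: "partition_diagram e"
  shows "fits (juxtapose d e) s t \<longleftrightarrow> fits d (take (tops d) s) (take (bots d) t) \<and>
     fits e (drop (tops d) s) (drop (bots d) t)"
proof (cases "length s = tops d + tops e \<and> length t = bots d + bots e")
  case False
  then show ?thesis by (auto simp: fits_def)
next
  case l: True
  have 1: "colour s t p = colour (take (tops d) s) (take (bots d) t) p" if "p \<in> points (tops d) (bots d)" for p
    using that by (auto simp: colour_def in_points_iff)
  have 2: "colour s t (shift_right d p) = colour (drop (tops d) s) (drop (bots d) t) p"
    if "p \<in> points (tops e) (bots e)" for p
    using that l by (auto simp: colour_def in_points_iff shift_right_def)
  have dp: "p \<in> points (tops d) (bots d) \<and> q \<in> points (tops d) (bots d)" if "(p, q) \<in> arcs d" for p q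
    using that d unfolding partition_diagram_def by blast
  have ep: "p \<in> points (tops e) (bots e) \<and> q \<in> points (tops e) (bots e)" if "(p, q) \<in> arcs e" for p q
    using that e unfolding partition_diagram_def by blast
  have "(\<forall>p q. (p, q) \<in> arcs (juxtapose d e) \<longrightarrow> colour s t p = colour s t q) \<longleftrightarrow>
    (\<forall>p q. (p, q) \<in> arcs d \<longrightarrow> colour s t p = colour s t q) \<and>
    (\<forall>p q. (p, q) \<in> arcs e \<longrightarrow> colour s t (shift_right d p) = colour s t (shift_right d q))"
    unfolding arcs_juxtapose by blast
  moreover have "(\<forall>p q. (p, q) \<in> arcs d \<longrightarrow> colour s t p = colour s t q) \<longleftrightarrow>
      fits d (take (tops d) s) (take (bots d) t)"
    using l dp 1 unfolding fits_def by (simp del: split_paired_All)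
  moreover have "(\<forall>p q. (p, q) \<in> arcs e \<longrightarrow> colour s t (shift_right d p) = colour s t (shift_right d q)) \<longleftrightarrow>
      fits e (drop (tops d) s) (drop (bots d) t)"
    using l ep 2 unfolding fits_def by (simp del: split_paired_All)
  ultimately show ?thesis using l unfolding fits_def[of "juxtapose d e"] by simp
qed

lemma partition_id: "partition_diagram (id_diagram n)"
  unfolding partition_diagram_def id_diagram_def by (auto simp: in_points_iff sym_def irrefl_def)

lemma fits_id: "fits (id_diagram n) s t \<longleftrightarrow> length s = n \<and> s = t"
proof -
  have "(\<forall>p q. (p, q) \<in> arcs (id_diagram n) \<longrightarrow> colour s t p = colour s t q) \<longleftrightarrow> (\<forall>i<n. s ! i = t ! i)"
    unfolding id_diagram_def by (auto simp: colour_def)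
  then show ?thesis unfolding fits_def by (auto simp: id_diagram_def intro: nth_equalityI)
qed

lemma partition_cap: "partition_diagram (cap_diagram n)"
  unfolding partition_diagram_def cap_diagram_def by (auto simp: in_points_iff sym_def irrefl_def) presburger

lemma partition_cup: "partition_diagram (cup_diagram n)"
  unfolding partition_diagram_def cup_diagram_def by (auto simp: in_points_iff sym_def irrefl_def) presburger

lemma fits_cap: "fits (cap_diagram n) s t \<longleftrightarrow> length s = 2 * n \<and> t = [] \<and> rev s = s"
proof -
  have "(\<forall>p q. (p, q) \<in> arcs (cap_diagram n) \<longrightarrow> colour s t p = colour s t q) \<longleftrightarrow>
      (\<forall>i<2 * n. s ! i = s ! (2 * n - 1 - i))"
    unfolding cap_diagram_def by (auto simp: colour_def)
  also have "\<dots> \<longleftrightarrow> rev s = s" if "length s = 2 * n"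
    using that by (auto simp: list_eq_iff_nth_eq rev_nth)
  finally show ?thesis unfolding fits_def by (auto simp: cap_diagram_def)
qed

lemma fits_cup: "fits (cup_diagram n) s t \<longleftrightarrow> s = [] \<and> length t = 2 * n \<and> rev t = t"
proof -
  have "(\<forall>p q. (p, q) \<in> arcs (cup_diagram n) \<longrightarrow> colour s t p = colour s t q) \<longleftrightarrow>
      (\<forall>i<2 * n. t ! i = t ! (2 * n - 1 - i))"
    unfolding cup_diagram_def by (auto simp: colour_def)
  also have "\<dots> \<longleftrightarrow> rev t = t" if "length t = 2 * n"
    using that by (auto simp: list_eq_iff_nth_eq rev_nth)
  finally show ?thesis unfolding fits_def by (auto simp: cup_diagram_def)
qed

lemma mgood_simps [simp]:
  "mgood x \<Longrightarrow> mgood y \<Longrightarrow> mgood (mcomp y x)" "mgood x \<Longrightarrow> mgood y \<Longrightarrow> mgood (mtens x y)"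
  "mgood x \<Longrightarrow> mgood (mflip x)" "mgood (mid n)" "mgood (mcap n)" "mgood (mcup n)"
  by (simp_all add: mgood_def mcomp_def mtens_def mflip_def mid_def mcap_def mcup_def partition_stack
      partition_juxtapose partition_flip partition_id partition_cap partition_cup)

lemma wt_mid [simp]: "wt (mid n) s t = of_bool (length s = n \<and> s = t)"
  and wt_mcap [simp]: "wt (mcap n) s t = of_bool (length s = 2 * n \<and> t = [] \<and> rev s = s)"
  and wt_mcup [simp]: "wt (mcup n) s t = of_bool (s = [] \<and> length t = 2 * n \<and> rev t = t)"
  by (simp_all add: wt_def mid_def mcap_def mcup_def fits_id fits_cap fits_cup)

lemma wt_mflip [simp]: "mgood x \<Longrightarrow> wt (mflip x) s t = wt x t s"
  by (simp add: wt_def mflip_def mgood_def fits_flip)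

lemma wt_mtens [simp]: "mgood x \<Longrightarrow> mgood y \<Longrightarrow> wt (mtens x y) s t =
    wt x (take (mtops x) s) (take (mbots x) t) * wt y (drop (mtops x) s) (drop (mbots x) t)"
  by (simp add: wt_def mtens_def mgood_def mtops_def mbots_def fits_juxtapose power_add)

lemma wt_outside: "length s \<noteq> mtops x \<or> length t \<noteq> mbots x \<Longrightarrow> wt x s t = 0"
  by (auto simp: wt_def fits_def mtops_def mbots_def)

text \<open>Weights are matrices indexed by colourings, and by \<open>card_fits\<close> stacking is
  their product: the exponents add up, and the loops created by gluing appear as the multiplicity of
  the sum.\<close>

lemma wt_mcomp [simp]:
  assumes "mgood x" "mgood y" "mbots x = mtops y"
  shows "wt (mcomp y x) s t = (\<Sum>u\<in>bl (mbots x). wt x s u * wt y u t)"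
proof (cases "length s = mtops x \<and> length t = mbots y")
  case True
  have "(\<Sum>u\<in>bl (mbots x). wt x s u * wt y u t) =
      2 ^ (fst y + fst x) * (\<Sum>u\<in>bl (mbots x). of_bool (fits (snd x) s u \<and> fits (snd y) u t))"
    unfolding sum_distrib_left wt_def by (intro sum.cong) (auto simp: power_add)
  also have "(\<Sum>u\<in>bl (mbots x). of_bool (fits (snd x) s u \<and> fits (snd y) u t)) =
      card {u. fits (snd x) s u \<and> fits (snd y) u t}"
  proof -
    have "bl (mbots x) \<inter> {u. fits (snd x) s u \<and> fits (snd y) u t} = {u. fits (snd x) s u \<and> fits (snd y) u t}"
      by (auto simp: fits_def mbots_def)
    then show ?thesis by (simp add: sum_of_bool_eq)
  qed
  also have "\<dots> = of_bool (fits (stack_diagram (snd x) (snd y)) s t) * 2 ^ stack_loops (snd x) (snd y)"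
    using assms True by (intro card_fits) (auto simp: mgood_def mtops_def mbots_def)
  finally show ?thesis by (simp add: wt_def mcomp_def power_add)
next
  case False
  then have "wt (mcomp y x) s t = 0" by (intro wt_outside) auto
  moreover have "wt x s u * wt y u t = 0" for u
    using False wt_outside[of s x u] wt_outside[of u y t] by auto
  ultimately show ?thesis by simp
qed

text \<open>The constant colouring fits every diagram, so its weight is a pure power of 2 that
  reveals the exponent; once the exponents agree, the remaining 0-1 matrices determine the diagrams
  by \<open>fits_faithful\<close>. This rule turns planar isotopies into identities of finite
  sums.\<close>

lemma mono_eqI:
  assumes "mgood x" "mgood y" "mtops x = mtops y" "mbots x = mbots y"
    and "\<And>s t. length s = mtops y \<Longrightarrow> length t = mbots y \<Longrightarrow> wt x s t = wt y s t"
  shows "x = y"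
proof -
  let ?s = "replicate (mtops x) False" and ?t = "replicate (mbots x) False"
  have f: "fits (snd z) ?s ?t" if "mgood z" "mtops z = mtops x" "mbots z = mbots x" for z
  proof -
    have "colour ?s ?t p = False" if "p \<in> points (mtops x) (mbots x)" for p
      using that by (auto simp: colour_def in_points_iff)
    then show ?thesis using that unfolding fits_def mgood_def partition_diagram_def mtops_def mbots_def by fastforce
  qed
  have "wt x ?s ?t = wt y ?s ?t" using assms(3-5) by simp
  then have a: "fst x = fst y" using f[of x] f[of y] assms(1-4) by (simp add: wt_def)
  have "fits (snd x) s t = fits (snd y) s t" if "length s = mtops y" "length t = mbots y" for s t
    using assms(5)[OF that] a by (auto simp: wt_def of_bool_def split: if_splits)
  then have "snd x = snd y"
    using assms unfolding mgood_def mtops_def mbots_def by (intro fits_faithful) auto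
  with a show ?thesis by (simp add: prod_eq_iff)
qed

section \<open>Planar isotopies\<close>

text \<open>Associativity of the matrix product. The exponents are part of the equation, so it also
  says that gluing in either order creates the same total number of loops.\<close>

lemma mcomp_assoc:
  assumes "mgood x" "mgood y" "mgood z" "mbots x = mtops y" "mbots y = mtops z"
  shows "mcomp z (mcomp y x) = mcomp (mcomp z y) x"
proof (rule mono_eqI)
  fix s t
  show "wt (mcomp z (mcomp y x)) s t = wt (mcomp (mcomp z y) x) s t"
    using assms by (simp add: sum_distrib_left sum_distrib_right mult.assoc) (rule sum.swap)
qed (use assms in auto)

lemma mcomp_mid [simp]:
  "mgood x \<Longrightarrow> mbots x = n \<Longrightarrow> mcomp (mid n) x = x"
  "mgood x \<Longrightarrow> mtops x = n \<Longrightarrow> mcomp x (mid n) = x"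
  by (rule mono_eqI; auto simp: of_bool_conj)+

lemma mtens_assoc:
  assumes "mgood x" "mgood y" "mgood z"
  shows "mtens (mtens x y) z = mtens x (mtens y z)"
  by (rule mono_eqI) (use assms in \<open>auto simp: take_drop ac_simps\<close>)

lemma mtens_mid_0 [simp]: "mgood x \<Longrightarrow> mtens (mid 0) x = x" "mgood x \<Longrightarrow> mtens x (mid 0) = x"
  by (rule mono_eqI; auto)+

lemma mtens_mid: "mtens (mid m) (mid n) = mid (m + n)"
  by (rule mono_eqI) (auto, metis append_take_drop_id)

text \<open>Juxtaposition is the Kronecker product of matrices: a sum over concatenated colourings
  splits into a product of two sums.\<close>

lemma interchange:
  assumes "mgood x" "mgood y" "mgood x'" "mgood y'" "mbots x = mtops x'" "mbots y = mtops y'"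
  shows "mcomp (mtens x' y') (mtens x y) = mtens (mcomp x' x) (mcomp y' y)"
proof (rule mono_eqI)
  fix s t
  show "wt (mcomp (mtens x' y') (mtens x y)) s t = wt (mtens (mcomp x' x) (mcomp y' y)) s t"
    using assms by (simp add: sum_bl_add sum_product ac_simps cong: sum.cong_simp)
qed (use assms in auto)

lemma sum_bl_single:
  fixes g :: "bool list \<Rightarrow> nat"
  assumes "length c = k" "\<And>w. length w = k \<Longrightarrow> w \<noteq> c \<Longrightarrow> g w = 0"
  shows "(\<Sum>w\<in>bl k. g w) = g c"
proof -
  have "(\<Sum>w\<in>bl k. g w) = (\<Sum>w\<in>{c}. g w)"
    by (rule sum.mono_neutral_right) (use assms in auto)
  then show ?thesis by simp
qed

section \<open>Weights of composites with a layer of cups or caps\<close>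

lemma wt_mtens_append:
  assumes "mgood x" "mgood y" "mtops x = length s" "mbots x = length t"
  shows "wt (mtens x y) (s @ s') (t @ t') = wt x s t * wt y s' t'"
  using assms by simp

text \<open>A composite sums over all colourings of the middle row; the identity strands and the
  palindrome condition collapse this to the colours of the \<open>k\<close> arcs. With this formula
  and its mirror \<open>wt_cap_layer\<close> an isotopy becomes a reindexing.\<close>

lemma wt_cup_layer:
  assumes "mgood y" "mtops y = a + (2 * k + b)" "length s1 = a" "length s2 = b"
  shows "wt (mcomp y (mtens (mid a) (mtens (mcup k) (mid b)))) (s1 @ s2) t = (\<Sum>w\<in>bl k. wt y (s1 @ w @ rev w @ s2) t)"
proof -
  let ?z = "mtens (mid a) (mtens (mcup k) (mid b))"
  have "wt (mcomp y ?z) (s1 @ s2) t =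
      (\<Sum>u\<in>bl a. \<Sum>v\<in>bl (2 * k). \<Sum>z\<in>bl b. wt ?z (s1 @ s2) (u @ v @ z) * wt y (u @ v @ z) t)"
    using assms by (subst wt_mcomp) (simp_all add: sum_bl_add del: wt_mtens)
  also have "\<dots> = (\<Sum>u\<in>bl a. \<Sum>v\<in>bl (2 * k). \<Sum>z\<in>bl b. (of_bool (s1 = u) * of_bool (rev v = v) * of_bool (s2 = z)) * wt y (u @ v @ z) t)"
    using assms by (intro sum.cong) (auto simp: of_bool_def)
  also have "\<dots> = (\<Sum>v\<in>bl (2 * k). \<Sum>z\<in>bl b. (of_bool (rev v = v) * of_bool (s2 = z)) * wt y (s1 @ v @ z) t)"
    using assms by (subst sum_bl_single[where c = s1]) auto
  also have "\<dots> = (\<Sum>v\<in>bl (2 * k). of_bool (rev v = v) * wt y (s1 @ v @ s2) t)"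
    using assms by (intro sum.cong refl, subst sum_bl_single[where c = s2]) auto
  also have "\<dots> = (\<Sum>w\<in>bl k. wt y (s1 @ w @ rev w @ s2) t)"
    by (simp add: sum_bl_pal)
  finally show ?thesis .
qed

lemma wt_cap_layer:
  assumes "mgood x" "mbots x = a + (2 * k + b)" "length t1 = a" "length t2 = b"
  shows "wt (mcomp (mtens (mid a) (mtens (mcap k) (mid b))) x) s (t1 @ t2) = (\<Sum>w\<in>bl k. wt x s (t1 @ w @ rev w @ t2))"
proof -
  let ?z = "mtens (mid a) (mtens (mcap k) (mid b))"
  have "wt (mcomp ?z x) s (t1 @ t2) =
      (\<Sum>u\<in>bl a. \<Sum>v\<in>bl (2 * k). \<Sum>z\<in>bl b. wt x s (u @ v @ z) * wt ?z (u @ v @ z) (t1 @ t2))"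
    using assms by (subst wt_mcomp) (simp_all add: sum_bl_add del: wt_mtens)
  also have "\<dots> = (\<Sum>u\<in>bl a. \<Sum>v\<in>bl (2 * k). \<Sum>z\<in>bl b. (of_bool (u = t1) * of_bool (rev v = v) * of_bool (z = t2)) * wt x s (u @ v @ z))"
    using assms by (intro sum.cong) (auto simp: of_bool_def)
  also have "\<dots> = (\<Sum>v\<in>bl (2 * k). \<Sum>z\<in>bl b. (of_bool (rev v = v) * of_bool (z = t2)) * wt x s (t1 @ v @ z))"
    using assms by (subst sum_bl_single[where c = t1]) auto
  also have "\<dots> = (\<Sum>v\<in>bl (2 * k). of_bool (rev v = v) * wt x s (t1 @ v @ t2))"
    using assms by (intro sum.cong refl, subst sum_bl_single[where c = t2]) auto
  also have "\<dots> = (\<Sum>w\<in>bl k. wt x s (t1 @ w @ rev w @ t2))"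
    by (simp add: sum_bl_pal)
  finally show ?thesis .
qed

lemma wt_cap_end:
  assumes "mgood x" "mbots x = a + 2 * k" "length t = a"
  shows "wt (mcomp (mtens (mid a) (mcap k)) x) s t = (\<Sum>w\<in>bl k. wt x s (t @ w @ rev w))"
  using wt_cap_layer[of x a k 0 t "[]" s] assms by (simp del: wt_mcomp wt_mtens)

lemma wt_cap_start:
  assumes "mgood x" "mbots x = 2 * k + b" "length t = b"
  shows "wt (mcomp (mtens (mcap k) (mid b)) x) s t = (\<Sum>w\<in>bl k. wt x s (w @ rev w @ t))"
  using wt_cap_layer[of x 0 k b "[]" t s] assms by (simp del: wt_mcomp wt_mtens)

lemma wt_cap:
  assumes "mgood x" "mbots x = 2 * k"
  shows "wt (mcomp (mcap k) x) s [] = (\<Sum>w\<in>bl k. wt x s (w @ rev w))"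
  using wt_cap_end[of x 0 k "[]" s] assms by (simp del: wt_mcomp wt_mtens)

lemma wt_cup_end:
  assumes "mgood y" "mtops y = a + 2 * k" "length s = a"
  shows "wt (mcomp y (mtens (mid a) (mcup k))) s t = (\<Sum>w\<in>bl k. wt y (s @ w @ rev w) t)"
  using wt_cup_layer[of y a k 0 s "[]" t] assms by (simp del: wt_mcomp wt_mtens)

lemma wt_cup_start:
  assumes "mgood y" "mtops y = 2 * k + b" "length s = b"
  shows "wt (mcomp y (mtens (mcup k) (mid b))) s t = (\<Sum>w\<in>bl k. wt y (w @ rev w @ s) t)"
  using wt_cup_layer[of y 0 k b "[]" s t] assms by (simp del: wt_mcomp wt_mtens)

lemma wt_cup:
  assumes "mgood y" "mtops y = 2 * k"
  shows "wt (mcomp y (mcup k)) [] t = (\<Sum>w\<in>bl k. wt y (w @ rev w) t)"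
  using wt_cup_end[of y 0 k "[]" t] assms by (simp del: wt_mcomp wt_mtens)

lemmas wt_layers = wt_cap wt_cap_end wt_cap_start wt_cup wt_cup_end wt_cup_start

lemma mcap_add:
  "mcap (c + c') = mcomp (mcap c) (mtens (mid c) (mtens (mcap c') (mid c)))"
proof (rule mono_eqI)
  fix s t :: "bool list" assume st: "length s = mtops (mcomp (mcap c) (mtens (mid c) (mtens (mcap c') (mid c))))"
     "length t = mbots (mcomp (mcap c) (mtens (mid c) (mtens (mcap c') (mid c))))"
  define s1 s2 s3 where "s1 = take c s" and "s2 = take (2 * c') (drop c s)" and "s3 = drop (2 * c') (drop c s)"
  have s: "s = s1 @ s2 @ s3" "length s1 = c" "length s2 = 2 * c'" "length s3 = c"
    using st by (simp_all add: s1_def s2_def s3_def del: drop_drop)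
  have "wt (mcomp (mcap c) (mtens (mid c) (mtens (mcap c') (mid c)))) s [] = 
      wt (mtens (mid c) (mtens (mcap c') (mid c))) s (s1 @ rev s1)"
    by (subst wt_cap) (use s in \<open>auto intro!: sum_bl_single simp del: append_assoc\<close>)
  also have "\<dots> = of_bool (rev s2 = s2 \<and> s3 = rev s1)" using s by auto
  also have "\<dots> = wt (mcap (c + c')) s []" using s by auto
  finally show "wt (mcap (c + c')) s t = wt (mcomp (mcap c) (mtens (mid c) (mtens (mcap c') (mid c)))) s t"
    using st by simp
qed auto

lemma mflip_mcomp: "mgood x \<Longrightarrow> mgood y \<Longrightarrow> mbots x = mtops y \<Longrightarrow> mflip (mcomp y x) = mcomp (mflip x) (mflip y)"
  by (rule mono_eqI) (auto simp: mult.commute)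

lemma mflip_mtens: "mgood x \<Longrightarrow> mgood y \<Longrightarrow> mflip (mtens x y) = mtens (mflip x) (mflip y)"
  by (rule mono_eqI) auto

lemma mflip_mflip: "mgood x \<Longrightarrow> mflip (mflip x) = x"
  by (rule mono_eqI) auto

lemma mflip_simps [simp]: "mflip (mid n) = mid n" "mflip (mcap n) = mcup n" "mflip (mcup n) = mcap n"
  by (rule mono_eqI; auto)+

text \<open>A single loop: its two colourings give weight 2, that is, exponent 1.\<close>

lemma mcap_mcup: "mcomp (mcap (Suc 0)) (mcup (Suc 0)) = (1, id_diagram 0)"
proof (rule mono_eqI)
  fix s t :: "bool list"
  assume "length s = mtops (1, id_diagram 0)" "length t = mbots (1, id_diagram 0)"
  then have [simp]: "s = []" "t = []" by (simp_all add: mtops_def mbots_def id_diagram_def)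
  have "wt (1, id_diagram 0) [] [] = 2" by (simp add: wt_def fits_id)
  moreover have "wt (mcomp (mcap (Suc 0)) (mcup (Suc 0))) [] [] = 2"
  proof -
    have "wt (mcomp (mcap (Suc 0)) (mcup (Suc 0))) [] [] = (\<Sum>w\<in>bl (Suc 0). wt (mcup (Suc 0)) [] (w @ rev w))"
      by (rule wt_cap) auto
    then show ?thesis unfolding sum_bl_1 by simp
  qed
  ultimately show "wt (mcomp (mcap (Suc 0)) (mcup (Suc 0))) s t = wt (1, id_diagram 0) s t" by simp
next
  show "mgood (1, id_diagram 0)" by (simp add: mgood_def partition_id)
qed (auto simp: mtops_def[of "(_, _)"] mbots_def[of "(_, _)"] id_diagram_def)

text \<open>The bends force the colours of the middle strands, so the sum over them has a single
  non-zero term.\<close>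

lemma zigzag:
  "mcomp (mtens (mid n) (mcap n)) (mtens (mcup n) (mid n)) = mid n" (is "?x = _")
  "mcomp (mtens (mcap n) (mid n)) (mtens (mid n) (mcup n)) = mid n" (is "?y = _")
proof -
  show "?x = mid n"
  proof (rule mono_eqI)
    fix s t :: "bool list" assume st: "length s = mtops (mid n)" "length t = mbots (mid n)"
    then have "wt ?x s t = (\<Sum>w\<in>bl n. wt (mtens (mcup n) (mid n)) s (t @ w @ rev w))"
      by (intro wt_cap_end) auto
    also have "\<dots> = wt (mtens (mcup n) (mid n)) s (t @ rev t @ rev (rev t))"
      by (rule sum_bl_single) (use st in auto)
    finally have "wt ?x s t = wt (mtens (mcup n) (mid n)) s (t @ rev t @ rev (rev t))" .
    with st show "wt ?x s t = wt (mid n) s t" by (auto simp del: wt_mcomp)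
  qed auto
  show "?y = mid n"
  proof (rule mono_eqI)
    fix s t :: "bool list" assume st: "length s = mtops (mid n)" "length t = mbots (mid n)"
    then have "wt ?y s t = wt (mtens (mid n) (mcup n)) s (s @ rev s @ t)"
      by (subst wt_cap_start) (auto intro!: sum_bl_single)
    with st show "wt ?y s t = wt (mid n) s t" by (auto simp del: wt_mcomp)
  qed auto
qed

text \<open>Colourings make the planar closure visibly cyclic.\<close>

definition mtrace :: "nat \<Rightarrow> monomial \<Rightarrow> monomial" where
  "mtrace n x = mcomp (mcap n) (mcomp (mtens x (mid n)) (mcup n))"

lemma mtrace_simps [simp]:
  "mtops (mtrace n x) = 0" "mbots (mtrace n x) = 0" "mgood x \<Longrightarrow> mgood (mtrace n x)"
  by (simp_all add: mtrace_def)

lemma wt_mtrace: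
  assumes "mgood x" "mtops x = n" "mbots x = n"
  shows "wt (mtrace n x) [] [] = (\<Sum>w\<in>bl n. wt x w w)"
proof -
  have "wt (mtrace n x) [] [] = (\<Sum>w\<in>bl n. \<Sum>v\<in>bl n. wt (mtens x (mid n)) (v @ rev v) (w @ rev w))"
    unfolding mtrace_def using assms by (simp add: wt_layers del: wt_mcomp wt_mtens)
  also have "\<dots> = (\<Sum>w\<in>bl n. wt (mtens x (mid n)) (w @ rev w) (w @ rev w))"
    using assms by (intro sum.cong refl sum_bl_single) auto
  also have "\<dots> = (\<Sum>w\<in>bl n. wt x w w)"
    using assms by (intro sum.cong) auto
  finally show ?thesis .
qed

lemma mtrace_cyclic:
  assumes "mgood x" "mgood y" "mtops x = m" "mbots x = n" "mtops y = n" "mbots y = m"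
  shows "mtrace m (mcomp y x) = mtrace n (mcomp x y)"
proof (rule mono_eqI)
  fix s t :: "bool list" 
  assume "length s = mtops (mtrace n (mcomp x y))" "length t = mbots (mtrace n (mcomp x y))"
  then show "wt (mtrace m (mcomp y x)) s t = wt (mtrace n (mcomp x y)) s t"
    using assms by (simp add: wt_mtrace) (subst sum.swap, simp add: mult.commute)
qed (use assms in auto)

lemma mtrace_mflip:
  assumes "mgood x" "mtops x = n" "mbots x = n"
  shows "mtrace n (mflip x) = mtrace n x"
  by (rule mono_eqI) (use assms in \<open>auto simp: wt_mtrace\<close>)

text \<open>Partial trace: closing the last \<open>k\<close> strands before the others amounts to
  splitting each index of the matrix trace as \<open>w @ v\<close>.\<close>

lemma mtrace_mtens_mid:
  assumes "mgood x" "mtops x = n + k" "mbots x = n + k"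
  shows "mtrace (n + k) x = mtrace n (mcomp (mtens (mid n) (mcap k)) (mcomp (mtens x (mid k)) (mtens (mid n) (mcup k))))"
    (is "_ = mtrace n ?y")
proof (rule mono_eqI)
  fix s t :: "bool list"
  have y: "wt ?y w w' = (\<Sum>v\<in>bl k. wt x (w @ v) (w' @ v))" if "length w = n" "length w' = n" for w w'
  proof -
    have "wt ?y w w' = (\<Sum>v\<in>bl k. \<Sum>u\<in>bl k. wt (mtens x (mid k)) (w @ u @ rev u) (w' @ v @ rev v))"
      using assms that by (simp add: wt_layers del: wt_mcomp wt_mtens)
    also have "\<dots> = (\<Sum>v\<in>bl k. wt (mtens x (mid k)) (w @ v @ rev v) (w' @ v @ rev v))"
      using assms that by (intro sum.cong refl sum_bl_single) auto
    also have "\<dots> = (\<Sum>v\<in>bl k. wt x (w @ v) (w' @ v))"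
      using assms that by (intro sum.cong) auto
    finally show ?thesis .
  qed
  assume "length s = mtops (mtrace n ?y)" "length t = mbots (mtrace n ?y)"
  then have "s = []" "t = []" by simp_all
  then show "wt (mtrace (n + k) x) s t = wt (mtrace n ?y) s t"
    using assms by (simp add: wt_mtrace y sum_bl_add del: wt_mcomp)
qed (use assms in auto)

text \<open>A cap on one end of a bundle of nested arcs can be pushed through to the other end,
  where it becomes a cup. Nesting reverses the order of the strands, whence \<open>a\<close> and
  \<open>b\<close> trade places. This is what later carries a turn-back onto the idempotent at the
  far end of an arc.\<close>

lemma mcup_slide:
  "mcomp (mtens (mid (a + 2 + b)) (mtens (mid a) (mtens (mcap 1) (mid b)))) (mcup (a + 2 + b)) =
   mcomp (mtens (mtens (mid b) (mtens (mcup 1) (mid a))) (mid (a + b))) (mcup (a + b))" (is "?x = ?y")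
proof (rule mono_eqI)
  fix s t :: "bool list" assume st: "length s = mtops ?y" "length t = mbots ?y"
  let ?Y = "mtens (mid b) (mtens (mcup 1) (mid a))"
  define p1 p2 p3 q1 q2 where "p1 = take b t" and "p2 = take 2 (drop b t)" and "p3 = take a (drop 2 (drop b t))"
    and "q1 = take a (drop a (drop 2 (drop b t)))" and "q2 = drop a (drop a (drop 2 (drop b t)))"
  have t: "t = p1 @ p2 @ p3 @ q1 @ q2" and l: "length p1 = b" "length p2 = 2" "length p3 = a" "length q1 = a" "length q2 = b"
    using st by (simp_all add: p1_def p2_def p3_def q1_def q2_def del: drop_drop)
  obtain x x' where p2: "p2 = [x, x']" using l(2) by (auto simp: length_Suc_conv numeral_2_eq_2)
  have "?x = mcomp (mtens (mid (a + 2 + b + a)) (mtens (mcap 1) (mid b))) (mcup (a + 2 + b))"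
    by (simp add: mtens_assoc [symmetric] mtens_mid)
  then have "wt ?x [] t = (\<Sum>w\<in>bl 1. wt (mcup (a + 2 + b)) [] ((p1 @ p2 @ p3 @ q1) @ w @ rev w @ q2))"
    using l wt_cap_layer[of "mcup (a + 2 + b)" "a + 2 + b + a" 1 b "p1 @ p2 @ p3 @ q1" q2 "[]"]
    by (simp add: t del: wt_mcomp wt_mtens wt_mcup)
  also have "\<dots> = of_bool (x = x' \<and> p1 = rev q2 \<and> p3 = rev q1)"
    using l by (auto simp: sum_bl_1 p2 of_bool_def)
  also have "\<dots> = wt ?Y (rev (q1 @ q2)) (p1 @ p2 @ p3)"
    using l by (auto simp: p2 of_bool_def)
  also have "\<dots> = (\<Sum>w\<in>bl (a + b). wt ?Y w (p1 @ p2 @ p3) * of_bool (w = rev (q1 @ q2)))"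
    using l by (subst sum_bl_delta) simp
  also have "\<dots> = (\<Sum>w\<in>bl (a + b). wt (mtens ?Y (mid (a + b))) (w @ rev w) ((p1 @ p2 @ p3) @ q1 @ q2))"
  proof (rule sum.cong)
    fix w assume w: "w \<in> bl (a + b)"
    have "mtops ?Y = length w" "mbots ?Y = length (p1 @ p2 @ p3)" using l w by simp_all
    then have "wt (mtens ?Y (mid (a + b))) (w @ rev w) ((p1 @ p2 @ p3) @ q1 @ q2) = wt ?Y w (p1 @ p2 @ p3) * of_bool (rev w = q1 @ q2)"
      by (subst wt_mtens_append) (use w l in \<open>simp_all del: append_assoc wt_mtens\<close>)
    moreover have "rev w = q1 @ q2 \<longleftrightarrow> w = rev (q1 @ q2)" by (metis rev_rev_ident)
    ultimately show "wt ?Y w (p1 @ p2 @ p3) * of_bool (w = rev (q1 @ q2)) =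
        wt (mtens ?Y (mid (a + b))) (w @ rev w) ((p1 @ p2 @ p3) @ q1 @ q2)" by (simp only:)
  qed simp
  also have "\<dots> = wt ?y [] t"
    unfolding t append_assoc by (rule wt_cup [symmetric]) auto
  finally show "wt ?x s t = wt ?y s t" using st by simp
qed auto

lemma mcup_slide':
  "mcomp (mtens (mtens (mid a) (mtens (mcap 1) (mid b))) (mid (a + 2 + b))) (mcup (a + 2 + b)) =
   mcomp (mtens (mid (a + b)) (mtens (mid b) (mtens (mcup 1) (mid a)))) (mcup (a + b))" (is "?x = ?y")
proof (rule mono_eqI)
  fix s t :: "bool list" assume st: "length s = mtops ?y" "length t = mbots ?y"
  let ?Y = "mtens (mid b) (mtens (mcup 1) (mid a))"
  define q1 q2 p1 p2 p3 where "q1 = take a t" and "q2 = take b (drop a t)" and "p1 = take b (drop b (drop a t))"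
    and "p2 = take 2 (drop b (drop b (drop a t)))" and "p3 = drop 2 (drop b (drop b (drop a t)))"
  have t: "t = q1 @ q2 @ p1 @ p2 @ p3" and l: "length p1 = b" "length p2 = 2" "length p3 = a" "length q1 = a" "length q2 = b"
    using st by (simp_all add: p1_def p2_def p3_def q1_def q2_def del: drop_drop)
  obtain x x' where p2: "p2 = [x, x']" using l(2) by (auto simp: length_Suc_conv numeral_2_eq_2)
  have "?x = mcomp (mtens (mid a) (mtens (mcap 1) (mid (b + (a + 2 + b))))) (mcup (a + 2 + b))"
    by (simp add: mtens_assoc mtens_mid)
  then have "wt ?x [] t = (\<Sum>w\<in>bl 1. wt (mcup (a + 2 + b)) [] (q1 @ w @ rev w @ q2 @ p1 @ p2 @ p3))"
    using l wt_cap_layer[of "mcup (a + 2 + b)" a 1 "b + (a + 2 + b)" q1 "q2 @ p1 @ p2 @ p3" "[]"]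
    by (simp add: t del: wt_mcomp wt_mtens wt_mcup)
  also have "\<dots> = of_bool (x = x' \<and> p1 = rev q2 \<and> p3 = rev q1)"
    using l by (auto simp: sum_bl_1 p2 of_bool_def)
  also have "\<dots> = wt ?Y (rev (q1 @ q2)) (p1 @ p2 @ p3)"
    using l by (auto simp: p2 of_bool_def)
  also have "\<dots> = (\<Sum>w\<in>bl (a + b). of_bool (w = q1 @ q2) * wt ?Y (rev w) (p1 @ p2 @ p3))"
    using l by (subst sum_bl_delta) simp
  also have "\<dots> = (\<Sum>w\<in>bl (a + b). wt (mtens (mid (a + b)) ?Y) (w @ rev w) ((q1 @ q2) @ p1 @ p2 @ p3))"
  proof (rule sum.cong)
    fix w assume w: "w \<in> bl (a + b)"
    have "wt (mtens (mid (a + b)) ?Y) (w @ rev w) ((q1 @ q2) @ p1 @ p2 @ p3) = wt (mid (a + b)) w (q1 @ q2) * wt ?Y (rev w) (p1 @ p2 @ p3)"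
      by (rule wt_mtens_append) (use w l in simp_all)
    moreover have "wt (mid (a + b)) w (q1 @ q2) = of_bool (w = q1 @ q2)" using w by simp
    ultimately show "of_bool (w = q1 @ q2) * wt ?Y (rev w) (p1 @ p2 @ p3) =
        wt (mtens (mid (a + b)) ?Y) (w @ rev w) ((q1 @ q2) @ p1 @ p2 @ p3)" by (simp only:)
  qed simp
  also have "\<dots> = wt ?y [] t"
    unfolding t append_assoc by (rule wt_cup [symmetric]) auto
  finally show "wt ?x s t = wt ?y s t" using st by simp
qed auto

text \<open>The right-hand side of the theorem applies \<open>mrot\<close> to each summand of the 4-vertex; \<open>mrot'\<close> inverts it.\<close>

definition mrot :: "nat \<Rightarrow> nat \<Rightarrow> nat \<Rightarrow> nat \<Rightarrow> monomial \<Rightarrow> monomial" where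
  "mrot i j k l x = mcomp (mtens (mid (k + l)) (mcap j)) (mcomp (mtens (mid k) (mtens x (mid j))) (mtens (mcup k) (mid (i + j))))"

definition mrot' :: "nat \<Rightarrow> nat \<Rightarrow> nat \<Rightarrow> nat \<Rightarrow> monomial \<Rightarrow> monomial" where
  "mrot' i j k l x = mcomp (mtens (mcap k) (mid (l + j))) (mcomp (mtens (mid k) (mtens x (mid j))) (mtens (mid (k + i)) (mcup j)))"

lemma mrot_simps [simp]:
  "mgood x \<Longrightarrow> mgood (mrot i j k l x)" "mtops (mrot i j k l x) = i + j" "mbots (mrot i j k l x) = k + l"
  "mgood x \<Longrightarrow> mgood (mrot' i j k l x)" "mtops (mrot' i j k l x) = k + i" "mbots (mrot' i j k l x) = l + j"
  by (simp_all add: mrot_def mrot'_def)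

text \<open>Bending a leg moves a block of indices between the rows and the columns of the matrix;
  the bend consists of nested arcs, so the block is reversed. Invertibility and isometry of the
  rotation then rest on \<open>rev\<close> being an involution.\<close>

lemma wt_mrot:
  assumes "mgood x" "mtops x = k + i" "mbots x = l + j" "length a = i" "length b = j" "length c = k" "length d = l"
  shows "wt (mrot i j k l x) (a @ b) (c @ d) = wt x (rev c @ a) (d @ rev b)"
proof -
  let ?z = "mtens (mid k) (mtens x (mid j))"
  have "wt (mrot i j k l x) (a @ b) (c @ d) = (\<Sum>v\<in>bl j. \<Sum>u\<in>bl k. wt ?z (u @ rev u @ a @ b) (c @ d @ v @ rev v))"
  proof -
    have "wt (mrot i j k l x) (a @ b) (c @ d) = (\<Sum>v\<in>bl j. wt (mcomp ?z (mtens (mcup k) (mid (i + j)))) (a @ b) ((c @ d) @ v @ rev v))"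
      unfolding mrot_def by (rule wt_cap_end) (use assms in auto)
    also have "\<dots> = (\<Sum>v\<in>bl j. \<Sum>u\<in>bl k. wt ?z (u @ rev u @ a @ b) ((c @ d) @ v @ rev v))"
      by (intro sum.cong refl wt_cup_start) (use assms in auto)
    finally show ?thesis by (simp only: append_assoc)
  qed
  also have "\<dots> = (\<Sum>v\<in>bl j. \<Sum>u\<in>bl k. of_bool (u = c) * (wt x (rev u @ a) (d @ v) * of_bool (v = rev b)))"
  proof (intro sum.cong refl)
    fix u v assume u: "u \<in> bl k" and v: "v \<in> bl j"
    have "wt (mtens x (mid j)) ((rev u @ a) @ b) ((d @ v) @ rev v) = wt x (rev u @ a) (d @ v) * wt (mid j) b (rev v)"
      by (rule wt_mtens_append) (use assms u v in auto)
    then have "wt ?z (u @ (rev u @ a) @ b) (c @ (d @ v) @ rev v) = wt (mid k) u c * (wt x (rev u @ a) (d @ v) * wt (mid j) b (rev v))"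
      by (subst wt_mtens_append) (use assms u in auto)
    moreover have "b = rev v \<longleftrightarrow> v = rev b" by auto
    ultimately show "wt ?z (u @ rev u @ a @ b) (c @ d @ v @ rev v) = of_bool (u = c) * (wt x (rev u @ a) (d @ v) * of_bool (v = rev b))"
      using assms u by simp
  qed
  also have "\<dots> = wt x (rev c @ a) (d @ rev b)"
    using assms by simp
  finally show ?thesis .
qed

lemma wt_mrot':
  assumes "mgood x" "mtops x = i + j" "mbots x = k + l" "length a = i" "length b = j" "length c = k" "length d = l"
  shows "wt (mrot' i j k l x) (c @ a) (d @ b) = wt x (a @ rev b) (rev c @ d)"
proof -
  let ?z = "mtens (mid k) (mtens x (mid j))"
  have "wt (mrot' i j k l x) (c @ a) (d @ b) = (\<Sum>v\<in>bl k. \<Sum>u\<in>bl j. wt ?z (c @ a @ u @ rev u) (v @ rev v @ d @ b))"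
  proof -
    have "wt (mrot' i j k l x) (c @ a) (d @ b) = (\<Sum>v\<in>bl k. wt (mcomp ?z (mtens (mid (k + i)) (mcup j))) (c @ a) (v @ rev v @ d @ b))"
      unfolding mrot'_def by (rule wt_cap_start) (use assms in auto)
    also have "\<dots> = (\<Sum>v\<in>bl k. \<Sum>u\<in>bl j. wt ?z ((c @ a) @ u @ rev u) (v @ rev v @ d @ b))"
      by (intro sum.cong refl wt_cup_end) (use assms in auto)
    finally show ?thesis by (simp only: append_assoc)
  qed
  also have "\<dots> = (\<Sum>v\<in>bl k. \<Sum>u\<in>bl j. of_bool (v = c) * (wt x (a @ u) (rev v @ d) * of_bool (u = rev b)))"
  proof (intro sum.cong refl)
    fix u v assume u: "u \<in> bl j" and v: "v \<in> bl k"
    have "wt (mtens x (mid j)) ((a @ u) @ rev u) ((rev v @ d) @ b) = wt x (a @ u) (rev v @ d) * wt (mid j) (rev u) b"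
      by (rule wt_mtens_append) (use assms u v in auto)
    then have "wt ?z (c @ (a @ u) @ rev u) (v @ (rev v @ d) @ b) = wt (mid k) c v * (wt x (a @ u) (rev v @ d) * wt (mid j) (rev u) b)"
      by (subst wt_mtens_append) (use assms v in auto)
    moreover have "rev u = b \<longleftrightarrow> u = rev b" "c = v \<longleftrightarrow> v = c" by auto
    ultimately show "wt ?z (c @ a @ u @ rev u) (v @ rev v @ d @ b) = of_bool (v = c) * (wt x (a @ u) (rev v @ d) * of_bool (u = rev b))"
      using assms u v by simp
  qed
  also have "\<dots> = wt x (a @ rev b) (rev c @ d)"
    using assms by (simp add: sum_distrib_left [symmetric])
  finally show ?thesis .
qed

lemma split_list_add:
  assumes "length s = i + j"
  obtains a b where "s = a @ b" "length a = i" "length b = j"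
  using assms by (intro that[of "take i s" "drop i s"]) auto

lemma mrot_mrot':
  assumes "mgood x" "mtops x = i + j" "mbots x = k + l"
  shows "mrot i j k l (mrot' i j k l x) = x"
proof (rule mono_eqI)
  fix s t :: "bool list" assume "length s = mtops x" "length t = mbots x"
  then obtain a b c d where "s = a @ b" "length a = i" "length b = j" "t = c @ d" "length c = k" "length d = l"
    using assms split_list_add by metis
  then show "wt (mrot i j k l (mrot' i j k l x)) s t = wt x s t"
    using assms by (simp add: wt_mrot wt_mrot')
qed (use assms in auto)

text \<open>Both traces add up products of an entry of \<open>x\<close> and an entry of
  \<open>y\<close> over all colourings of the four legs, and they differ by reindexing
  \<open>b\<close> and \<open>c\<close> with \<open>rev\<close>. In other words,
  \<open>mrot'\<close> is the transpose of \<open>mrot\<close> for the trace form.\<close>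

lemma mtrace_mrot:
  assumes x: "mgood x" "mtops x = i + j" "mbots x = k + l" and y: "mgood y" "mtops y = k + i" "mbots y = l + j"
  shows "mtrace (i + j) (mcomp (mflip (mrot i j k l y)) x) = mtrace (k + i) (mcomp (mflip y) (mrot' i j k l x))"
    (is "?L = ?R")
proof (rule mono_eqI)
  fix s t :: "bool list" assume "length s = mtops ?R" "length t = mbots ?R"
  then have "s = []" "t = []" by simp_all
  moreover have "wt ?L [] [] = (\<Sum>a\<in>bl i. \<Sum>b\<in>bl j. \<Sum>c\<in>bl k. \<Sum>d\<in>bl l. wt x (a @ b) (c @ d) * wt y (rev c @ a) (d @ rev b))"
    using x y by (simp add: wt_mtrace sum_bl_add wt_mrot cong: sum.cong_simp)
  moreover have "wt ?R [] [] = (\<Sum>c\<in>bl k. \<Sum>a\<in>bl i. \<Sum>d\<in>bl l. \<Sum>b\<in>bl j. wt x (a @ rev b) (rev c @ d) * wt y (c @ a) (d @ b))"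
    using x y by (simp add: wt_mtrace sum_bl_add wt_mrot' cong: sum.cong_simp)
  moreover have rev: "(\<Sum>w\<in>bl n. f (rev w)) = (\<Sum>w\<in>bl n. f w)" for n and f :: "bool list \<Rightarrow> nat"
    by (rule sum.reindex_bij_witness[where i = rev and j = rev]) auto
  moreover have "(\<Sum>c\<in>bl k. \<Sum>a\<in>bl i. \<Sum>d\<in>bl l. \<Sum>b\<in>bl j. wt x (a @ rev b) (rev c @ d) * wt y (c @ a) (d @ b)) =
      (\<Sum>c\<in>bl k. \<Sum>a\<in>bl i. \<Sum>d\<in>bl l. \<Sum>b\<in>bl j. wt x (a @ b) (c @ d) * wt y (rev c @ a) (d @ rev b))"
  proof -
    have "(\<Sum>b\<in>bl j. wt x (a @ rev b) (c @ d) * wt y (c' @ a) (d @ b)) = (\<Sum>b\<in>bl j. wt x (a @ b) (c @ d) * wt y (c' @ a) (d @ rev b))" for a c c' d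
      using rev[of "\<lambda>b. wt x (a @ b) (c @ d) * wt y (c' @ a) (d @ rev b)" j] by simp
    then show ?thesis
      using rev[of "\<lambda>c. \<Sum>a\<in>bl i. \<Sum>d\<in>bl l. \<Sum>b\<in>bl j. wt x (a @ b) (c @ d) * wt y (rev c @ a) (d @ rev b)" k] by simp
  qed
  moreover have "(\<Sum>a\<in>bl i. \<Sum>b\<in>bl j. \<Sum>c\<in>bl k. \<Sum>d\<in>bl l. h a b c d) = (\<Sum>c\<in>bl k. \<Sum>a\<in>bl i. \<Sum>d\<in>bl l. \<Sum>b\<in>bl j. h a b c d)"
    for h :: "bool list \<Rightarrow> bool list \<Rightarrow> bool list \<Rightarrow> bool list \<Rightarrow> nat"
  proof -
    have "(\<Sum>b\<in>bl j. \<Sum>c\<in>bl k. \<Sum>d\<in>bl l. h a b c d) = (\<Sum>c\<in>bl k. \<Sum>d\<in>bl l. \<Sum>b\<in>bl j. h a b c d)" for a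
      by (simp only: sum.swap[of _ "bl j"])
    then show ?thesis by (simp, subst sum.swap) simp
  qed
  ultimately show "wt ?L s t = wt ?R s t" by simp
qed (use assms in auto)

section \<open>The structure of crossingless diagrams\<close>

lemma diagrams_iff:
  "d \<in> diagrams m n \<longleftrightarrow> tops d = m \<and> bots d = n \<and> arcs d \<subseteq> points m n \<times> points m n \<and> sym (arcs d) \<and>
     irrefl (arcs d) \<and> (\<forall>p\<in>points m n. \<exists>!q. (p, q) \<in> arcs d) \<and> noncrossing m n (arcs d)"
  unfolding diagrams_def by (cases d) auto

lemma noncrossing_iff:
  "noncrossing m n R \<longleftrightarrow> (\<forall>a b c d. (a, b) \<in> R \<longrightarrow> (c, d) \<in> R \<longrightarrow>
     \<not> (pos m n a < pos m n c \<and> pos m n c < pos m n b \<and> pos m n b < pos m n d))"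
  unfolding noncrossing_def by blast

lemma diagramsD:
  assumes "d \<in> diagrams m n"
  shows "tops d = m" "bots d = n" "(p, q) \<in> arcs d \<Longrightarrow> p \<in> points m n \<and> q \<in> points m n"
    "(p, q) \<in> arcs d \<Longrightarrow> (q, p) \<in> arcs d" "(p, p) \<notin> arcs d"
    "p \<in> points m n \<Longrightarrow> \<exists>q. (p, q) \<in> arcs d"
    "(p, q) \<in> arcs d \<Longrightarrow> (p, r) \<in> arcs d \<Longrightarrow> q = r"
    "(a, b) \<in> arcs d \<Longrightarrow> (c, c') \<in> arcs d \<Longrightarrow>
      \<not> (pos m n a < pos m n c \<and> pos m n c < pos m n b \<and> pos m n b < pos m n c')"
  using assms unfolding diagrams_iff noncrossing_iff sym_def irrefl_def by blast+

lemma diagramsI: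
  assumes "tops d = m" "bots d = n" "\<And>p q. (p, q) \<in> arcs d \<Longrightarrow> p \<in> points m n"
    "\<And>p q. (p, q) \<in> arcs d \<Longrightarrow> (q, p) \<in> arcs d" "\<And>p. (p, p) \<notin> arcs d"
    "\<And>p. p \<in> points m n \<Longrightarrow> \<exists>q. (p, q) \<in> arcs d"
    "\<And>p q r. (p, q) \<in> arcs d \<Longrightarrow> (p, r) \<in> arcs d \<Longrightarrow> q = r"
    "\<And>a b c c'. (a, b) \<in> arcs d \<Longrightarrow> (c, c') \<in> arcs d \<Longrightarrow> pos m n a < pos m n c \<Longrightarrow> 
      pos m n c < pos m n b \<Longrightarrow> pos m n b < pos m n c' \<Longrightarrow> False"
  shows "d \<in> diagrams m n"
proof -
  have "arcs d \<subseteq> points m n \<times> points m n"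
  proof
    fix x assume x: "x \<in> arcs d"
    obtain p q where "x = (p, q)" by (cases x)
    then show "x \<in> points m n \<times> points m n" using x assms(3,4) by blast
  qed
  moreover have "sym (arcs d)" "irrefl (arcs d)" using assms(4,5) unfolding sym_def irrefl_def by blast+
  moreover have "\<forall>p\<in>points m n. \<exists>!q. (p, q) \<in> arcs d" using assms(6,7) by blast
  moreover have "noncrossing m n (arcs d)" unfolding noncrossing_iff using assms(8) by blast
  ultimately show ?thesis using assms(1,2) unfolding diagrams_iff by blast
qed

lemma id_in_diagrams: "id_diagram n \<in> diagrams n n"
  by (rule diagramsI) (auto simp: id_diagram_def in_points_iff pos_def)

lemma pos_flip: "p \<in> points m n \<Longrightarrow> pos n m (1 - fst p, snd p) = m + n - 1 - pos m n p \<and> pos m n p < m + n"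
  by (auto simp: in_points_iff pos_def)

text \<open>Reflection reverses the reading of the boundary, \<open>pos\<close> becoming
  \<open>m + n - 1 - pos\<close>. A crossing read backwards is again a crossing, once both arcs are
  turned around by symmetry.\<close>

lemma flip_in_diagrams:
  assumes "d \<in> diagrams m n"
  shows "flip d \<in> diagrams n m"
proof -
  have pd: "partition_diagram d" using diagrams_partition[OF assms] by simp
  note a = arcs_flip_good[OF pd]
  note D = diagramsD[OF assms]
  let ?f = "\<lambda>p :: point. (1 - fst p, snd p)"
  have ff: "?f (?f p) = p" if "fst p \<le> 1" for p using that by (cases p) auto
  have le: "fst p \<le> 1" if "p \<in> points k l" for p k l using that by (auto simp: in_points_iff)
  have mem: "p \<in> points n m" "fst p \<le> 1" "fst q \<le> 1" "?f p \<in> points m n" "?f q \<in> points m n" "(?f p, ?f q) \<in> arcs d"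
    if "(p, q) \<in> arcs (flip d)" for p q
    using that D(3) flip_points unfolding a by blast+
  have pp: "pos m n (?f p) = m + n - 1 - pos n m p" "pos n m p < m + n" if "p \<in> points n m" for p
    using pos_flip[OF that] by auto
  show ?thesis
  proof (rule diagramsI)
    fix p q assume pq: "(p, q) \<in> arcs (flip d)"
    show "p \<in> points n m" using mem[OF pq] by blast
    show qp: "(q, p) \<in> arcs (flip d)" using pq D(4) unfolding a by blast
    fix r assume "(p, r) \<in> arcs (flip d)"
    then have "?f q = ?f r" "fst r \<le> 1" using pq D(7) unfolding a by blast+
    then show "q = r" using ff mem[OF pq] by metis
  next
    fix p show "(p, p) \<notin> arcs (flip d)" using D(5) unfolding a by blast
  next
    fix p assume p: "p \<in> points n m"
    then have "?f p \<in> points m n" using flip_points le by blast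
    then obtain q where q: "(?f p, q) \<in> arcs d" using D(6) by blast
    then have "fst q \<le> 1" using D(3) le by blast
    then have "(p, ?f q) \<in> arcs (flip d)" using q p le ff unfolding a by simp
    then show "\<exists>q. (p, q) \<in> arcs (flip d)" by blast
  next
    fix x y z w assume xy: "(x, y) \<in> arcs (flip d)" and zw: "(z, w) \<in> arcs (flip d)"
      and less: "pos n m x < pos n m z" "pos n m z < pos n m y" "pos n m y < pos n m w"
    have yx: "(y, x) \<in> arcs (flip d)" and wz: "(w, z) \<in> arcs (flip d)" using xy zw D(4) unfolding a by blast+
    have "x \<in> points n m" "y \<in> points n m" "z \<in> points n m" "w \<in> points n m"
      using mem(1) xy yx zw wz by blast+
    moreover have "pos m n (?f q) < pos m n (?f p)" if "p \<in> points n m" "q \<in> points n m" "pos n m p < pos n m q" for p q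
      using that(3) unfolding pp(1)[OF that(1)] pp(1)[OF that(2)] using pp(2)[OF that(2)] by simp
    ultimately have "pos m n (?f w) < pos m n (?f y)" "pos m n (?f y) < pos m n (?f z)" "pos m n (?f z) < pos m n (?f x)"
      using less by blast+
    then show False using D(8)[OF mem(6)[OF wz] mem(6)[OF yx]] by blast
  qed (simp_all add: D)
qed

section \<open>Inserting and deleting an innermost bottom arc\<close>

definition skip :: "nat \<Rightarrow> point \<Rightarrow> point" where
  "skip t p = (if fst p = 0 \<or> snd p < t then p else (fst p, snd p + 2))"

definition ins :: "nat \<Rightarrow> diagram \<Rightarrow> diagram" where
  "ins t d = Diagram (tops d) (bots d + 2)
     (map_prod (skip t) (skip t) ` arcs d \<union> {((1, t), (1, Suc t)), ((1, Suc t), (1, t))})"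

lemma skip_inj: "skip t p = skip t q \<longleftrightarrow> p = q"
  by (cases p; cases q) (auto simp: skip_def split: if_splits)

lemma skip_points: "skip t p \<in> points m (n + 2) \<longleftrightarrow> p \<in> points m n" if "t \<le> n"
  using that by (cases p) (auto simp: skip_def in_points_iff)

lemma skip_neq: "skip t p \<noteq> (1, t)" "skip t p \<noteq> (1, Suc t)"
  by (cases p; auto simp: skip_def)+

lemma skip_surj:
  assumes "p \<in> points m (n + 2)" "p \<noteq> (1, t)" "p \<noteq> (1, Suc t)" "t \<le> n"
  shows "\<exists>q\<in>points m n. p = skip t q"
proof (cases "fst p = 0 \<or> snd p < t")
  case True
  then show ?thesis using assms by (intro bexI[of _ p]) (auto simp: skip_def in_points_iff)
next
  case False
  then have "fst p = 1" "snd p \<ge> t + 2" using assms by (auto simp: in_points_iff prod_eq_iff)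
  then show ?thesis using assms
    by (intro bexI[of _ "(fst p, snd p - 2)"]) (auto simp: skip_def in_points_iff prod_eq_iff)
qed

definition gap :: "nat \<Rightarrow> nat \<Rightarrow> nat" where "gap k x = (if x < k then x else x + 2)"

lemma gap_less: "gap k x < gap k y \<longleftrightarrow> x < y"
  by (auto simp: gap_def)

text \<open>Bottom points are read from right to left, so a pair inserted at columns
  \<open>t\<close> and \<open>t + 1\<close> takes the position \<open>m + (n - t)\<close> and the
  next one, and it is the points to its left that move on by two. Being strictly monotone,
  \<open>gap\<close> preserves and reflects crossings.\<close>

lemma pos_skip: "p \<in> points m n \<Longrightarrow> t \<le> n \<Longrightarrow> pos m (n + 2) (skip t p) = gap (m + (n - t)) (pos m n p)"
  by (auto simp: skip_def in_points_iff pos_def gap_def)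

lemma arcs_ins: "(p, q) \<in> arcs (ins t d) \<longleftrightarrow> (\<exists>p' q'. (p', q') \<in> arcs d \<and> p = skip t p' \<and> q = skip t q') \<or>
    p = (1, t) \<and> q = (1, Suc t) \<or> p = (1, Suc t) \<and> q = (1, t)"
  by (auto simp: ins_def)

text \<open>The new arc joins neighbouring positions, so no end fits strictly between them and it
  crosses nothing; the old arcs are moved monotonically.\<close>

lemma ins_in_diagrams:
  assumes d: "d \<in> diagrams m n" and t: "t \<le> n"
  shows "ins t d \<in> diagrams m (n + 2)"
proof -
  note D = diagramsD[OF d]
  have new: "(1, t) \<in> points m (n + 2)" "(1, Suc t) \<in> points m (n + 2)" using t by (auto simp: in_points_iff)
  have pnew: "pos m (n + 2) (1, t) = Suc (m + (n - t))" "pos m (n + 2) (1, Suc t) = m + (n - t)"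
    using t by (auto simp: pos_def)
  show ?thesis
  proof (rule diagramsI)
    fix p q assume pq: "(p, q) \<in> arcs (ins t d)"
    show "p \<in> points m (n + 2)" using pq new D(3) skip_points[OF t] unfolding arcs_ins by blast
    show "(q, p) \<in> arcs (ins t d)" using pq D(4) unfolding arcs_ins by blast
    fix r assume pr: "(p, r) \<in> arcs (ins t d)"
    consider p' q' where "(p', q') \<in> arcs d" "p = skip t p'" "q = skip t q'" | "p = (1, t)" "q = (1, Suc t)" 
      | "p = (1, Suc t)" "q = (1, t)" using pq unfolding arcs_ins by blast
    then show "q = r"
    proof cases
      case 1
      then obtain r' where "(p', r') \<in> arcs d" "r = skip t r'" 
        using pr skip_neq skip_inj unfolding arcs_ins by metis
      then show ?thesis using D(7) 1 by blast
    next
      case 2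
      then show ?thesis using pr skip_neq unfolding arcs_ins by (metis n_not_Suc_n prod.inject)
    next
      case 3
      then show ?thesis using pr skip_neq unfolding arcs_ins by (metis n_not_Suc_n prod.inject)
    qed
  next
    fix p show "(p, p) \<notin> arcs (ins t d)"
      using D(5) skip_inj unfolding arcs_ins by (metis n_not_Suc_n prod.inject)
  next
    fix p assume p: "p \<in> points m (n + 2)"
    show "\<exists>q. (p, q) \<in> arcs (ins t d)"
    proof (cases "p = (1, t) \<or> p = (1, Suc t)")
      case True
      then show ?thesis unfolding arcs_ins by blast
    next
      case False
      then obtain p' where "p' \<in> points m n" "p = skip t p'" using skip_surj p t by metis
      then show ?thesis using D(6) unfolding arcs_ins by metis
    qed
  next
    fix x y z w assume xy: "(x, y) \<in> arcs (ins t d)" and zw: "(z, w) \<in> arcs (ins t d)"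
      and less: "pos m (n + 2) x < pos m (n + 2) z" "pos m (n + 2) z < pos m (n + 2) y" "pos m (n + 2) y < pos m (n + 2) w"
    have "\<not> (x = (1, t) \<and> y = (1, Suc t) \<or> x = (1, Suc t) \<and> y = (1, t))"
      using less pnew by auto
    then obtain x' y' where x: "(x', y') \<in> arcs d" "x = skip t x'" "y = skip t y'"
      using xy unfolding arcs_ins by blast
    have "\<not> (z = (1, t) \<and> w = (1, Suc t) \<or> z = (1, Suc t) \<and> w = (1, t))"
      using less pnew by auto
    then obtain z' w' where z: "(z', w') \<in> arcs d" "z = skip t z'" "w = skip t w'"
      using zw unfolding arcs_ins by blast
    have "x' \<in> points m n" "y' \<in> points m n" "z' \<in> points m n" "w' \<in> points m n" using D(3) x z by blast+
    then show False using less D(8)[OF x(1) z(1)] unfolding x z by (simp only: pos_skip[OF _ t] gap_less simp_thms)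
  qed (use D in \<open>auto simp: ins_def\<close>)
qed

text \<open>Since the points \<open>t\<close> and \<open>t + 1\<close> are joined to each other, no
  other arc touches them, and deleting both leaves a perfect matching.\<close>

lemma ins_exhaust:
  assumes D: "D \<in> diagrams m (n + 2)" and t: "t \<le> n" and arc: "((1, t), (1, Suc t)) \<in> arcs D"
  obtains d where "d \<in> diagrams m n" "D = ins t d"
proof -
  note D' = diagramsD[OF D]
  define d where "d = Diagram m n {(p, q). (skip t p, skip t q) \<in> arcs D}"
  have arcs_d: "(p, q) \<in> arcs d \<longleftrightarrow> (skip t p, skip t q) \<in> arcs D" for p q by (simp add: d_def)
  have other: "q \<noteq> (1, t) \<and> q \<noteq> (1, Suc t)" if "(p, q) \<in> arcs D" "p \<noteq> (1, t)" "p \<noteq> (1, Suc t)" for p q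
    using that arc D'(4,7) by metis
  have ex: "\<exists>q'. q = skip t q' \<and> (p, q') \<in> arcs d" if "(skip t p, q) \<in> arcs D" for p q
    using that other[OF that skip_neq] D'(3) skip_surj[OF _ _ _ t] unfolding arcs_d by metis
  have "d \<in> diagrams m n"
  proof (rule diagramsI)
    fix p q assume pq: "(p, q) \<in> arcs d"
    show "p \<in> points m n" using pq D'(3) skip_points[OF t] unfolding arcs_d by blast
    show "(q, p) \<in> arcs d" using pq D'(4) unfolding arcs_d by blast
    fix r assume "(p, r) \<in> arcs d"
    then show "q = r" using pq D'(7) skip_inj unfolding arcs_d by metis
  next
    fix p show "(p, p) \<notin> arcs d" using D'(5) unfolding arcs_d by blast
  next
    fix p assume "p \<in> points m n"
    then obtain q where "(skip t p, q) \<in> arcs D" using D'(6) skip_points[OF t] by metis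
    then show "\<exists>q. (p, q) \<in> arcs d" using ex by blast
  next
    fix x y z w assume xy: "(x, y) \<in> arcs d" and zw: "(z, w) \<in> arcs d"
      and less: "pos m n x < pos m n z" "pos m n z < pos m n y" "pos m n y < pos m n w"
    have "x \<in> points m n" "y \<in> points m n" "z \<in> points m n" "w \<in> points m n"
      using xy zw D'(3) skip_points[OF t] unfolding arcs_d by blast+
    then show False using less D'(8)[OF xy[unfolded arcs_d] zw[unfolded arcs_d]] by (simp only: pos_skip[OF _ t] gap_less simp_thms)
  qed (simp_all add: d_def)
  moreover have "D = ins t d"
  proof -
    have "(p, q) \<in> arcs D \<longleftrightarrow> (p, q) \<in> arcs (ins t d)" for p q
    proof
      assume pq: "(p, q) \<in> arcs D"
      show "(p, q) \<in> arcs (ins t d)"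
      proof (cases "p = (1, t) \<or> p = (1, Suc t)")
        case True
        then show ?thesis using pq arc D'(4,7) unfolding arcs_ins by metis
      next
        case False
        then obtain p' where "p = skip t p'" using skip_surj[OF _ _ _ t] D'(3)[OF pq] by metis
        then show ?thesis using ex pq unfolding arcs_ins by metis
      qed
    next
      assume "(p, q) \<in> arcs (ins t d)"
      then show "(p, q) \<in> arcs D" using arc D'(4) unfolding arcs_ins arcs_d by blast
    qed
    then have "arcs D = arcs (ins t d)" by auto
    then show ?thesis using D'(1,2) by (intro diagram.expand) (simp add: ins_def d_def)
  qed
  ultimately show ?thesis using that by blast
qed

text \<open>The point next to \<open>i\<close> lies under the arc, and noncrossing traps its partner
  there as well. That arc is shorter, so the descent ends at an arc between neighbours.\<close>

lemma innermost_bottom_arc: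
  assumes d: "d \<in> diagrams m n" and "((1, i), (1, j)) \<in> arcs d" "i < j"
  shows "\<exists>t. Suc t < n \<and> ((1, t), (1, Suc t)) \<in> arcs d"
  using assms(2,3)
proof (induction "j - i" arbitrary: i j rule: less_induct)
  case less
  note D = diagramsD[OF d]
  have j: "j < n" using D(3)[OF less.prems(1)] by (simp add: in_points_iff)
  show ?case
  proof (cases "j = Suc i")
    case True
    then show ?thesis using less.prems j by auto
  next
    case False
    then have ij: "Suc i < j" using less.prems by simp
    have "(1, Suc i) \<in> points m n" using ij j by (simp add: in_points_iff)
    then obtain q where q: "((1, Suc i), q) \<in> arcs d" using D(6) by blast
    have qp: "q \<in> points m n" using D(3) q by blast
    have ji: "((1, j), (1, i)) \<in> arcs d" using D(4) less.prems by blast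
    have "q \<noteq> (1, i)" "q \<noteq> (1, j)" "q \<noteq> (1, Suc i)"
      using D(4,5,7) q ji less.prems ij by (metis Pair_inject n_not_Suc_n nat_neq_iff)+
    moreover have "\<not> pos m n q > pos m n (1, i)"
      using D(8)[OF ji q] ij j by (auto simp: pos_def)
    moreover have "\<not> pos m n q < pos m n (1, j)"
      using D(8)[OF D(4)[OF q] ji] ij j by (auto simp: pos_def)
    ultimately obtain k where k: "q = (1, k)" "Suc i < k" "k < j"
      using qp ij j by (cases q) (auto simp: pos_def in_points_iff)
    show ?thesis using less.hyps[of k "Suc i"] q k by auto
  qed
qed

lemma strict_mono_nat_id:
  fixes f :: "nat \<Rightarrow> nat"
  assumes "\<And>i. i < n \<Longrightarrow> f i < n" "\<And>i j. i < j \<Longrightarrow> j < n \<Longrightarrow> f i < f j" "i < n"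
  shows "f i = i"
proof -
  have 1: "i < n \<Longrightarrow> i \<le> f i" for i
  proof (induction i)
    case (Suc i)
    then have "i \<le> f i" "f i < f (Suc i)" using assms(2)[of i "Suc i"] by auto
    then show ?case by simp
  qed simp
  have 2: "i + k < n \<Longrightarrow> f i + k \<le> f (i + k)" for i k
  proof (induction k)
    case (Suc k)
    then have "f i + k \<le> f (i + k)" "f (i + k) < f (i + Suc k)" using assms(2)[of "i + k" "i + Suc k"] by auto
    then show ?case by simp
  qed simp
  have "f i + (n - 1 - i) \<le> f (n - 1)" using 2[of i "n - 1 - i"] assms(3) by simp
  moreover have "f (n - 1) < n" using assms(1,3) by simp
  ultimately show ?thesis using 1[OF assms(3)] assms(3) by simp
qed

text \<open>Without top arcs every top point starts a through strand, and either alternative of the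
  last hypothesis makes these strands reach all bottom points. As bottom positions run backwards,
  noncrossing means that the strands keep their order, and an order-preserving bijection of an
  initial segment is the identity.\<close>

lemma through_diagram_id:
  assumes d: "d \<in> diagrams m n" and top: "\<And>i j. ((0, i), (0, j)) \<notin> arcs d"
    and n: "m = n \<or> (\<forall>i j. ((1, i), (1, j)) \<notin> arcs d)"
  shows "m = n" "d = id_diagram n"
proof -
  note D = diagramsD[OF d]
  have "\<exists>j. ((0, i), (1, j)) \<in> arcs d" if i: "i < m" for i
  proof -
    obtain q where q: "((0, i), q) \<in> arcs d" using D(6)[of "(0, i)"] i by (auto simp: in_points_iff)
    then have "q \<in> points m n" "fst q \<noteq> 0" using D(3) top by (blast, metis prod.collapse)
    then show ?thesis using q by (cases q) (auto simp: in_points_iff)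
  qed
  then obtain f where f: "((0, i), (1, f i)) \<in> arcs d" if "i < m" for i by metis
  have fn: "f i < n" if "i < m" for i using D(3)[OF f[OF that]] by (simp add: in_points_iff)
  have inj: "inj_on f {..<m}"
    using f D(4,7) unfolding inj_on_def by (metis Pair_inject lessThan_iff)
  have mono: "f i < f j" if "i < j" "j < m" for i j
  proof (rule ccontr)
    assume "\<not> f i < f j"
    moreover have "f i \<noteq> f j" using inj that by (metis inj_onD lessThan_iff less_trans nat_neq_iff)
    ultimately have "f j < f i" by simp
    then show False using D(8)[OF f f, of i j] that fn[of i] fn[of j] by (auto simp: pos_def)
  qed
  have image: "f ` {..<m} \<subseteq> {..<n}" using fn by auto
  have surj: "f ` {..<m} = {..<n}"
    using n
  proof
    assume "m = n"
    then show ?thesis using inj image by (simp add: endo_inj_surj)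
  next
    assume b: "\<forall>i j. ((1, i), (1, j)) \<notin> arcs d"
    have "j \<in> f ` {..<m}" if j: "j < n" for j
    proof -
      obtain q where q: "((1, j), q) \<in> arcs d" using D(6)[of "(1, j)"] j by (auto simp: in_points_iff)
      then have "q \<in> points m n" "fst q \<noteq> 1" using D(3) b by (blast, metis prod.collapse)
      then obtain i where i: "q = (0, i)" "i < m" by (cases q) (auto simp: in_points_iff)
      then have "(1, f i) = (1 :: nat, j)" using D(4,7) f[OF i(2)] q by blast
      then show ?thesis using i by auto
    qed
    then show ?thesis using image by blast
  qed
  show mn: "m = n" using card_image[OF inj] surj by simp
  have id: "f i = i" if "i < n" for i
    using strict_mono_nat_id[of n f i] fn mono that mn by blast
  have "(p, q) \<in> arcs d \<longleftrightarrow> (p, q) \<in> arcs (id_diagram n)" for p q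
  proof
    have up: "((1, i), (0, i)) \<in> arcs d" if "i < n" for i using D(4) f[of i] id that mn by simp
    assume pq: "(p, q) \<in> arcs d"
    then have "p \<in> points n n" using D(3) mn by blast
    then obtain i where i: "i < n" "p = (0, i) \<or> p = (1, i)" by (cases p) (auto simp: in_points_iff)
    then have "p = (0, i) \<and> q = (1, i) \<or> p = (1, i) \<and> q = (0, i)"
      using D(7) pq f[of i] id up mn by metis
    then show "(p, q) \<in> arcs (id_diagram n)" using i by (auto simp: id_diagram_def)
  next
    assume "(p, q) \<in> arcs (id_diagram n)"
    then show "(p, q) \<in> arcs d" using f id mn D(4) by (force simp: id_diagram_def)
  qed
  then have "arcs d = arcs (id_diagram n)" by auto
  then show "d = id_diagram n" using D(1,2) mn by (intro diagram.expand) (simp add: id_diagram_def)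
qed

lemma innermost_top_arc:
  assumes d: "d \<in> diagrams m n" and "((0, i), (0, j)) \<in> arcs d"
  shows "\<exists>t. Suc t < m \<and> ((0, t), (0, Suc t)) \<in> arcs d"
proof -
  have pd: "partition_diagram d" using diagrams_partition[OF d] by simp
  have fl: "((1, i), (1, j)) \<in> arcs (flip d) \<longleftrightarrow> ((0, i), (0, j)) \<in> arcs d" for i j
    unfolding arcs_flip_good[OF pd] by simp
  have "((0, j), (0, i)) \<in> arcs d" "i \<noteq> j" using diagramsD(4,5)[OF d] assms(2) by blast+
  then show ?thesis
    using innermost_bottom_arc[OF flip_in_diagrams[OF d]] assms(2) unfolding fl by (metis nat_neq_iff)
qed

lemma diagram_cases:
  assumes d: "d \<in> diagrams m n"
  obtains (id) "m = n" "d = id_diagram n"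
  | (bottom) t where "Suc t < n" "((1, t), (1, Suc t)) \<in> arcs d"
  | (top) t where "Suc t < m" "((0, t), (0, Suc t)) \<in> arcs d"
proof -
  have b: "i < j \<or> j < i" if "((a, i), (a, j)) \<in> arcs d" for a i j
    using diagramsD(5)[OF d] that by (metis nat_neq_iff)
  show ?thesis
    using that through_diagram_id[OF d] innermost_top_arc[OF d] innermost_bottom_arc[OF d]
      b diagramsD(4)[OF d] by metis
qed

text \<open>If all top points of an endomorphism run through, no bottom point is left over. So a
  non-identity diagram turns back at the top, and later arguments about \<open>End(n)\<close> can
  test caps alone.\<close>

lemma nonidentity_arcs:
  assumes d: "d \<in> diagrams n n" "d \<noteq> id_diagram n"
  shows "\<exists>t. Suc t < n \<and> ((0, t), (0, Suc t)) \<in> arcs d"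
  using through_diagram_id[OF d(1)] innermost_top_arc[OF d(1)] d(2) by metis

section \<open>Closure under composition and juxtaposition\<close>

abbreviation mdg :: "nat \<Rightarrow> nat \<Rightarrow> monomial \<Rightarrow> bool" where
  "mdg m n x \<equiv> snd x \<in> diagrams m n"

lemma mdgD: "mdg m n x \<Longrightarrow> mgood x \<and> mtops x = m \<and> mbots x = n"
  using diagrams_partition[of "snd x" m n] by (simp add: mgood_def mtops_def mbots_def)

definition capE :: "nat \<Rightarrow> nat \<Rightarrow> monomial" where
  "capE a b = mtens (mid a) (mtens (mcap 1) (mid b))"

definition cupE :: "nat \<Rightarrow> nat \<Rightarrow> monomial" where
  "cupE a b = mtens (mid a) (mtens (mcup 1) (mid b))"

lemma capE_simps [simp]:
  "mgood (capE a b)" "mtops (capE a b) = a + (2 + b)" "mbots (capE a b) = a + b"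
  "mgood (cupE a b)" "mtops (cupE a b) = a + b" "mbots (cupE a b) = a + (2 + b)"
  "mflip (capE a b) = cupE a b" "mflip (cupE a b) = capE a b"
  by (simp_all add: capE_def cupE_def mflip_mtens)

text \<open>The bridge between two descriptions of adding an arc: insertion, for which planarity is
  known, and composition with a single cup, for which the algebra is known. No loop arises, so the
  exponent stays.\<close>

lemma ins_eq_cup:
  assumes x: "mdg m (t + b) x"
  shows "mcomp (cupE t b) x = (fst x, ins t (snd x))"
proof (rule mono_eqI)
  note X = mdgD[OF x]
  have d: "snd x \<in> diagrams m (t + b)" using x .
  have i: "ins t (snd x) \<in> diagrams m (t + b + 2)" by (rule ins_in_diagrams[OF d]) simp
  show "mgood (fst x, ins t (snd x))" "mtops (mcomp (cupE t b) x) = mtops (fst x, ins t (snd x))"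
    "mbots (mcomp (cupE t b) x) = mbots (fst x, ins t (snd x))"
    using mdgD[of "(fst x, ins t (snd x))" m "t + b + 2"] i X by auto
  show "mgood (mcomp (cupE t b) x)" using X by simp
  fix s u :: "bool list" assume "length s = mtops (fst x, ins t (snd x))" "length u = mbots (fst x, ins t (snd x))"
  then have s: "length s = m" and ul: "length u = t + (2 + b)"
    using mdgD[of "(fst x, ins t (snd x))" m "t + b + 2"] i by auto
  define u1 u2 u3 where "u1 = take t u" and "u2 = take 2 (drop t u)" and "u3 = drop 2 (drop t u)"
  have u: "u = u1 @ u2 @ u3" and l: "length u1 = t" "length u2 = 2" "length u3 = b"
    using ul by (simp_all add: u1_def u2_def u3_def del: drop_drop)
  obtain c c' where u2: "u2 = [c, c']" using l(2) by (auto simp: length_Suc_conv numeral_2_eq_2)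
  have col: "colour s u (skip t p) = colour s (u1 @ u3) p" if "p \<in> points m (t + b)" for p
    using that l by (auto simp: skip_def colour_def in_points_iff u u2 nth_append nth_Cons')
  have "fits (ins t (snd x)) s u \<longleftrightarrow> fits (snd x) s (u1 @ u3) \<and> c = c'"
  proof -
    have "colour s u (1, t) = c" "colour s u (1, Suc t) = c'"
      using l by (simp_all add: colour_def u u2 nth_append)
    then have "(\<forall>p q. (p, q) \<in> arcs (ins t (snd x)) \<longrightarrow> colour s u p = colour s u q) \<longleftrightarrow>
      (\<forall>p q. (p, q) \<in> arcs (snd x) \<longrightarrow> colour s u (skip t p) = colour s u (skip t q)) \<and> c = c'"
      unfolding arcs_ins by blast
    also have "(\<forall>p q. (p, q) \<in> arcs (snd x) \<longrightarrow> colour s u (skip t p) = colour s u (skip t q)) \<longleftrightarrow>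
        (\<forall>p q. (p, q) \<in> arcs (snd x) \<longrightarrow> colour s (u1 @ u3) p = colour s (u1 @ u3) q)"
      using col diagramsD(3)[OF d] by (metis (no_types, lifting))
    finally show ?thesis
      using s ul l diagramsD(1,2)[OF d] diagramsD(1,2)[OF i] unfolding fits_def by simp
  qed
  then have "wt (fst x, ins t (snd x)) s u = wt x s (u1 @ u3) * of_bool (c = c')"
    by (simp add: wt_def)
  also have "\<dots> = wt (mcomp (cupE t b) x) s u"
  proof -
    have "wt (mcomp (cupE t b) x) s u = (\<Sum>v\<in>bl t. \<Sum>w\<in>bl b. wt x s (v @ w) * wt (cupE t b) (v @ w) u)"
      using X by (simp add: sum_bl_add)
    also have "\<dots> = (\<Sum>v\<in>bl t. \<Sum>w\<in>bl b. of_bool (v = u1) * (of_bool (w = u3) * (wt x s (v @ w) * of_bool (c = c'))))"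
      using l by (intro sum.cong refl) (auto simp: cupE_def u u2)
    also have "\<dots> = wt x s (u1 @ u3) * of_bool (c = c')"
      using l by (simp add: sum_distrib_left [symmetric])
    finally show ?thesis by simp
  qed
  finally show "wt (mcomp (cupE t b) x) s u = wt (fst x, ins t (snd x)) s u" by simp
qed

lemma cupE_mdg:
  assumes "mdg m (t + b) x"
  shows "mdg m (t + (2 + b)) (mcomp (cupE t b) x)"
  using ins_in_diagrams[OF assms, of t] unfolding ins_eq_cup[OF assms] by (simp add: ac_simps)

lemma mflip_mdg: "mdg m n x \<Longrightarrow> mdg n m (mflip x)"
  by (simp add: mflip_def flip_in_diagrams)

lemma capE_mdg:
  assumes "mdg (t + b) m x"
  shows "mdg (t + (2 + b)) m (mcomp x (capE t b))"
proof -
  have "mdg (t + (2 + b)) m (mflip (mcomp (cupE t b) (mflip x)))"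
    using mflip_mdg cupE_mdg assms by blast
  then show ?thesis using mdgD[OF assms] by (simp add: mflip_mcomp mflip_mflip)
qed

lemma mid_mdg: "mdg n n (mid n)"
  by (simp add: mid_def id_in_diagrams)

lemma bottom_arc_cup:
  assumes d: "mdg m n x" and arc: "((1, t), (1, Suc t)) \<in> arcs (snd x)" and t: "Suc t < n"
  obtains y b where "mdg m (t + b) y" "x = mcomp (cupE t b) y" "n = t + (2 + b)" "fst y = fst x"
proof -
  define b where "b = n - 2 - t"
  have n: "n = t + b + 2" using t by (simp add: b_def)
  obtain e where e: "e \<in> diagrams m (t + b)" "snd x = ins t e"
    using ins_exhaust[of "snd x" m "t + b" t] d arc n by auto
  show ?thesis
    by (rule that[of "(fst x, e)" b]) (use e n ins_eq_cup[of "(fst x, e)" m t b] in \<open>auto simp: prod_eq_iff\<close>)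
qed

lemma top_arc_cap:
  assumes d: "mdg m n x" and arc: "((0, t), (0, Suc t)) \<in> arcs (snd x)" and t: "Suc t < m"
  obtains y b where "mdg (t + b) n y" "x = mcomp y (capE t b)" "m = t + (2 + b)" "fst y = fst x"
proof -
  have "partition_diagram (snd x)" using diagrams_partition[OF d] by simp
  then have "((1, t), (1, Suc t)) \<in> arcs (snd (mflip x))"
    using arc by (simp add: mflip_def arcs_flip_good)
  then obtain y b where y: "mdg n (t + b) y" "mflip x = mcomp (cupE t b) y" "m = t + (2 + b)" "fst y = fst (mflip x)"
    using bottom_arc_cup[OF mflip_mdg[OF d]] t by metis
  have "x = mflip (mflip x)" using mdgD[OF d] mflip_mflip by simp
  also have "\<dots> = mcomp (mflip y) (mflip (cupE t b))"
    unfolding y(2) by (rule mflip_mcomp) (use mdgD[OF y(1)] in simp_all)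
  finally have "x = mcomp (mflip y) (capE t b)" by (simp only: capE_simps)
  moreover have "mdg (t + b) n (mflip y)" using y(1) by (rule mflip_mdg)
  moreover have "fst (mflip y) = fst x" using y(4) by (simp only: mflip_def fst_conv)
  ultimately show ?thesis using y(3) by (intro that)
qed

text \<open>An induction principle for crossingless diagrams: each is an identity or loses an
  innermost arc, leaving a diagram with two endpoints fewer.\<close>

lemma mdg_cases:
  assumes "mdg m n x"
  obtains (id) "m = n" "x = (fst x, id_diagram n)"
  | (bottom) t b y where "mdg m (t + b) y" "x = mcomp (cupE t b) y" "n = t + (2 + b)" "fst y = fst x"
  | (top) t b y where "mdg (t + b) n y" "x = mcomp y (capE t b)" "m = t + (2 + b)" "fst y = fst x"
  using assms
proof (cases rule: diagram_cases)
  case id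
  then show ?thesis using that(1) by (simp add: prod_eq_iff)
next
  case (bottom t)
  then show ?thesis using bottom_arc_cup[OF assms bottom(2,1)] that(2) by blast
next
  case (top t)
  then show ?thesis using top_arc_cap[OF assms top(2,1)] that(3) by blast
qed

section \<open>Relations between single cups and caps\<close>

lemma far_commute:
  assumes "mgood x" "mgood y" "mtops x = a" "mbots x = a'" "mtops y = b" "mbots y = b'"
  shows "mcomp (mtens x (mid b')) (mtens (mid a) y) = mtens x y"
    "mcomp (mtens (mid a') y) (mtens x (mid b)) = mtens x y"
  using assms by (simp_all add: interchange)

lemma capE_tens: "mtens (capE a b) (mid c) = capE a (b + c)" "mtens (mid c) (capE a b) = capE (c + a) b"
  "mtens (cupE a b) (mid c) = cupE a (b + c)" "mtens (mid c) (cupE a b) = cupE (c + a) b"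
  by (simp_all add: capE_def cupE_def mtens_assoc mtens_mid) (simp_all add: mtens_mid [symmetric] mtens_assoc)

lemma capE_cupE_far:
  "mcomp (capE a (c + (2 + b))) (cupE (a + (2 + c)) b) = mcomp (cupE (a + c) b) (capE a (c + b))"
  "mcomp (capE (a + (2 + c)) b) (cupE a (c + (2 + b))) = mcomp (cupE a (c + b)) (capE (a + c) b)"
proof -
  have "capE a (c + (2 + b)) = mtens (capE a c) (mid (2 + b))" "cupE (a + (2 + c)) b = mtens (mid (a + (2 + c))) (cupE 0 b)"
    "cupE (a + c) b = mtens (mid (a + c)) (cupE 0 b)" "capE a (c + b) = mtens (capE a c) (mid b)"
    "capE (a + (2 + c)) b = mtens (mid (a + (2 + c))) (capE 0 b)" "cupE a (c + (2 + b)) = mtens (cupE a c) (mid (2 + b))"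
    "cupE a (c + b) = mtens (cupE a c) (mid b)" "capE (a + c) b = mtens (mid (a + c)) (capE 0 b)"
    by (simp_all add: capE_tens)
  then show "mcomp (capE a (c + (2 + b))) (cupE (a + (2 + c)) b) = mcomp (cupE (a + c) b) (capE a (c + b))"
    "mcomp (capE (a + (2 + c)) b) (cupE a (c + (2 + b))) = mcomp (cupE a (c + b)) (capE (a + c) b)"
    using far_commute[of "capE a c" "cupE 0 b" "a + (2 + c)" "a + c" b "2 + b"]
      far_commute[of "cupE a c" "capE 0 b" "a + c" "a + (2 + c)" "2 + b" b] by simp_all
qed

text \<open>The local relations: a cap and a cup offset by one strand straighten out, and at the
  same place they close a loop.\<close>

lemma capE_cupE_near:
  "mcomp (capE a (Suc b)) (cupE (Suc a) b) = mid (a + (Suc b))"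
  "mcomp (capE (Suc a) b) (cupE a (Suc b)) = mid (a + (Suc b))"
  "mcomp (capE a b) (cupE a b) = (1, id_diagram (a + b))"
proof -
  have 1: "mcomp (capE 0 1) (cupE 1 0) = mid 1" "mcomp (capE 1 0) (cupE 0 1) = mid 1"
    using zigzag[of 1] by (simp_all add: capE_def cupE_def)
  have c: "capE a (Suc b) = mtens (mid a) (mtens (capE 0 1) (mid b))" "cupE (Suc a) b = mtens (mid a) (mtens (cupE 1 0) (mid b))"
    "capE (Suc a) b = mtens (mid a) (mtens (capE 1 0) (mid b))" "cupE a (Suc b) = mtens (mid a) (mtens (cupE 0 1) (mid b))"
    by (simp_all add: capE_tens)
  show "mcomp (capE a (Suc b)) (cupE (Suc a) b) = mid (a + (Suc b))"
    "mcomp (capE (Suc a) b) (cupE a (Suc b)) = mid (a + (Suc b))"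
    unfolding c by (simp_all add: interchange 1[simplified] mtens_mid)
  have "mcomp (capE a b) (cupE a b) = mtens (mid a) (mtens (1, id_diagram 0) (mid b))"
    unfolding capE_def cupE_def by (simp add: interchange mcap_mcup)
  also have "\<dots> = (1, snd (mtens (mid a) (mtens (mid 0) (mid b))))" by (simp add: mtens_def mid_def)
  also have "\<dots> = (1, id_diagram (a + b))" by (simp add: mtens_mid) (simp add: mid_def)
  finally show "mcomp (capE a b) (cupE a b) = (1, id_diagram (a + b))" .
qed

lemma mcomp_scalar:
  "mcomp (Suc k, d) x = (Suc (fst (mcomp (k, d) x)), snd (mcomp (k, d) x))"
  "snd (mcomp (k, d) x) = snd (mcomp (k', d) x)" "snd (mcomp x (k, d)) = snd (mcomp x (k', d))"
  by (simp_all add: mcomp_def)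

text \<open>The difficult generator: a cap glued below \<open>x\<close> may join two different
  strands, so this is not an insertion. Peeling an arc off \<open>x\<close> leaves a cap meeting a
  cup, and the two coincide (loop), overlap in one strand (snake) or are disjoint; in the last case
  they commute and the induction applies to the cap that has moved up.\<close>

lemma mdg_capE:
  assumes "mdg m (t + (2 + b)) x"
  shows "mdg m (t + b) (mcomp (capE t b) x)"
  using assms
proof (induction "m + (t + b)" arbitrary: m t b x rule: less_induct)
  case less
  from less.prems show ?case
  proof (cases rule: mdg_cases)
    case id
    have "mdg m (t + b) (mcomp (mid (t + b)) (capE t b))" 
      using capE_mdg[OF mid_mdg] id by simp
    then have "mdg m (t + b) (mcomp (capE t b) (mid (t + (2 + b))))" by simp
    then show ?thesis using id(2) mcomp_scalar(3) unfolding mid_def by metis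
  next
    case (top t' b' y)
    have "mdg (t' + b') (t + b) (mcomp (capE t b) y)"
      by (rule less.hyps) (use top in auto)
    then have "mdg m (t + b) (mcomp (mcomp (capE t b) y) (capE t' b'))" using capE_mdg top(3) by blast
    then show ?thesis using top(2) mdgD[OF top(1)] by (simp add: mcomp_assoc)
  next
    case (bottom t' b' y)
    note Y = mdgD[OF bottom(1)]
    have x: "mcomp (capE t b) x = mcomp (mcomp (capE t b) (cupE t' b')) y"
      using bottom Y by (simp add: mcomp_assoc)
    consider "t = t'" "b = b'" | "t' = Suc t" "b = Suc b'" | "t = Suc t'" "b' = Suc b"
      | c where "t' = t + (2 + c)" "b = c + (2 + b')" | c where "t = t' + (2 + c)" "b' = c + (2 + b)"
    proof -
      have "t + b = t' + b'" using bottom(3) by simp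
      moreover have "t = t' \<or> t' = Suc t \<or> t = Suc t' \<or> (\<exists>c. t' = t + (2 + c)) \<or> (\<exists>c. t = t' + (2 + c))"
        by presburger
      ultimately show ?thesis using that by (smt (verit) add.assoc add.commute add_Suc_right add_left_cancel)
    qed
    then show ?thesis
    proof cases
      case 1
      have "snd (mcomp (1, id_diagram (t + b)) y) = snd (mcomp (mid (t + b)) y)"
        unfolding mid_def by (rule mcomp_scalar(2))
      then show ?thesis using x 1 bottom(1) Y by (simp add: capE_cupE_near)
    next
      case 2
      then show ?thesis using x bottom(1) Y by (simp add: capE_cupE_near)
    next
      case 3
      then show ?thesis using x bottom(1) Y by (simp add: capE_cupE_near)
    next
      case (4 c)
      have "mdg m (t + (c + b')) (mcomp (capE t (c + b')) y)"
        by (rule less.hyps) (use bottom(1) 4 in \<open>auto simp: ac_simps\<close>)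
      then have "mdg m (t + c + (2 + b')) (mcomp (cupE (t + c) b') (mcomp (capE t (c + b')) y))"
        by (intro cupE_mdg) (simp add: ac_simps)
      moreover have "mcomp (capE t b) x = mcomp (cupE (t + c) b') (mcomp (capE t (c + b')) y)"
      proof -
        have "mcomp (capE t b) (cupE t' b') = mcomp (cupE (t + c) b') (capE t (c + b'))"
          unfolding 4 by (rule capE_cupE_far(1))
        then have "mcomp (capE t b) x = mcomp (mcomp (cupE (t + c) b') (capE t (c + b'))) y" using x by simp
        also have "\<dots> = mcomp (cupE (t + c) b') (mcomp (capE t (c + b')) y)"
          by (rule mcomp_assoc [symmetric]) (use Y 4 in auto)
        finally show ?thesis .
      qed
      ultimately show ?thesis using 4 by (simp add: ac_simps)
    next
      case (5 c)
      have "mdg m (t' + c + b) (mcomp (capE (t' + c) b) y)"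
        by (rule less.hyps) (use bottom(1) 5 in \<open>auto simp: ac_simps\<close>)
      then have "mdg m (t' + (2 + (c + b))) (mcomp (cupE t' (c + b)) (mcomp (capE (t' + c) b) y))"
        by (intro cupE_mdg) (simp add: ac_simps)
      moreover have "mcomp (capE t b) x = mcomp (cupE t' (c + b)) (mcomp (capE (t' + c) b) y)"
      proof -
        have "mcomp (capE t b) (cupE t' b') = mcomp (cupE t' (c + b)) (capE (t' + c) b)"
          unfolding 5 by (rule capE_cupE_far(2))
        then have "mcomp (capE t b) x = mcomp (mcomp (cupE t' (c + b)) (capE (t' + c) b)) y" using x by simp
        also have "\<dots> = mcomp (cupE t' (c + b)) (mcomp (capE (t' + c) b) y)"
          by (rule mcomp_assoc [symmetric]) (use Y 5 in auto)
        finally show ?thesis .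
      qed
      ultimately show ?thesis using 5 by (simp add: ac_simps)
    qed
  qed
qed

text \<open>Planarity of stacking by peeling arcs off the lower diagram \<open>y\<close>: its caps
  are absorbed into \<open>x\<close> by \<open>mdg_capE\<close>, its cups are insertions.\<close>

lemma mcomp_mdg:
  assumes "mdg m n x" "mdg n k y"
  shows "mdg m k (mcomp y x)"
  using assms
proof (induction "n + k" arbitrary: m n k x y rule: less_induct)
  case less
  note X = mdgD[OF less.prems(1)]
  from less.prems(2) show ?case
  proof (cases rule: mdg_cases)
    case id
    then have "snd (mcomp y x) = snd (mcomp (mid n) x)" using mcomp_scalar(2) unfolding mid_def by metis
    then show ?thesis using X less.prems(1) id(1) by simp
  next
    case (top t b z)
    have "mdg m (t + b) (mcomp (capE t b) x)" using mdg_capE less.prems(1) top(3) by blast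
    then have "mdg m k (mcomp z (mcomp (capE t b) x))"
      by (rule less.hyps[rotated]) (use top in auto)
    then show ?thesis using top X mdgD[OF top(1)] by (simp add: mcomp_assoc)
  next
    case (bottom t b z)
    have "mdg m (t + b) (mcomp z x)"
      by (rule less.hyps) (use bottom less.prems(1) in auto)
    then have "mdg m k (mcomp (cupE t b) (mcomp z x))" using cupE_mdg bottom(3) by blast
    then show ?thesis using bottom X mdgD[OF bottom(1)] by (simp add: mcomp_assoc)
  qed
qed

lemma mtens_mid_mdg:
  assumes "mdg m n x"
  shows "mdg (m + k) (n + k) (mtens x (mid k))" "mdg (k + m) (k + n) (mtens (mid k) x)"
proof -
  have "mdg (m + k) (n + k) (mtens x (mid k)) \<and> mdg (k + m) (k + n) (mtens (mid k) x)"
    using assms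
  proof (induction "m + n" arbitrary: m n x rule: less_induct)
    case less
    from less.prems show ?case
    proof (cases rule: mdg_cases)
      case id
      have "snd (mtens x (mid k)) = snd (mtens (mid n) (mid k))" "snd (mtens (mid k) x) = snd (mtens (mid k) (mid n))"
        by (subst id(2), simp add: mtens_def mid_def)+
      then show ?thesis using id(1) mid_mdg by (simp add: mtens_mid)
    next
      case (top t b z)
      note Z = mdgD[OF top(1)]
      have 1: "mtens x (mid k) = mcomp (mtens z (mid k)) (capE t (b + k))"
        "mtens (mid k) x = mcomp (mtens (mid k) z) (capE (k + t) b)"
        using Z top by (simp_all add: capE_tens [symmetric] interchange)
      have "mdg (t + b + k) (n + k) (mtens z (mid k)) \<and> mdg (k + (t + b)) (k + n) (mtens (mid k) z)"
        by (rule less.hyps) (use top in auto)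
      then show ?thesis using capE_mdg[of "mtens z (mid k)" t "b + k" "n + k"] capE_mdg[of "mtens (mid k) z" "k + t" b "k + n"] top(3)
        unfolding 1 by (simp add: ac_simps)
    next
      case (bottom t b z)
      note Z = mdgD[OF bottom(1)]
      have 1: "mtens x (mid k) = mcomp (cupE t (b + k)) (mtens z (mid k))"
        "mtens (mid k) x = mcomp (cupE (k + t) b) (mtens (mid k) z)"
        using Z bottom by (simp_all add: capE_tens [symmetric] interchange)
      have "mdg (m + k) (t + b + k) (mtens z (mid k)) \<and> mdg (k + m) (k + (t + b)) (mtens (mid k) z)"
        by (rule less.hyps) (use bottom in auto)
      then show ?thesis using cupE_mdg[of "mtens z (mid k)" "m + k" t "b + k"] cupE_mdg[of "mtens (mid k) z" "k + m" "k + t" b] bottom(3)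
        unfolding 1 by (simp add: ac_simps)
    qed
  qed
  then show "mdg (m + k) (n + k) (mtens x (mid k))" "mdg (k + m) (k + n) (mtens (mid k) x)" by simp_all
qed

lemma mtens_mdg:
  assumes x: "mdg m n x" and y: "mdg m' n' y"
  shows "mdg (m + m') (n + n') (mtens x y)"
proof -
  have "mtens x y = mcomp (mtens x (mid n')) (mtens (mid m) y)"
    using far_commute(1) mdgD[OF x] mdgD[OF y] by simp
  then show ?thesis using mcomp_mdg mtens_mid_mdg x y by metis
qed

lemma stack_in_diagrams:
  assumes "d \<in> diagrams m n" "e \<in> diagrams n k"
  shows "stack_diagram d e \<in> diagrams m k"
  using mcomp_mdg[of "(0, d)" m n "(0, e)" k] assms by (simp add: mcomp_def)

lemma juxtapose_in_diagrams:
  assumes "d \<in> diagrams m n" "e \<in> diagrams m' n'"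
  shows "juxtapose d e \<in> diagrams (m + m') (n + n')"
  using mtens_mdg[of "(0, d)" m n "(0, e)" m' n'] assms by (simp add: mtens_def)

text \<open>The innermost of \<open>n + 1\<close> nested arcs is a single cup inserted in the middle
  of the other \<open>n\<close>.\<close>

lemma cup_in_diagrams: "cup_diagram n \<in> diagrams 0 (2 * n)"
proof (induction n)
  case 0
  have "cup_diagram 0 = id_diagram 0" by (simp add: cup_diagram_def id_diagram_def)
  then show ?case using id_in_diagrams[of 0] by simp
next
  case (Suc n)
  have "mcup (Suc n) = mflip (mcap (n + 1))" by simp
  also have "\<dots> = mcomp (cupE n n) (mcup n)"
    unfolding mcap_add by (simp add: mflip_mcomp mflip_mtens cupE_def)
  finally have "mcup (Suc n) = mcomp (cupE n n) (mcup n)" .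
  moreover have "mdg 0 (n + (2 + n)) (mcomp (cupE n n) (mcup n))"
    by (rule cupE_mdg) (use Suc in \<open>simp add: mcup_def mult_2\<close>)
  ultimately have "mdg 0 (n + (2 + n)) (mcup (Suc n))" by simp
  then show ?case by (simp add: mcup_def mult_2)
qed

lemma cap_in_diagrams: "cap_diagram n \<in> diagrams (2 * n) 0"
proof -
  have "mdg (2 * n) 0 (mflip (mcup n))"
    by (rule mflip_mdg) (simp add: mcup_def cup_in_diagrams)
  then show ?thesis by (simp add: mcap_def)
qed

section \<open>Linear extension\<close>

lemma lookup_scale [simp]: "Poly_Mapping.lookup (scale c x) a = c * Poly_Mapping.lookup x a"
  unfolding scale_def by (simp add: Poly_Mapping.map.rep_eq when_def)

lemma scale_simps [simp]:
  "scale 0 x = 0" "scale c 0 = 0" "scale 1 x = x" "scale c (scale c' x) = scale (c * c') x"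
  "scale c (Poly_Mapping.single a b) = Poly_Mapping.single a (c * b)"
  by (rule poly_mapping_eqI; simp add: lookup_single when_def)+

lemma scale_linear:
  "scale c (x + y) = scale c x + scale c y" "scale c (x - y) = scale c x - scale c y"
  "scale (c + c') x = scale c x + scale c' x" "scale (c - c') x = scale c x - scale c' x"
  by (rule poly_mapping_eqI; simp add: lookup_add lookup_minus algebra_simps)+

lemma scale_sum: "scale c (\<Sum>i\<in>I. f i) = (\<Sum>i\<in>I. scale c (f i))"
  by (induction I rule: infinite_finite_induct) (auto simp: scale_linear)

lemma minus_eq_scale: "x - y = x + scale (- 1) y"
  by (rule poly_mapping_eqI) (simp add: lookup_add lookup_minus)

lemma keys_scale: "Poly_Mapping.keys (scale c x) \<subseteq> Poly_Mapping.keys x"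
  by (auto simp: in_keys_iff)

text \<open>Cancellation can make the keys of a sum fewer than those of its terms. Summing over a
  common finite superset reduces bilinearity to a comparison of sums over one index set.\<close>

lemma bilinear_ext_superset:
  assumes "finite S" "finite T" "Poly_Mapping.keys x \<subseteq> S" "Poly_Mapping.keys y \<subseteq> T"
  shows "bilinear_ext h x y = (\<Sum>a\<in>S. \<Sum>b\<in>T. scale (Poly_Mapping.lookup x a * Poly_Mapping.lookup y b) (h a b))"
proof -
  have "bilinear_ext h x y = (\<Sum>a\<in>Poly_Mapping.keys x. \<Sum>b\<in>T. scale (Poly_Mapping.lookup x a * Poly_Mapping.lookup y b) (h a b))"
    unfolding bilinear_ext_def
    by (intro sum.cong refl sum.mono_neutral_left) (use assms in \<open>auto simp: in_keys_iff\<close>)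
  also have "\<dots> = (\<Sum>a\<in>S. \<Sum>b\<in>T. scale (Poly_Mapping.lookup x a * Poly_Mapping.lookup y b) (h a b))"
    by (intro sum.mono_neutral_left) (use assms in \<open>auto simp: in_keys_iff\<close>)
  finally show ?thesis .
qed

lemma bilinear_ext_add:
  "bilinear_ext h (x + x') y = bilinear_ext h x y + bilinear_ext h x' y"
  "bilinear_ext h x (y + y') = bilinear_ext h x y + bilinear_ext h x y'"
proof -
  let ?K = Poly_Mapping.keys
  have f: "finite (?K x \<union> ?K x' \<union> ?K (x + x'))" "finite (?K y)" by auto
  show "bilinear_ext h (x + x') y = bilinear_ext h x y + bilinear_ext h x' y"
    by (subst (1 2 3) bilinear_ext_superset[OF f])
      (auto simp: lookup_add distrib_right scale_linear sum.distrib)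
  have f: "finite (?K x)" "finite (?K y \<union> ?K y' \<union> ?K (y + y'))" by auto
  show "bilinear_ext h x (y + y') = bilinear_ext h x y + bilinear_ext h x y'"
    by (subst (1 2 3) bilinear_ext_superset[OF f])
      (auto simp: lookup_add distrib_left scale_linear sum.distrib)
qed

lemma bilinear_ext_scale:
  "bilinear_ext h (scale c x) y = scale c (bilinear_ext h x y)"
  "bilinear_ext h x (scale c y) = scale c (bilinear_ext h x y)"
proof -
  let ?K = Poly_Mapping.keys
  have f: "finite (?K x)" "finite (?K y)" by auto
  show "bilinear_ext h (scale c x) y = scale c (bilinear_ext h x y)"
    by (subst (1 2) bilinear_ext_superset[OF f]) (use subsetD[OF keys_scale] in \<open>auto simp: scale_sum mult.assoc\<close>)
  show "bilinear_ext h x (scale c y) = scale c (bilinear_ext h x y)"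
    by (subst (1 2) bilinear_ext_superset[OF f]) (use subsetD[OF keys_scale] in \<open>auto simp: scale_sum mult.left_commute\<close>)
qed

lemma bilinear_ext_0 [simp]: "bilinear_ext h 0 y = 0" "bilinear_ext h x 0 = 0"
  by (simp_all add: bilinear_ext_def)

lemma bilinear_ext_diff:
  "bilinear_ext h (x - x') y = bilinear_ext h x y - bilinear_ext h x' y"
  "bilinear_ext h x (y - y') = bilinear_ext h x y - bilinear_ext h x y'"
  by (simp_all add: minus_eq_scale bilinear_ext_add bilinear_ext_scale)

lemma bilinear_ext_sum:
  "bilinear_ext h (\<Sum>i\<in>I. f i) y = (\<Sum>i\<in>I. bilinear_ext h (f i) y)"
  "bilinear_ext h x (\<Sum>i\<in>I. g i) = (\<Sum>i\<in>I. bilinear_ext h x (g i))"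
  by (induction I rule: infinite_finite_induct; auto simp: bilinear_ext_add)+

lemma bilinear_ext_single:
  "bilinear_ext h (Poly_Mapping.single a c) (Poly_Mapping.single b c') = scale (c * c') (h a b)"
  by (cases "c = 0"; cases "c' = 0") (simp_all add: bilinear_ext_def)

lemmas bilinear_ext_linear = bilinear_ext_add bilinear_ext_scale bilinear_ext_diff bilinear_ext_sum

lemmas tl_comp_linear [simp] = bilinear_ext_linear[where h = "compose_basis A" for A, folded tl_comp_def]
  bilinear_ext_0[where h = "compose_basis A" for A, folded tl_comp_def]
lemmas tl_tensor_linear [simp] = bilinear_ext_linear[where h = "\<lambda>d e. basis (juxtapose d e)", folded tl_tensor_def]
  bilinear_ext_0[where h = "\<lambda>d e. basis (juxtapose d e)", folded tl_tensor_def]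
lemma poly_mapping_expansion: "x = (\<Sum>d\<in>Poly_Mapping.keys x. scale (Poly_Mapping.lookup x d) (basis d))"
  by (rule poly_mapping_eqI)
    (auto simp: lookup_sum lookup_single when_def sum.delta in_keys_iff)

text \<open>An identity that is linear in each argument may be checked on diagrams. Applied once per
  argument, this carries the identities of monomials over to linear combinations.\<close>

lemma poly_mapping_lin_induct [case_names zero add scale basis]:
  assumes "P 0" "\<And>x y. P x \<Longrightarrow> P y \<Longrightarrow> P (x + y)" "\<And>c x. P x \<Longrightarrow> P (scale c x)"
    "\<And>d. d \<in> Poly_Mapping.keys x \<Longrightarrow> P (basis d)"
  shows "P x"
proof -
  have K: "P (\<Sum>d\<in>K. scale (Poly_Mapping.lookup x d) (basis d))" if "finite K" "K \<subseteq> Poly_Mapping.keys x" for K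
    using that
  proof (induction K rule: finite_induct)
    case empty
    show ?case using assms(1) by simp
  next
    case (insert d K)
    then show ?case unfolding sum.insert[OF insert.hyps] by (intro assms(2-4)) auto
  qed
  show ?thesis by (subst poly_mapping_expansion) (rule K; simp)
qed

lemma tl_hom_induct [consumes 1, case_names zero add scale basis]:
  assumes "x \<in> tl_hom m n" "P 0" "\<And>x y. P x \<Longrightarrow> P y \<Longrightarrow> P (x + y)" "\<And>c x. P x \<Longrightarrow> P (scale c x)"
    "\<And>d. d \<in> diagrams m n \<Longrightarrow> P (basis d)"
  shows "P x"
  by (rule poly_mapping_lin_induct[of P]) (use assms in \<open>auto simp: tl_hom_def\<close>)

lemma tl_hom_linear [simp, intro]:
  "0 \<in> tl_hom m n" "x \<in> tl_hom m n \<Longrightarrow> y \<in> tl_hom m n \<Longrightarrow> x + y \<in> tl_hom m n"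
  "x \<in> tl_hom m n \<Longrightarrow> scale c x \<in> tl_hom m n"
  "x \<in> tl_hom m n \<Longrightarrow> y \<in> tl_hom m n \<Longrightarrow> x - y \<in> tl_hom m n"
  "d \<in> diagrams m n \<Longrightarrow> Poly_Mapping.single d c \<in> tl_hom m n"
proof -
  show add: "x + y \<in> tl_hom m n" if "x \<in> tl_hom m n" "y \<in> tl_hom m n" for x y
    using that Poly_Mapping.keys_add[of x y] unfolding tl_hom_def by blast
  show sc: "scale c x \<in> tl_hom m n" if "x \<in> tl_hom m n" for c x
    using that keys_scale[of c x] unfolding tl_hom_def by blast
  show "x - y \<in> tl_hom m n" if "x \<in> tl_hom m n" "y \<in> tl_hom m n"
    unfolding minus_eq_scale using that add sc by blast
qed (auto simp: tl_hom_def)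

lemma tl_hom_sum [simp, intro]: "(\<And>i. i \<in> I \<Longrightarrow> f i \<in> tl_hom m n) \<Longrightarrow> (\<Sum>i\<in>I. f i) \<in> tl_hom m n"
  by (induction I rule: infinite_finite_induct) auto

lemma compose_basis_in_tl_hom:
  "d \<in> diagrams m n \<Longrightarrow> e \<in> diagrams n k \<Longrightarrow> compose_basis A e d \<in> tl_hom m k"
  using stack_in_diagrams[of d m n e k] by (auto simp: compose_basis_def)

lemma tl_comp_in_hom [intro]:
  assumes "x \<in> tl_hom m n" "y \<in> tl_hom n k"
  shows "y \<circ>\<^bsub>A\<^esub> x \<in> tl_hom m k"
  using assms unfolding tl_comp_def bilinear_ext_def
  by (auto simp: tl_hom_def[of m n] tl_hom_def[of n k] intro!: tl_hom_sum tl_hom_linear(3) compose_basis_in_tl_hom)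

lemma tl_tensor_in_hom [intro]:
  assumes "x \<in> tl_hom m n" "y \<in> tl_hom m' n'"
  shows "x \<otimes> y \<in> tl_hom (m + m') (n + n')"
  using assms unfolding tl_tensor_def bilinear_ext_def
  by (auto simp: tl_hom_def[of m n] tl_hom_def[of m' n'] intro!: tl_hom_sum tl_hom_linear(3,5) juxtapose_in_diagrams)

lemma tl_generators_in_hom [simp, intro]:
  "tl_id n \<in> tl_hom n n" "tl_cap n \<in> tl_hom (2 * n) 0" "tl_cup n \<in> tl_hom 0 (2 * n)"
  by (auto simp: tl_id_def tl_cap_def tl_cup_def id_in_diagrams cap_in_diagrams cup_in_diagrams)

section \<open>Monomials evaluated at a parameter\<close>

definition loop :: "complex \<Rightarrow> complex" where "loop A = - (A ^ 2) - inverse A ^ 2"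

text \<open>Identities of monomials are identities between pairs of an exponent and a diagram.
  Although they are proved with loops of weight 2, they therefore transfer to any loop value through
  \<open>ev\<close>.\<close>

definition ev :: "complex \<Rightarrow> monomial \<Rightarrow> tl" where
  "ev A x = Poly_Mapping.single (snd x) (loop A ^ fst x)"

lemma tl_comp_ev: "mbots x = mtops y \<Longrightarrow> ev A y \<circ>\<^bsub>A\<^esub> ev A x = ev A (mcomp y x)"
  by (simp add: tl_comp_def ev_def bilinear_ext_single compose_basis_def mtops_def mbots_def mcomp_def
      power_add loop_def [symmetric])

lemma tl_tensor_ev: "ev A x \<otimes> ev A y = ev A (mtens x y)"
  by (simp add: tl_tensor_def ev_def bilinear_ext_single mtens_def power_add)

lemma ev_generators:
  "basis d = ev A (0, d)" "tl_id n = ev A (mid n)" "tl_cap n = ev A (mcap n)" "tl_cup n = ev A (mcup n)"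
  by (simp_all add: ev_def tl_id_def tl_cap_def tl_cup_def mid_def mcap_def mcup_def)

definition linear_ext :: "('a \<Rightarrow> ('b \<Rightarrow>\<^sub>0 complex)) \<Rightarrow> ('a \<Rightarrow>\<^sub>0 complex) \<Rightarrow> ('b \<Rightarrow>\<^sub>0 complex)" where
  "linear_ext h x = bilinear_ext (\<lambda>_. h) (basis ()) x"

text \<open>Linear rather than conjugate linear: the trace of \<open>adj y\<close> after
  \<open>x\<close> is then a complex bilinear form, whose canonical tensor has the shape of the
  4-vertex.\<close>

definition adj :: "tl \<Rightarrow> tl" where "adj = linear_ext (\<lambda>d. basis (flip d))"

lemma adj_linear [simp]:
  "adj (x + y) = adj x + adj y" "adj (scale c x) = scale c (adj x)" "adj (x - y) = adj x - adj y"
  "adj (\<Sum>i\<in>I. f i) = (\<Sum>i\<in>I. adj (f i))" "adj 0 = 0"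
  by (simp_all add: adj_def linear_ext_def bilinear_ext_linear)

lemma adj_ev: "adj (ev A x) = ev A (mflip x)"
  by (simp add: adj_def linear_ext_def ev_def bilinear_ext_single mflip_def)

lemma adj_in_hom [intro]:
  assumes "x \<in> tl_hom m n"
  shows "adj x \<in> tl_hom n m"
  using assms by (induction x rule: tl_hom_induct) (auto simp: ev_generators(1)[of _ 0] adj_ev, auto simp: ev_def mflip_def flip_in_diagrams)

definition tl_trace :: "complex \<Rightarrow> nat \<Rightarrow> tl \<Rightarrow> complex" where
  "tl_trace A n x = tl_value (tl_cap n \<circ>\<^bsub>A\<^esub> (x \<otimes> tl_id n) \<circ>\<^bsub>A\<^esub> tl_cup n)"

lemma tl_value_linear [simp]:
  "tl_value (x + y) = tl_value x + tl_value y" "tl_value (scale c x) = c * tl_value x" "tl_value (x - y) = tl_value x - tl_value y"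
  "tl_value 0 = 0" "tl_value (\<Sum>i\<in>I. f i) = (\<Sum>i\<in>I. tl_value (f i))"
  by (simp_all add: tl_value_def lookup_add lookup_minus lookup_sum)

lemma tl_trace_linear [simp]:
  "tl_trace A n (x + y) = tl_trace A n x + tl_trace A n y" "tl_trace A n (scale c x) = c * tl_trace A n x"
  "tl_trace A n (x - y) = tl_trace A n x - tl_trace A n y" "tl_trace A n 0 = 0"
  "tl_trace A n (\<Sum>i\<in>I. f i) = (\<Sum>i\<in>I. tl_trace A n (f i))"
  by (simp_all add: tl_trace_def)

lemma tl_trace_ev:
  assumes "mtops x = n" "mbots x = n"
  shows "tl_trace A n (ev A x) = tl_value (ev A (mtrace n x))"
  using assms by (simp add: tl_trace_def ev_generators(2-)[of _ A] tl_tensor_ev tl_comp_ev mtrace_def)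

lemma ev0_simps [simp]: "d \<in> diagrams m n \<Longrightarrow> mgood (a, d)" "d \<in> diagrams m n \<Longrightarrow> mtops (a, d) = m" "d \<in> diagrams m n \<Longrightarrow> mbots (a, d) = n"
  using mdgD[of "(a, d)" m n] by auto

lemma ev0_arity: "d \<in> diagrams m n \<Longrightarrow> mgood (a, d) \<and> mtops (a, d) = m \<and> mbots (a, d) = n"
  by simp

section \<open>The Temperley--Lieb category\<close>

lemma tl_assoc:
  assumes x: "x \<in> tl_hom m n" and y: "y \<in> tl_hom n k" and z: "z \<in> tl_hom k l"
  shows "(z \<circ>\<^bsub>A\<^esub> y) \<circ>\<^bsub>A\<^esub> x = z \<circ>\<^bsub>A\<^esub> y \<circ>\<^bsub>A\<^esub> x"
  using x
proof (induction x rule: tl_hom_induct)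
  case d: (basis d)
  show ?case using y
  proof (induction y rule: tl_hom_induct)
    case e: (basis e)
    show ?case using z
    proof (induction z rule: tl_hom_induct)
      case (basis f)
      then show ?case using ev0_arity[OF d, of 0] ev0_arity[OF e, of 0] ev0_arity[of f k l 0]
        by (simp add: ev_generators(1)[of _ A] tl_comp_ev mcomp_assoc)
    qed auto
  qed auto
qed auto

lemma tl_id_comp:
  assumes x: "x \<in> tl_hom m n"
  shows "tl_id n \<circ>\<^bsub>A\<^esub> x = x" "x \<circ>\<^bsub>A\<^esub> tl_id m = x"
proof -
  show "tl_id n \<circ>\<^bsub>A\<^esub> x = x"
    using x by (induction x rule: tl_hom_induct)
      (auto simp: ev_generators(1,2)[of _ A] tl_comp_ev ev0_arity)
  show "x \<circ>\<^bsub>A\<^esub> tl_id m = x"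
    using x by (induction x rule: tl_hom_induct)
      (auto simp: ev_generators(1,2)[of _ A] tl_comp_ev ev0_arity)
qed

lemma tl_tensor_assoc:
  assumes x: "x \<in> tl_hom m n" and y: "y \<in> tl_hom m' n'" and z: "z \<in> tl_hom m'' n''"
  shows "(x \<otimes> y) \<otimes> z = x \<otimes> y \<otimes> z"
  using x
proof (induction x rule: tl_hom_induct)
  case d: (basis d)
  show ?case using y
  proof (induction y rule: tl_hom_induct)
    case e: (basis e)
    show ?case using z
    proof (induction z rule: tl_hom_induct)
      case (basis f)
      then show ?case using ev0_arity[OF d, of 0] ev0_arity[OF e, of 0] ev0_arity[of f m'' n'' 0]
        by (simp add: ev_generators(1)[of _ 0] tl_tensor_ev mtens_assoc)
    qed auto
  qed auto
qed auto

lemma tl_tensor_id_0: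
  assumes x: "x \<in> tl_hom m n"
  shows "tl_id 0 \<otimes> x = x" "x \<otimes> tl_id 0 = x"
proof -
  show "tl_id 0 \<otimes> x = x"
    using x by (induction x rule: tl_hom_induct)
      (auto simp: ev_generators(1,2)[of _ 0] tl_tensor_ev ev0_arity)
  show "x \<otimes> tl_id 0 = x"
    using x by (induction x rule: tl_hom_induct)
      (auto simp: ev_generators(1,2)[of _ 0] tl_tensor_ev ev0_arity)
qed

lemma tl_tensor_id: "tl_id m \<otimes> tl_id n = tl_id (m + n)"
  by (simp add: ev_generators(2)[of _ 0] tl_tensor_ev mtens_mid)

lemma tl_interchange:
  assumes x: "x \<in> tl_hom m n" and y: "y \<in> tl_hom m' n'" and z: "z \<in> tl_hom n k" and w: "w \<in> tl_hom n' k'"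
  shows "(z \<otimes> w) \<circ>\<^bsub>A\<^esub> (x \<otimes> y) = (z \<circ>\<^bsub>A\<^esub> x) \<otimes> (w \<circ>\<^bsub>A\<^esub> y)"
  using x
proof (induction x rule: tl_hom_induct)
  case d: (basis d)
  show ?case using y
  proof (induction y rule: tl_hom_induct)
    case e: (basis e)
    show ?case using z
    proof (induction z rule: tl_hom_induct)
      case f: (basis f)
      show ?case using w
      proof (induction w rule: tl_hom_induct)
        case (basis g)
        then show ?case
          using ev0_arity[OF d, of 0] ev0_arity[OF e, of 0] ev0_arity[OF f, of 0] ev0_arity[of g n' k' 0]
          by (simp add: ev_generators(1)[of _ A] tl_tensor_ev tl_comp_ev interchange)
      qed auto
    qed auto
  qed auto
qed auto

lemma adj_comp:
  assumes x: "x \<in> tl_hom m n" and y: "y \<in> tl_hom n k"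
  shows "adj (y \<circ>\<^bsub>A\<^esub> x) = adj x \<circ>\<^bsub>A\<^esub> adj y"
  using x
proof (induction x rule: tl_hom_induct)
  case d: (basis d)
  show ?case using y
  proof (induction y rule: tl_hom_induct)
    case (basis e)
    then show ?case using ev0_arity[OF d, of 0] ev0_arity[of e n k 0]
      by (simp add: ev_generators(1)[of _ A] tl_comp_ev adj_ev mflip_mcomp)
  qed auto
qed auto

lemma adj_tensor:
  assumes x: "x \<in> tl_hom m n" and y: "y \<in> tl_hom m' n'"
  shows "adj (x \<otimes> y) = adj x \<otimes> adj y"
  using x
proof (induction x rule: tl_hom_induct)
  case d: (basis d)
  show ?case using y
  proof (induction y rule: tl_hom_induct)
    case (basis e)
    then show ?case using ev0_arity[OF d, of 0] ev0_arity[of e m' n' 0]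
      by (simp add: ev_generators(1)[of _ 0] tl_tensor_ev adj_ev mflip_mtens)
  qed auto
qed auto

lemma adj_adj: "x \<in> tl_hom m n \<Longrightarrow> adj (adj x) = x"
  by (induction x rule: tl_hom_induct) (auto simp: ev_generators(1)[of _ 0] adj_ev mflip_mflip ev0_arity)

lemma adj_generators [simp]: "adj (tl_id n) = tl_id n" "adj (tl_cap n) = tl_cup n" "adj (tl_cup n) = tl_cap n"
  by (simp_all add: ev_generators(2-)[of _ 0] adj_ev)

lemma tl_cap_add: "tl_cap (c + c') = tl_cap c \<circ>\<^bsub>A\<^esub> (tl_id c \<otimes> tl_cap c' \<otimes> tl_id c)"
  by (simp add: ev_generators(2-)[of _ A] tl_tensor_ev tl_comp_ev mcap_add [symmetric])

lemma tl_cup_slide: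
  "(tl_id (a + 2 + b) \<otimes> tl_id a \<otimes> tl_cap 1 \<otimes> tl_id b) \<circ>\<^bsub>A\<^esub> tl_cup (a + 2 + b) =
   ((tl_id b \<otimes> tl_cup 1 \<otimes> tl_id a) \<otimes> tl_id (a + b)) \<circ>\<^bsub>A\<^esub> tl_cup (a + b)"
  using mcup_slide[of a b] by (simp add: ev_generators(2-)[of _ A] tl_tensor_ev tl_comp_ev)

lemma tl_cup_slide':
  "((tl_id a \<otimes> tl_cap 1 \<otimes> tl_id b) \<otimes> tl_id (a + 2 + b)) \<circ>\<^bsub>A\<^esub> tl_cup (a + 2 + b) =
   (tl_id (a + b) \<otimes> tl_id b \<otimes> tl_cup 1 \<otimes> tl_id a) \<circ>\<^bsub>A\<^esub> tl_cup (a + b)"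
  using mcup_slide'[of a b] by (simp add: ev_generators(2-)[of _ A] tl_tensor_ev tl_comp_ev)

section \<open>The planar trace and the rotation\<close>

lemma tl_trace_cyclic:
  assumes x: "x \<in> tl_hom m n" and y: "y \<in> tl_hom n m"
  shows "tl_trace A m (y \<circ>\<^bsub>A\<^esub> x) = tl_trace A n (x \<circ>\<^bsub>A\<^esub> y)"
  using x
proof (induction x rule: tl_hom_induct)
  case d: (basis d)
  show ?case using y
  proof (induction y rule: tl_hom_induct)
    case (basis e)
    then show ?case
      using ev0_arity[OF d, of 0] ev0_arity[of e n m 0] mtrace_cyclic[of "(0, d)" "(0, e)" m n]
      by (simp add: ev_generators(1)[of _ A] tl_comp_ev tl_trace_ev)
  qed auto
qed auto

lemma tl_trace_adj:
  assumes x: "x \<in> tl_hom n n"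
  shows "tl_trace A n (adj x) = tl_trace A n x"
  using x
proof (induction x rule: tl_hom_induct)
  case (basis d)
  then show ?case using ev0_arity[of d n n 0]
    by (simp add: ev_generators(1)[of _ A] adj_ev tl_trace_ev mtrace_mflip)
qed auto

lemma tl_trace_partial:
  assumes x: "x \<in> tl_hom (n + k) (n + k)"
  shows "tl_trace A (n + k) x =
     tl_trace A n ((tl_id n \<otimes> tl_cap k) \<circ>\<^bsub>A\<^esub> (x \<otimes> tl_id k) \<circ>\<^bsub>A\<^esub> (tl_id n \<otimes> tl_cup k))"
  using x
proof (induction x rule: tl_hom_induct)
  case (basis d)
  then show ?case using ev0_arity[of d "n + k" "n + k" 0]
    by (simp add: ev_generators[of _ A] tl_tensor_ev tl_comp_ev tl_trace_ev mtrace_mtens_mid)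
qed auto

definition tl_rot :: "complex \<Rightarrow> nat \<Rightarrow> nat \<Rightarrow> nat \<Rightarrow> nat \<Rightarrow> tl \<Rightarrow> tl" where
  "tl_rot A i j k l x =
     (tl_id (k + l) \<otimes> tl_cap j) \<circ>\<^bsub>A\<^esub> (tl_id k \<otimes> x \<otimes> tl_id j) \<circ>\<^bsub>A\<^esub> (tl_cup k \<otimes> tl_id (i + j))"

definition tl_rot' :: "complex \<Rightarrow> nat \<Rightarrow> nat \<Rightarrow> nat \<Rightarrow> nat \<Rightarrow> tl \<Rightarrow> tl" where
  "tl_rot' A i j k l x =
     (tl_cap k \<otimes> tl_id (l + j)) \<circ>\<^bsub>A\<^esub> (tl_id k \<otimes> x \<otimes> tl_id j) \<circ>\<^bsub>A\<^esub> (tl_id (k + i) \<otimes> tl_cup j)"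

lemma tl_rot_ev:
  "mtops x = k + i \<Longrightarrow> mbots x = l + j \<Longrightarrow> tl_rot A i j k l (ev A x) = ev A (mrot i j k l x)"
  "mtops x = i + j \<Longrightarrow> mbots x = k + l \<Longrightarrow> tl_rot' A i j k l (ev A x) = ev A (mrot' i j k l x)"
  by (simp_all add: tl_rot_def tl_rot'_def mrot_def mrot'_def ev_generators(2-)[of _ A] tl_tensor_ev tl_comp_ev)

lemma tl_rot_linear [simp]:
  "tl_rot A i j k l (x + y) = tl_rot A i j k l x + tl_rot A i j k l y" "tl_rot A i j k l (scale c x) = scale c (tl_rot A i j k l x)"
  "tl_rot A i j k l 0 = 0" "tl_rot A i j k l (\<Sum>n\<in>I. f n) = (\<Sum>n\<in>I. tl_rot A i j k l (f n))"
  "tl_rot' A i j k l (x + y) = tl_rot' A i j k l x + tl_rot' A i j k l y" "tl_rot' A i j k l (scale c x) = scale c (tl_rot' A i j k l x)"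
  "tl_rot' A i j k l 0 = 0"
  by (simp_all add: tl_rot_def tl_rot'_def)

lemma tl_rot_rot':
  assumes "x \<in> tl_hom (i + j) (k + l)"
  shows "tl_rot A i j k l (tl_rot' A i j k l x) = x"
  using assms
proof (induction x rule: tl_hom_induct)
  case (basis d)
  then show ?case using ev0_arity[of d "i + j" "k + l" 0]
    by (simp add: ev_generators(1)[of _ A] tl_rot_ev mrot_mrot')
qed auto

text \<open>\<open>tl_rot'\<close> is the transpose of \<open>tl_rot\<close> for the trace form,
  while \<open>tl_rot_rot'\<close> makes it a right inverse. The two facts together express that
  rotation is an isometry.\<close>

lemma tl_trace_rot:
  assumes x: "x \<in> tl_hom (i + j) (k + l)" and y: "y \<in> tl_hom (k + i) (l + j)"
  shows "tl_trace A (i + j) (adj (tl_rot A i j k l y) \<circ>\<^bsub>A\<^esub> x) =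
      tl_trace A (k + i) (adj y \<circ>\<^bsub>A\<^esub> tl_rot' A i j k l x)"
  using x
proof (induction x rule: tl_hom_induct)
  case d: (basis d)
  show ?case using y
  proof (induction y rule: tl_hom_induct)
    case e: (basis e)
    note D = ev0_arity[OF d, of 0] and E = ev0_arity[OF e, of 0]
    have rot: "tl_rot A i j k l (ev A (0, e)) = ev A (mrot i j k l (0, e))"
        "tl_rot' A i j k l (ev A (0, d)) = ev A (mrot' i j k l (0, d))"
      by (rule tl_rot_ev; use D E in simp)+
    have comp: "ev A (mflip (mrot i j k l (0, e))) \<circ>\<^bsub>A\<^esub> ev A (0, d) = ev A (mcomp (mflip (mrot i j k l (0, e))) (0, d))"
        "ev A (mflip (0, e)) \<circ>\<^bsub>A\<^esub> ev A (mrot' i j k l (0, d)) = ev A (mcomp (mflip (0, e)) (mrot' i j k l (0, d)))"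
      by (rule tl_comp_ev; use D E in simp)+
    have trace: "tl_trace A (i + j) (ev A (mcomp (mflip (mrot i j k l (0, e))) (0, d))) =
          tl_value (ev A (mtrace (i + j) (mcomp (mflip (mrot i j k l (0, e))) (0, d))))"
        "tl_trace A (k + i) (ev A (mcomp (mflip (0, e)) (mrot' i j k l (0, d)))) =
          tl_value (ev A (mtrace (k + i) (mcomp (mflip (0, e)) (mrot' i j k l (0, d)))))"
      by (rule tl_trace_ev; use D E in simp)+
    have "mtrace (i + j) (mcomp (mflip (mrot i j k l (0, e))) (0, d)) =
        mtrace (k + i) (mcomp (mflip (0, e)) (mrot' i j k l (0, d)))"
      by (rule mtrace_mrot) (use D E in simp_all)
    then show ?case by (simp only: ev_generators(1)[of _ A] rot adj_ev comp trace)
  qed auto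
qed auto

section \<open>Composition across arbitrary shapes\<close>

declare One_nat_def [simp del]

text \<open>Combinations of crossingless diagrams of possibly different shapes. A composite of
  mismatched diagrams is 0, so associativity holds for these without conditions on sources and
  targets, and \<open>comp_assoc\<close> becomes a rewrite rule whose side conditions the simplifier
  can discharge.\<close>

definition tl_good :: "tl \<Rightarrow> bool" where
  "tl_good x \<longleftrightarrow> (\<forall>d\<in>Poly_Mapping.keys x. d \<in> diagrams (tops d) (bots d))"

lemma tl_good_hom: "x \<in> tl_hom m n \<Longrightarrow> tl_good x"
  unfolding tl_good_def tl_hom_def using diagramsD(1,2) by blast

lemma tl_good_induct [consumes 1, case_names zero add scale basis]:
  assumes "tl_good x" "P 0" "\<And>x y. P x \<Longrightarrow> P y \<Longrightarrow> P (x + y)" "\<And>c x. P x \<Longrightarrow> P (scale c x)"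
    "\<And>d m n. d \<in> diagrams m n \<Longrightarrow> P (basis d)"
  shows "P x"
  by (rule poly_mapping_lin_induct[of P]) (use assms in \<open>auto simp: tl_good_def\<close>)

lemma tl_good_linear [simp]:
  "tl_good 0" "tl_good x \<Longrightarrow> tl_good y \<Longrightarrow> tl_good (x + y)" "tl_good x \<Longrightarrow> tl_good (scale c x)"
  "tl_good x \<Longrightarrow> tl_good y \<Longrightarrow> tl_good (x - y)"
proof -
  show add: "tl_good (x + y)" if "tl_good x" "tl_good y" for x y
    using that Poly_Mapping.keys_add[of x y] unfolding tl_good_def by blast
  show sc: "tl_good (scale c x)" if "tl_good x" for c x
    using that keys_scale[of c x] unfolding tl_good_def by blast
  show "tl_good (x - y)" if "tl_good x" "tl_good y"
    unfolding minus_eq_scale using that add sc by blast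
qed (simp add: tl_good_def)

lemma basis_comp_mismatch: "bots d \<noteq> tops e \<Longrightarrow> basis e \<circ>\<^bsub>A\<^esub> basis d = 0"
  by (simp add: tl_comp_def bilinear_ext_single compose_basis_def)

lemma tl_good_comp [simp]:
  assumes x: "tl_good x" and y: "tl_good y"
  shows "tl_good (y \<circ>\<^bsub>A\<^esub> x)"
  using x
proof (induction x rule: tl_good_induct)
  case d: (basis d m n)
  show ?case using y
  proof (induction y rule: tl_good_induct)
    case e: (basis e n' k)
    show ?case
    proof (cases "n = n'")
      case True
      then show ?thesis using d e by (intro tl_good_hom tl_comp_in_hom tl_hom_linear) auto
    next
      case False
      then show ?thesis using diagramsD(2)[OF d] diagramsD(1)[OF e] by (simp add: basis_comp_mismatch)
    qed
  qed auto
qed auto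

lemma tl_good_tensor [simp]:
  assumes x: "tl_good x" and y: "tl_good y"
  shows "tl_good (x \<otimes> y)"
  using x
proof (induction x rule: tl_good_induct)
  case d: (basis d m n)
  show ?case using y
  proof (induction y rule: tl_good_induct)
    case e: (basis e n' k)
    then show ?case using d by (intro tl_good_hom tl_tensor_in_hom tl_hom_linear) auto
  qed auto
qed auto

lemma tl_good_generators [simp]: "tl_good (tl_id n)" "tl_good (tl_cap n)" "tl_good (tl_cup n)"
  using tl_good_hom tl_generators_in_hom by blast+

lemma comp_assoc:
  assumes x: "tl_good x" and y: "tl_good y" and z: "tl_good z"
  shows "(z \<circ>\<^bsub>A\<^esub> y) \<circ>\<^bsub>A\<^esub> x = z \<circ>\<^bsub>A\<^esub> y \<circ>\<^bsub>A\<^esub> x"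
  using x
proof (induction x rule: tl_good_induct)
  case d: (basis d m n)
  show ?case using y
  proof (induction y rule: tl_good_induct)
    case e: (basis e n' k)
    show ?case using z
    proof (induction z rule: tl_good_induct)
      case f: (basis f k' l)
      have 1: "basis e \<circ>\<^bsub>A\<^esub> basis d = (if n = n' then compose_basis A e d else 0)"
        "basis f \<circ>\<^bsub>A\<^esub> basis e = (if k = k' then compose_basis A f e else 0)"
        using diagramsD(1,2)[OF d] diagramsD(1,2)[OF e] diagramsD(1,2)[OF f]
        by (auto simp: basis_comp_mismatch) (simp_all add: tl_comp_def bilinear_ext_single)
      show ?case
      proof (cases "n = n' \<and> k = k'")
        case True
        then show ?thesis using d e f by (intro tl_assoc tl_hom_linear) auto
      next
        case False
        have "(basis f \<circ>\<^bsub>A\<^esub> basis e) \<circ>\<^bsub>A\<^esub> basis d = 0"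
        proof (cases "k = k'")
          case True
          then show ?thesis using 1 False diagramsD(1,2)[OF d] diagramsD(1)[OF e]
            by (simp add: compose_basis_def basis_comp_mismatch del: scale_simps(5))
        qed (simp add: 1)
        moreover have "basis f \<circ>\<^bsub>A\<^esub> basis e \<circ>\<^bsub>A\<^esub> basis d = 0"
        proof (cases "n = n'")
          case True
          then show ?thesis using 1 False diagramsD(1)[OF f] diagramsD(2)[OF e]
            by (simp add: compose_basis_def basis_comp_mismatch del: scale_simps(5))
        qed (simp add: 1)
        ultimately show ?thesis by simp
      qed
    qed auto
  qed auto
qed auto

lemma tl_hom_cast: "x \<in> tl_hom m n \<Longrightarrow> m = m' \<Longrightarrow> n = n' \<Longrightarrow> x \<in> tl_hom m' n'"
  by simp

lemma tl_comp_typ: "x \<in> tl_hom m n \<Longrightarrow> y \<in> tl_hom n' k \<Longrightarrow> n = n' \<Longrightarrow> y \<circ>\<^bsub>A\<^esub> x \<in> tl_hom m k"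
  by auto

lemmas tl_typ = tl_comp_typ tl_tensor_in_hom tl_generators_in_hom tl_hom_linear(3)

lemma comp_id:
  "x \<in> tl_hom m n \<Longrightarrow> n = k \<Longrightarrow> tl_id k \<circ>\<^bsub>A\<^esub> x = x" "x \<in> tl_hom m n \<Longrightarrow> m = k \<Longrightarrow> x \<circ>\<^bsub>A\<^esub> tl_id k = x"
  using tl_id_comp by auto

lemma tl_ic:
  assumes "x \<in> tl_hom m n" "y \<in> tl_hom m' n'" "z \<in> tl_hom p k" "w \<in> tl_hom p' k'" "n = p" "n' = p'"
  shows "(z \<otimes> w) \<circ>\<^bsub>A\<^esub> (x \<otimes> y) = (z \<circ>\<^bsub>A\<^esub> x) \<otimes> (w \<circ>\<^bsub>A\<^esub> y)"
  using tl_interchange assms by blast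

lemma tensor_assoc:
  assumes "tl_good x" "tl_good y" "tl_good z"
  shows "(x \<otimes> y) \<otimes> z = x \<otimes> y \<otimes> z"
  using assms(1)
proof (induction x rule: tl_good_induct)
  case d: (basis d)
  show ?case using assms(2)
  proof (induction y rule: tl_good_induct)
    case e: (basis e)
    show ?case using assms(3)
    proof (induction z rule: tl_good_induct)
      case f: (basis f)
      show ?case by (rule tl_tensor_assoc) (use d e f in auto)
    qed auto
  qed auto
qed auto

section \<open>Turn-backs\<close>

definition tcap :: "nat \<Rightarrow> nat \<Rightarrow> tl" where "tcap a b = tl_id a \<otimes> tl_cap 1 \<otimes> tl_id b"
definition tcup :: "nat \<Rightarrow> nat \<Rightarrow> tl" where "tcup a b = tl_id a \<otimes> tl_cup 1 \<otimes> tl_id b"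

lemma tcap_in_hom [simp, intro]: "tcap a b \<in> tl_hom (a + (2 + b)) (a + b)" "tcup a b \<in> tl_hom (a + b) (a + (2 + b))"
  unfolding tcap_def tcup_def by (rule tl_hom_cast, (rule tl_typ | simp)+)+

lemma tcap_ev: "tcap a b = ev A (capE a b)" "tcup a b = ev A (cupE a b)"
  by (simp_all add: tcap_def tcup_def capE_def cupE_def ev_generators(2-)[of _ A] tl_tensor_ev)

lemma adj_tcap [simp]: "adj (tcap a b) = tcup a b" "adj (tcup a b) = tcap a b"
  by (simp_all add: tcap_ev[of _ _ 0] adj_ev)

lemma turn_back_eq: "s + 2 \<le> n \<Longrightarrow> turn_back_top n s = tcap s (n - 2 - s)" "turn_back_bot n s = tcup s (n - 2 - s)"
  by (simp_all add: turn_back_top_def turn_back_bot_def tcap_def tcup_def)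

lemma tcap_tensor: "tcap a b \<otimes> tl_id c = tcap a (b + c)" "tl_id c \<otimes> tcap a b = tcap (c + a) b"
  "tcup a b \<otimes> tl_id c = tcup a (b + c)" "tl_id c \<otimes> tcup a b = tcup (c + a) b"
  by (simp_all add: tcap_ev[of _ _ 0] ev_generators(2)[of _ 0] tl_tensor_ev capE_tens)

text \<open>The linear form of peeling: a diagram is an identity or factors through a turn-back, so
  whatever annihilates turn-backs sees identities only.\<close>

lemma basis_cases:
  assumes "d \<in> diagrams m n"
  obtains (id) "m = n" "d = id_diagram n"
  | (bottom) a b y where "m \<noteq> n \<or> d \<noteq> id_diagram n" "n = a + (2 + b)" "y \<in> tl_hom m (a + b)" "basis d = tcup a b \<circ>\<^bsub>A\<^esub> y"
  | (top) a b y where "m = a + (2 + b)" "y \<in> tl_hom (a + b) n" "basis d = y \<circ>\<^bsub>A\<^esub> tcap a b"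
proof -
  have d: "snd (0 :: nat, d) \<in> diagrams m n" using assms by simp
  consider "m = n" "d = id_diagram n"
    | t where "m \<noteq> n \<or> d \<noteq> id_diagram n" "Suc t < n" "((1, t), (1, Suc t)) \<in> arcs (snd (0 :: nat, d))"
    | t where "Suc t < m" "((0, t), (0, Suc t)) \<in> arcs (snd (0 :: nat, d))"
    using diagram_cases[OF assms] by (metis snd_conv)
  then show ?thesis
  proof cases
    case 1
    then show ?thesis by (rule id)
  next
    case (2 t)
    obtain y b where y: "snd y \<in> diagrams m (t + b)" "(0, d) = mcomp (cupE t b) y" "n = t + (2 + b)" "fst y = fst (0 :: nat, d)"
      using bottom_arc_cup[OF d 2(3,2)] by metis
    have "basis d = ev A (0, d)" by (rule ev_generators)
    also have "\<dots> = tcup t b \<circ>\<^bsub>A\<^esub> ev A y"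
      unfolding y(2) tcap_ev[of _ _ A] by (rule tl_comp_ev [symmetric]) (use mdgD[OF y(1)] in simp)
    finally have "basis d = tcup t b \<circ>\<^bsub>A\<^esub> ev A y" .
    moreover have "ev A y \<in> tl_hom m (t + b)" using y(1) by (auto simp: ev_def)
    ultimately show ?thesis using bottom y(3) 2(1) by blast
  next
    case (3 t)
    obtain y b where y: "snd y \<in> diagrams (t + b) n" "(0, d) = mcomp y (capE t b)" "m = t + (2 + b)" "fst y = fst (0 :: nat, d)"
      using top_arc_cap[OF d 3(2,1)] by metis
    have "basis d = ev A (0, d)" by (rule ev_generators)
    also have "\<dots> = ev A y \<circ>\<^bsub>A\<^esub> tcap t b"
      unfolding y(2) tcap_ev[of _ _ A] by (rule tl_comp_ev [symmetric]) (use mdgD[OF y(1)] in simp)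
    finally have "basis d = ev A y \<circ>\<^bsub>A\<^esub> tcap t b" .
    moreover have "ev A y \<in> tl_hom (t + b) n" using y(1) by (auto simp: ev_def)
    ultimately show ?thesis using top y(3) by blast
  qed
qed

lemma endo_basis_cases:
  assumes "d \<in> diagrams n n"
  obtains (id) "d = id_diagram n"
  | (top) a b y where "d \<noteq> id_diagram n" "n = a + (2 + b)" "y \<in> tl_hom (a + b) n" "basis d = y \<circ>\<^bsub>A\<^esub> tcap a b"
proof (cases "d = id_diagram n")
  case True
  then show ?thesis by (rule id)
next
  case False
  have d: "snd (0 :: nat, d) \<in> diagrams n n" using assms by simp
  obtain t where t: "Suc t < n" "((0, t), (0, Suc t)) \<in> arcs (snd (0 :: nat, d))"
    using nonidentity_arcs[OF assms False] by auto
  obtain y b where y: "snd y \<in> diagrams (t + b) n" "(0, d) = mcomp y (capE t b)" "n = t + (2 + b)" "fst y = fst (0 :: nat, d)"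
    using top_arc_cap[OF d t(2,1)] by metis
  have "basis d = ev A (0, d)" by (rule ev_generators)
  also have "\<dots> = ev A y \<circ>\<^bsub>A\<^esub> tcap t b"
    unfolding y(2) tcap_ev[of _ _ A] by (rule tl_comp_ev [symmetric]) (use mdgD[OF y(1)] in simp)
  finally have "basis d = ev A y \<circ>\<^bsub>A\<^esub> tcap t b" .
  moreover have "ev A y \<in> tl_hom (t + b) n" using y(1) by (auto simp: ev_def)
  ultimately show ?thesis using top y(3) False by blast
qed

definition linear_map :: "(tl \<Rightarrow> tl) \<Rightarrow> bool" where
  "linear_map L \<longleftrightarrow> (\<forall>x y. L (x + y) = L x + L y) \<and> (\<forall>c x. L (scale c x) = scale c (L x))"

lemma linear_map_0: "linear_map L \<Longrightarrow> L 0 = 0"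
  unfolding linear_map_def by (metis scale_simps(1))

text \<open>Every diagram other than an identity starts with a cap or ends with a cup.\<close>

lemma linear_map_through:
  assumes x: "x \<in> tl_hom m n" and L: "linear_map L"
    and cap: "\<And>a b y. m = a + (2 + b) \<Longrightarrow> y \<in> tl_hom (a + b) n \<Longrightarrow> L (y \<circ>\<^bsub>A\<^esub> tcap a b) = 0"
    and cup: "\<And>a b y. n = a + (2 + b) \<Longrightarrow> y \<in> tl_hom m (a + b) \<Longrightarrow> m \<noteq> n \<Longrightarrow> L (tcup a b \<circ>\<^bsub>A\<^esub> y) = 0"
  shows "L x = (if m = n then scale (Poly_Mapping.lookup x (id_diagram n)) (L (tl_id n)) else 0)"
  using x
proof (induction x rule: tl_hom_induct)
  case zero
  then show ?case using linear_map_0[OF L] by simp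
next
  case (add x y)
  then show ?case using L by (simp add: linear_map_def lookup_add scale_linear)
next
  case (scale c x)
  then show ?case using L by (simp add: linear_map_def)
next
  case (basis d)
  show ?case
  proof (cases "m = n")
    case True
    then have "d \<in> diagrams n n" using basis by simp
    then show ?thesis
    proof (cases rule: endo_basis_cases[where A = A])
      case id
      then show ?thesis using True by (simp add: tl_id_def)
    next
      case (top a b y)
      then have "L (basis d) = 0" using cap True by metis
      then show ?thesis using top(1) by (simp add: lookup_single when_def)
    qed
  next
    case False
    have "L (basis d) = 0"
      using basis by (cases rule: basis_cases[where A = A]) (use False cap cup in auto)
    then show ?thesis using False by simp
  qed
qed

lemma linear_map_comp [simp]:
  "linear_map (\<lambda>x. x)"
  "linear_map L \<Longrightarrow> linear_map (\<lambda>x. y \<circ>\<^bsub>A\<^esub> L x)" "linear_map L \<Longrightarrow> linear_map (\<lambda>x. L x \<circ>\<^bsub>A\<^esub> y)"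
  "linear_map L \<Longrightarrow> linear_map (\<lambda>x. y \<otimes> L x)" "linear_map L \<Longrightarrow> linear_map (\<lambda>x. L x \<otimes> y)"
  by (simp_all add: linear_map_def)

section \<open>Jones--Wenzl idempotents\<close>

lemma Delta_0 [simp]: "Delta A 0 = 1"
  by (simp add: Delta_def)

lemma Delta_1: "Delta A (Suc 0) = loop A"
  by (simp add: Delta_def loop_def power_int_minus power2_eq_square power_inverse)

text \<open>A Chebyshev recursion. Multiplying \<open>S (Suc n)\<close> by \<open>A ^ 2\<close>
  gives all terms of \<open>S (Suc (Suc n))\<close> but the last; multiplying it by
  \<open>inverse A ^ 2\<close> gives \<open>S n\<close> and that same term. The signs in
  \<open>Delta\<close> turn the resulting factor into \<open>loop A\<close>.\<close>

lemma Delta_Suc_Suc: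
  assumes "A \<noteq> 0"
  shows "Delta A (Suc (Suc n)) = loop A * Delta A (Suc n) - Delta A n"
proof -
  define S where "S n = (\<Sum>s = 0..n. A powi (2 * int n - 4 * int s))" for n
  have p: "A powi 2 = A ^ 2" "A powi (-2) = inverse A ^ 2"
    using assms by (simp_all add: power_int_def power_inverse)
  have last: "2 * int (Suc (Suc n)) - 4 * int (Suc (Suc n)) = - 2 * int n - 4" "2 * int n - 4 * int (Suc n) = - 2 * int n - 4"
    by simp_all
  have "A ^ 2 * S (Suc n) = (\<Sum>s = 0..Suc n. A powi (2 * int (Suc (Suc n)) - 4 * int s))"
    unfolding S_def sum_distrib_left p(1)[symmetric]
    by (intro sum.cong refl, subst power_int_add [symmetric]) (use assms in \<open>simp_all add: algebra_simps\<close>)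
  then have 1: "S (Suc (Suc n)) = A ^ 2 * S (Suc n) + A powi (- 2 * int n - 4)"
    unfolding S_def[of "Suc (Suc n)"] sum.atLeast0_atMost_Suc[of _ "Suc n"] last by simp
  have "inverse A ^ 2 * S (Suc n) = (\<Sum>s = 0..Suc n. A powi (2 * int n - 4 * int s))"
    unfolding S_def sum_distrib_left p(2)[symmetric]
    by (intro sum.cong refl, subst power_int_add [symmetric]) (use assms in \<open>simp_all add: algebra_simps\<close>)
  then have "inverse A ^ 2 * S (Suc n) = S n + A powi (- 2 * int n - 4)"
    unfolding S_def[of n] sum.atLeast0_atMost_Suc last .
  then have S2: "S (Suc (Suc n)) = (A ^ 2 + inverse A ^ 2) * S (Suc n) - S n"
    using 1 by (simp add: algebra_simps)
  have D: "Delta A n = (- 1) ^ n * S n" for n by (simp add: Delta_def S_def)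
  show ?thesis unfolding D S2 by (simp add: loop_def algebra_simps)
qed

text \<open>Wenzl's recursion, an explicit candidate for the definite description
  \<open>jones_wenzl\<close>. The hook made of \<open>tcap n 0\<close> and \<open>tcup n 0\<close>
  acts on the last two strands. With the signed \<open>Delta\<close> its coefficient is subtracted:
  for two strands the result is the identity minus the hook divided by the loop value.\<close>

fun jw :: "complex \<Rightarrow> nat \<Rightarrow> tl" where
  "jw A 0 = tl_id 0"
| "jw A (Suc 0) = tl_id (Suc 0)"
| "jw A (Suc (Suc n)) = jw A (Suc n) \<otimes> tl_id 1 - scale (Delta A n / Delta A (Suc n))
     ((jw A (Suc n) \<otimes> tl_id 1) \<circ>\<^bsub>A\<^esub> tcup n 0 \<circ>\<^bsub>A\<^esub> tcap n 0 \<circ>\<^bsub>A\<^esub> (jw A (Suc n) \<otimes> tl_id 1))"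

declare jw.simps(3) [simp del]

lemma jw_in_hom [simp, intro]: "jw A n \<in> tl_hom n n"
proof (induction A n rule: jw.induct)
  case (3 A n)
  then have 1: "jw A (Suc n) \<otimes> tl_id 1 \<in> tl_hom (Suc (Suc n)) (Suc (Suc n))"
    by - (rule tl_hom_cast, rule tl_tensor_in_hom[OF _ tl_generators_in_hom(1)], assumption, simp_all)
  have 2: "tcup n 0 \<in> tl_hom n (Suc (Suc n))" "tcap n 0 \<in> tl_hom (Suc (Suc n)) n"
    using tcap_in_hom[of n 0] by simp_all
  show ?case unfolding jw.simps by (intro tl_hom_linear tl_comp_in_hom[OF _ 1] tl_comp_in_hom[OF _ 2(1)] tl_comp_in_hom[OF 1] 1 2)
qed auto

lemma jw_good [simp]: "tl_good (jw A n)" by (rule tl_good_hom) auto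
lemma tcap_good [simp]: "tl_good (tcap a b)" "tl_good (tcup a b)" using tl_good_hom tcap_in_hom by blast+

lemma adj_jw [simp]: "adj (jw A n) = jw A n"
proof (induction A n rule: jw.induct)
  case (3 A n)
  let ?q = "jw A (Suc n) \<otimes> tl_id 1"
  have 1: "?q \<in> tl_hom (Suc (Suc n)) (Suc (Suc n))"
    by (rule tl_hom_cast, (rule tl_typ jw_in_hom | simp)+)
  have 2: "tcup n 0 \<in> tl_hom n (Suc (Suc n))" "tcap n 0 \<in> tl_hom (Suc (Suc n)) n"
    using tcap_in_hom[of n 0] by simp_all
  have q: "adj ?q = ?q" using 3 adj_tensor[OF jw_in_hom tl_generators_in_hom(1)] by simp
  note cq = tl_comp_in_hom[OF 1 2(2), of A]
  note ucq = tl_comp_in_hom[OF cq 2(1), of A]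
  have "adj (?q \<circ>\<^bsub>A\<^esub> tcup n 0 \<circ>\<^bsub>A\<^esub> tcap n 0 \<circ>\<^bsub>A\<^esub> ?q) = ((?q \<circ>\<^bsub>A\<^esub> tcup n 0) \<circ>\<^bsub>A\<^esub> tcap n 0) \<circ>\<^bsub>A\<^esub> ?q"
    unfolding adj_comp[OF ucq 1] adj_comp[OF cq 2(1)] adj_comp[OF 1 2(2)] q by simp
  then show ?case unfolding jw.simps(3) adj_linear q by (simp add: comp_assoc)
qed simp_all

definition top_killed :: "complex \<Rightarrow> nat \<Rightarrow> tl \<Rightarrow> bool" where
  "top_killed A n x \<longleftrightarrow> (\<forall>a b. a + (2 + b) = n \<longrightarrow> x \<circ>\<^bsub>A\<^esub> tcup a b = 0)"

definition bot_killed :: "complex \<Rightarrow> nat \<Rightarrow> tl \<Rightarrow> bool" where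
  "bot_killed A n x \<longleftrightarrow> (\<forall>a b. a + (2 + b) = n \<longrightarrow> tcap a b \<circ>\<^bsub>A\<^esub> x = 0)"

lemma tcap_tcup_snake:
  "tcap (Suc n) 0 \<circ>\<^bsub>A\<^esub> tcup n 1 = tl_id (Suc n)" "tcap n 1 \<circ>\<^bsub>A\<^esub> tcup (Suc n) 0 = tl_id (Suc n)"
  using capE_cupE_near(1,2)[of n 0] by (simp_all add: tcap_ev[of _ _ A] tl_comp_ev ev_generators(2)[of _ A] One_nat_def)

lemma tcap_tcup_loop: "tcap a b \<circ>\<^bsub>A\<^esub> tcup a b = scale (loop A) (tl_id (a + b))"
  using capE_cupE_near(3)[of a b] by (simp add: tcap_ev[of _ _ A] tl_comp_ev) (simp add: ev_def tl_id_def)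

lemma tl_value_id_0: "tl_value (tl_id 0) = 1"
  by (simp add: tl_value_def tl_id_def id_diagram_def)

lemma tl_trace_0:
  assumes "x \<in> tl_hom 0 0"
  shows "tl_trace A 0 x = tl_value x"
proof -
  have "tl_cap 0 = tl_id 0" "tl_cup 0 = tl_id 0"
    by (simp_all add: tl_cap_def tl_cup_def tl_id_def cap_diagram_def cup_diagram_def id_diagram_def)
  then show ?thesis unfolding tl_trace_def using comp_id[OF assms] tl_tensor_id_0[OF assms] by simp
qed

locale generic_parameter =
  fixes A :: complex
  assumes A_nonzero: "A \<noteq> 0" and Delta_nonzero: "Delta A n \<noteq> 0"
begin

abbreviation comp (infixr "\<cdot>" 55) where "y \<cdot> x \<equiv> y \<circ>\<^bsub>A\<^esub> x"

text \<open>Wenzl's recursion: the third property is the partial trace, which makes the next step work.\<close>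

lemma jw_properties:
  "jw A (Suc n) \<cdot> jw A (Suc n) = jw A (Suc n) \<and> top_killed A (Suc n) (jw A (Suc n)) \<and>
    tcap n 0 \<cdot> (jw A (Suc n) \<otimes> tl_id 1) \<cdot> tcup n 0 = scale (Delta A (Suc n) / Delta A n) (jw A n) \<and>
    jw A (Suc n) \<cdot> (jw A n \<otimes> tl_id 1) = jw A (Suc n)"
proof (induction n)
  case 0
  have "tcap 0 0 \<cdot> tl_id 2 \<cdot> tcup 0 0 = scale (Delta A (Suc 0)) (tl_id 0)"
    by (subst comp_id(1)[OF tcap_in_hom(2)]) (simp_all add: tcap_tcup_loop Delta_1)
  then show ?case using comp_id[OF tl_generators_in_hom(1)[of 1], of 1 A]
    by (simp add: top_killed_def tl_tensor_id numeral_2_eq_2 One_nat_def)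
next
  case (Suc n)
  let ?f = "jw A n" and ?g = "jw A (Suc n)" and ?p = "jw A (Suc (Suc n))"
  \<comment> \<open>\<open>s\<close> is inverse to the scalar of the partial trace in the induction
    hypothesis, which is why \<open>c \<cdot> q \<cdot> u\<close> is \<open>inverse s\<close> times
    \<open>?f\<close>.\<close>
  define q u c s where "q = ?g \<otimes> tl_id 1" and "u = tcup n 0" and "c = tcap n 0" and "s = Delta A n / Delta A (Suc n)"
  have IH: "?g \<cdot> ?g = ?g" "top_killed A (Suc n) ?g" "c \<cdot> q \<cdot> u = scale (inverse s) ?f"
      "?g \<cdot> (?f \<otimes> tl_id 1) = ?g"
    using Suc by (simp_all add: q_def u_def c_def s_def)
  have s0: "s \<noteq> 0" using Delta_nonzero by (simp add: s_def)
  have p: "?p = q - scale s (q \<cdot> u \<cdot> c \<cdot> q)" by (simp add: jw.simps(3) q_def u_def c_def s_def)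
  have qh: "q \<in> tl_hom (Suc (Suc n)) (Suc (Suc n))"
    unfolding q_def by (rule tl_hom_cast, (rule tl_typ jw_in_hom | simp)+)
  have uh: "u \<in> tl_hom n (Suc (Suc n))" and ch: "c \<in> tl_hom (Suc (Suc n)) n"
    using tcap_in_hom[of n 0] by (simp_all add: u_def c_def)
  have good [simp]: "tl_good q" "tl_good u" "tl_good c" using tl_good_hom qh uh ch by blast+
  have qq: "q \<cdot> q = q"
    unfolding q_def using tl_ic[OF jw_in_hom tl_generators_in_hom(1) jw_in_hom tl_generators_in_hom(1) refl refl]
      IH(1) comp_id[OF tl_generators_in_hom(1)[of 1]] by simp
  have ufu: "u \<cdot> ?f = (?f \<otimes> tl_id 2) \<cdot> u"
  proof -
    have "(tl_id n \<otimes> tl_cup 1) \<cdot> (?f \<otimes> tl_id 0) = ?f \<otimes> tl_cup 1"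
      by (subst tl_ic[OF jw_in_hom tl_generators_in_hom(1) tl_generators_in_hom(1) tl_generators_in_hom(3)])
        (auto simp: comp_id[OF jw_in_hom] comp_id[OF tl_generators_in_hom(3)])
    moreover have "(?f \<otimes> tl_id 2) \<cdot> (tl_id n \<otimes> tl_cup 1) = ?f \<otimes> tl_cup 1"
      by (subst tl_ic[OF tl_generators_in_hom(1) tl_generators_in_hom(3) jw_in_hom tl_generators_in_hom(1)])
        (auto simp: comp_id[OF jw_in_hom] comp_id[OF tl_generators_in_hom(3)])
    ultimately show ?thesis
      using tl_tensor_id_0[OF jw_in_hom] tl_tensor_id_0[OF tl_generators_in_hom(3)] by (simp add: u_def tcup_def)
  qed
  have qf: "q \<cdot> (?f \<otimes> tl_id 2) = q"
  proof -
    have "?f \<otimes> tl_id 2 = (?f \<otimes> tl_id 1) \<otimes> tl_id 1" by (simp add: tensor_assoc tl_tensor_id numeral_2_eq_2)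
    moreover have "q \<cdot> ((?f \<otimes> tl_id 1) \<otimes> tl_id 1) = (?g \<cdot> (?f \<otimes> tl_id 1)) \<otimes> (tl_id 1 \<cdot> tl_id 1)"
      unfolding q_def by (rule tl_ic, (rule tl_typ jw_in_hom | simp)+)
    ultimately show ?thesis using IH(4) comp_id[OF tl_generators_in_hom(1)[of 1]] by (simp add: q_def)
  qed
  have quf: "q \<cdot> u \<cdot> ?f = q \<cdot> u"
    unfolding ufu by (simp add: comp_assoc [symmetric] qf)
  have quf': "q \<cdot> u \<cdot> ?f \<cdot> x = q \<cdot> u \<cdot> x" if "tl_good x" for x
    using quf that by (metis comp_assoc good jw_good tl_good_comp)
  have qq': "q \<cdot> q \<cdot> x = q \<cdot> x" if "tl_good x" for x
    using qq that by (metis comp_assoc good)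
  have cqu: "c \<cdot> q \<cdot> u \<cdot> x = scale (inverse s) (?f \<cdot> x)" if "tl_good x" for x
  proof -
    have "c \<cdot> q \<cdot> u \<cdot> x = (c \<cdot> q \<cdot> u) \<cdot> x" using that by (simp add: comp_assoc)
    then show ?thesis by (simp add: IH(3))
  qed
  have pq: "?p \<cdot> q = ?p" by (simp add: p comp_assoc qq)
  \<comment> \<open>The correction term is built so that \<open>?p\<close> annihilates
    \<open>q \<cdot> u\<close>: the factors \<open>s\<close> and \<open>inverse s\<close> cancel.
    Expanding the right factor of \<open>?p \<cdot> ?p\<close> by the recursion therefore leaves
    only \<open>?p \<cdot> q\<close>.\<close>
  have pp: "?p \<cdot> ?p = ?p"
  proof -
    have "?p \<cdot> q \<cdot> u = 0"
      using s0 by (simp add: p comp_assoc qq' cqu IH(3) quf qq)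
    then have "?p \<cdot> q \<cdot> u \<cdot> c \<cdot> q = 0"
      by (metis comp_assoc good jw_good tl_good_comp tl_comp_linear(9))
    then show ?thesis using pq by (subst (2) p) simp
  qed
  \<comment> \<open>The turn-back on the last two strands is killed by the same cancellation of
    \<open>s\<close>; all others already die on the factor \<open>?g\<close> inside
    \<open>q\<close>.\<close>
  have kill: "?p \<cdot> tcup a b = 0" if ab: "a + (2 + b) = Suc (Suc n)" for a b
  proof (cases b)
    case 0
    then have "a = n" using ab by simp
    then show ?thesis using 0 s0 by (simp add: u_def [symmetric]) (simp add: p comp_assoc IH(3) quf)
  next
    case (Suc b')
    then have "?g \<cdot> tcup a b' = 0" using IH(2) ab unfolding top_killed_def by simp
    moreover have "q \<cdot> (tcup a b' \<otimes> tl_id 1) = (?g \<cdot> tcup a b') \<otimes> (tl_id 1 \<cdot> tl_id 1)"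
      unfolding q_def by (rule tl_ic, (rule tl_typ jw_in_hom tcap_in_hom)+) (use ab Suc in simp_all)
    ultimately have "q \<cdot> tcup a b = 0" using Suc by (simp add: tcap_tensor One_nat_def)
    then show ?thesis by (simp add: p comp_assoc)
  qed
  \<comment> \<open>Closing the last strand makes a loop in the main term, and in the correction two
    snakes straighten the hook. This leaves \<open>loop A - s\<close> times \<open>?g\<close>, which
    the recursion for \<open>Delta\<close> turns into the next ratio.\<close>
  have ptr: "tcap (Suc n) 0 \<cdot> (?p \<otimes> tl_id 1) \<cdot> tcup (Suc n) 0 = scale (Delta A (Suc (Suc n)) / Delta A (Suc n)) ?g"
  proof -
    let ?c = "tcap (Suc n) 0" and ?u = "tcup (Suc n) 0"
    have ch': "?c \<in> tl_hom (Suc (Suc (Suc n))) (Suc n)" and uh': "?u \<in> tl_hom (Suc n) (Suc (Suc (Suc n)))"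
      using tcap_in_hom[of "Suc n" 0] by simp_all
    have q1: "q \<otimes> tl_id 1 = ?g \<otimes> tl_id 2" by (simp add: q_def tensor_assoc tl_tensor_id numeral_2_eq_2)
    have cg: "?c \<cdot> (q \<otimes> tl_id 1) = ?g \<cdot> ?c"
    proof -
      have "(tl_id (Suc n) \<otimes> tl_cap 1) \<cdot> (?g \<otimes> tl_id 2) = ?g \<otimes> tl_cap 1"
        by (subst tl_ic[OF jw_in_hom tl_generators_in_hom(1) tl_generators_in_hom(1) tl_generators_in_hom(2)])
          (auto simp: comp_id[OF jw_in_hom] comp_id[OF tl_generators_in_hom(2)])
      moreover have "(?g \<otimes> tl_id 0) \<cdot> (tl_id (Suc n) \<otimes> tl_cap 1) = ?g \<otimes> tl_cap 1"
        by (subst tl_ic[OF tl_generators_in_hom(1) tl_generators_in_hom(2) jw_in_hom tl_generators_in_hom(1)])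
          (auto simp: comp_id[OF jw_in_hom] comp_id[OF tl_generators_in_hom(2)])
      ultimately show ?thesis unfolding q1
        using tl_tensor_id_0[OF jw_in_hom] tl_tensor_id_0[OF tl_generators_in_hom(2)] by (simp add: tcap_def)
    qed
    have gu: "(q \<otimes> tl_id 1) \<cdot> ?u = ?u \<cdot> ?g"
    proof -
      have qh1: "q \<otimes> tl_id 1 \<in> tl_hom (Suc (Suc (Suc n))) (Suc (Suc (Suc n)))"
        by (rule tl_hom_cast, (rule tl_typ qh | simp)+)
      have "adj q = q" unfolding q_def using adj_tensor[OF jw_in_hom tl_generators_in_hom(1)] by simp
      then have aq: "adj (q \<otimes> tl_id 1) = q \<otimes> tl_id 1" using adj_tensor[OF qh tl_generators_in_hom(1)] by simp
      show ?thesis using arg_cong[OF cg, of adj] adj_comp[OF qh1 ch'] adj_comp[OF ch' jw_in_hom[of A "Suc n"]] aq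
        by simp
    qed
    have e1: "?c \<cdot> (q \<otimes> tl_id 1) \<cdot> ?u = scale (loop A) ?g"
    proof -
      have "?c \<cdot> (q \<otimes> tl_id 1) \<cdot> ?u = ?g \<cdot> ?c \<cdot> ?u"
        using cg by (simp add: comp_assoc [symmetric])
      then show ?thesis using comp_id(2)[OF jw_in_hom] by (simp add: tcap_tcup_loop)
    qed
    have x1: "(x \<cdot> y) \<otimes> tl_id 1 = (x \<otimes> tl_id 1) \<cdot> (y \<otimes> tl_id 1)" if "y \<in> tl_hom k l" "x \<in> tl_hom l m" for x y k l m
      using tl_ic[OF that(1) tl_generators_in_hom(1)[of 1] that(2) tl_generators_in_hom(1)[of 1] refl refl]
        comp_id[OF tl_generators_in_hom(1)[of 1]] by simp
    have "(q \<cdot> u \<cdot> c \<cdot> q) \<otimes> tl_id 1 = (q \<otimes> tl_id 1) \<cdot> (u \<otimes> tl_id 1) \<cdot> (c \<otimes> tl_id 1) \<cdot> (q \<otimes> tl_id 1)"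
      using x1[OF qh ch] x1[OF tl_comp_in_hom[OF qh ch] uh] x1[OF tl_comp_in_hom[OF tl_comp_in_hom[OF qh ch] uh] qh] by simp
    moreover have "u \<otimes> tl_id 1 = tcup n 1" "c \<otimes> tl_id 1 = tcap n 1" by (simp_all add: u_def c_def tcap_tensor)
    ultimately have "?c \<cdot> ((q \<cdot> u \<cdot> c \<cdot> q) \<otimes> tl_id 1) \<cdot> ?u =
        (?c \<cdot> (q \<otimes> tl_id 1)) \<cdot> tcup n 1 \<cdot> tcap n 1 \<cdot> (q \<otimes> tl_id 1) \<cdot> ?u"
      by (simp add: comp_assoc)
    also have "\<dots> = ?g \<cdot> (?c \<cdot> tcup n 1) \<cdot> (tcap n 1 \<cdot> ?u) \<cdot> ?g"
      unfolding cg gu by (simp add: comp_assoc)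
    also have "\<dots> = ?g"
      unfolding tcap_tcup_snake using comp_id(1)[OF jw_in_hom] IH(1) by simp
    finally have e2: "?c \<cdot> ((q \<cdot> u \<cdot> c \<cdot> q) \<otimes> tl_id 1) \<cdot> ?u = ?g" .
    have "?c \<cdot> (?p \<otimes> tl_id 1) \<cdot> ?u = scale (loop A) ?g - scale s ?g"
      unfolding p by (simp add: e1 e2)
    also have "\<dots> = scale (Delta A (Suc (Suc n)) / Delta A (Suc n)) ?g"
      unfolding scale_linear(4)[symmetric] Delta_Suc_Suc[OF A_nonzero] using Delta_nonzero[of "Suc n"] by (simp add: s_def diff_divide_distrib)
    finally show ?thesis .
  qed
  show ?case using pp kill ptr pq unfolding top_killed_def q_def by blast
qed

lemma jw_idem: "jw A n \<cdot> jw A n = jw A n"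
proof (cases n)
  case 0
  then show ?thesis using comp_id[OF tl_generators_in_hom(1)] by simp
next
  case (Suc k)
  then show ?thesis using jw_properties by blast
qed

lemma jw_tcup: "a + (2 + b) = n \<Longrightarrow> jw A n \<cdot> tcup a b = 0"
  using jw_properties[of "n - 1"] unfolding top_killed_def by (cases n) auto

lemma jw_tcap: "a + (2 + b) = n \<Longrightarrow> tcap a b \<cdot> jw A n = 0"
proof -
  assume n: "a + (2 + b) = n"
  have "adj (jw A n \<cdot> tcup a b) = tcap a b \<cdot> jw A n"
    using adj_comp[OF tcap_in_hom(2)[of a b], of "jw A n" n A] n by simp
  then show ?thesis using jw_tcup[OF n] by simp
qed

text \<open>Closing the strands one at a time multiplies the ratios from the partial traces, and the
  product telescopes.\<close>

lemma jw_trace: "tl_trace A n (jw A n) = Delta A n"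
proof (induction n)
  case 0
  then show ?case by (simp add: tl_trace_0 tl_value_id_0)
next
  case (Suc n)
  have "tl_trace A (Suc n) (jw A (Suc n)) =
      tl_trace A n (tcap n 0 \<cdot> (jw A (Suc n) \<otimes> tl_id 1) \<cdot> tcup n 0)"
    using tl_trace_partial[of "jw A (Suc n)" n 1 A, unfolded Suc_eq_plus1 [symmetric]] tl_tensor_id_0(2)[OF tl_generators_in_hom(2)]
      tl_tensor_id_0(2)[OF tl_generators_in_hom(3)] by (simp add: tcap_def tcup_def)
  then show ?case using jw_properties[of n] Suc Delta_nonzero[of n] by simp
qed

lemma jw_nonzero: "jw A n \<noteq> 0"
  using jw_trace[of n] Delta_nonzero[of n] by auto

text \<open>Every diagram of \<open>x\<close> other than the identity begins with a cap, and that
  cap meets \<open>z\<close>.\<close>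

lemma killed_absorb:
  assumes x: "x \<in> tl_hom n n" and z: "tl_good z" and kill: "\<And>a b. a + (2 + b) = n \<Longrightarrow> tcap a b \<cdot> z = 0"
  shows "x \<cdot> z = scale (Poly_Mapping.lookup x (id_diagram n)) (tl_id n \<cdot> z)"
proof -
  have "y \<cdot> tcap a b \<cdot> z = 0" if "n = a + (2 + b)" for a b y
    using kill that by simp
  then show ?thesis
    using linear_map_through[OF x, of "\<lambda>x. x \<cdot> z" A] z
    by (simp add: comp_assoc tl_good_hom)
qed

text \<open>Idempotence and \<open>killed_absorb\<close> make \<open>jw A n\<close> equal to its
  identity coefficient times itself, and it is non-zero.\<close>

lemma lookup_jw: "Poly_Mapping.lookup (jw A n) (id_diagram n) = 1"
proof -
  have "jw A n = scale (Poly_Mapping.lookup (jw A n) (id_diagram n)) (jw A n)"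
    using killed_absorb[OF jw_in_hom[of A n] jw_good[of A n] jw_tcap] jw_idem comp_id(1)[OF jw_in_hom] by simp
  then have "scale (Poly_Mapping.lookup (jw A n) (id_diagram n) - 1) (jw A n) = 0"
    by (simp add: scale_linear)
  then have "(Poly_Mapping.lookup (jw A n) (id_diagram n) - 1) * Poly_Mapping.lookup (jw A n) d = 0" for d
    by (metis lookup_scale lookup_zero)
  then show ?thesis using jw_nonzero poly_mapping_eqI[of "jw A n" 0] by auto
qed

text \<open>The idempotent is the identity plus terms that begin with a cap. It may be inserted or
  erased wherever an expression makes such terms vanish; most manipulations of labelled diagrams are
  instances of this.\<close>

lemma linear_map_jw:
  assumes "linear_map L" "\<And>a b y. n = a + (2 + b) \<Longrightarrow> y \<in> tl_hom (a + b) n \<Longrightarrow> L (y \<cdot> tcap a b) = 0"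
  shows "L (jw A n) = L (tl_id n)"
  using linear_map_through[OF jw_in_hom[of A n] assms(1,2)] by (simp add: lookup_jw)

lemma linear_map_jw':
  assumes "linear_map L" "\<And>a b y. n = a + (2 + b) \<Longrightarrow> y \<in> tl_hom n (a + b) \<Longrightarrow> L (tcup a b \<cdot> y) = 0"
  shows "L (jw A n) = L (tl_id n)"
proof -
  have "L (adj (y \<cdot> tcap a b)) = 0" if "n = a + (2 + b)" "y \<in> tl_hom (a + b) n" for a b y
  proof -
    have "adj (y \<cdot> tcap a b) = tcup a b \<cdot> adj y"
      using adj_comp[OF tcap_in_hom(1)[of a b] that(2)] by simp
    then show ?thesis using assms(2) that adj_in_hom by simp
  qed
  then show ?thesis using linear_map_jw[of "\<lambda>x. L (adj x)" n] assms(1) by (simp add: linear_map_def)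
qed

text \<open>For uniqueness, let \<open>f\<close> be a second candidate and \<open>c\<close> its
  identity coefficient. Then \<open>f \<cdot> jw A n\<close> is \<open>f\<close>, because the other
  terms of \<open>jw A n\<close> die on \<open>f\<close>, and it is also \<open>c\<close> times
  \<open>jw A n\<close>, because the other terms of \<open>f\<close> die on \<open>jw A n\<close>.
  Idempotence of \<open>f\<close> forces \<open>c = 1\<close>.\<close>

theorem jones_wenzl_eq: "jones_wenzl A n = jw A n"
  unfolding jones_wenzl_def
proof (rule the_equality)
  show "jw A n \<in> tl_hom n n \<and> jw A n \<noteq> 0 \<and> jw A n \<cdot> jw A n = jw A n \<and>
     (\<forall>s. s + 2 \<le> n \<longrightarrow> turn_back_top n s \<cdot> jw A n = 0 \<and> jw A n \<cdot> turn_back_bot n s = 0)"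
  proof (intro conjI allI impI)
    fix s assume "s + 2 \<le> n"
    then have "s + (2 + (n - 2 - s)) = n" by simp
    then show "turn_back_top n s \<cdot> jw A n = 0" "jw A n \<cdot> turn_back_bot n s = 0"
      using jw_tcap jw_tcup turn_back_eq \<open>s + 2 \<le> n\<close> by metis+
  qed (use jw_nonzero jw_idem in auto)
  fix f assume f: "f \<in> tl_hom n n \<and> f \<noteq> 0 \<and> f \<cdot> f = f \<and>
     (\<forall>s. s + 2 \<le> n \<longrightarrow> turn_back_top n s \<cdot> f = 0 \<and> f \<cdot> turn_back_bot n s = 0)"
  then have fh: "f \<in> tl_hom n n" by blast
  have killed: "tcap a b \<cdot> f = 0" "f \<cdot> tcup a b = 0" if "n = a + (2 + b)" for a b
  proof -
    have "a + 2 \<le> n" "n - 2 - a = b" using that by simp_all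
    then show "tcap a b \<cdot> f = 0" "f \<cdot> tcup a b = 0" using f turn_back_eq by metis+
  qed
  define c where "c = Poly_Mapping.lookup f (id_diagram n)"
  have "jw A n \<cdot> f = f"
    using killed_absorb[OF jw_in_hom[of A n] tl_good_hom[OF fh]] killed(1) comp_id(1)[OF fh] by (simp add: lookup_jw)
  moreover have "f \<cdot> jw A n = f"
    using linear_map_jw'[of "\<lambda>x. f \<cdot> x" n] killed(2) comp_id(2)[OF fh] fh
    by (simp add: comp_assoc [symmetric] tl_good_hom)
  moreover have fj: "f \<cdot> jw A n = scale c (jw A n)"
    using killed_absorb[OF fh jw_good[of A n] jw_tcap] comp_id(1)[OF jw_in_hom] by (simp add: c_def)
  ultimately have "f = scale c (jw A n)" by simp
  moreover have "c = 1"
  proof -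
    have "f \<cdot> f = scale c f"
      using killed_absorb[OF fh tl_good_hom[OF fh]] killed(1) comp_id(1)[OF fh] by (simp add: c_def)
    then have "scale (c - 1) f = 0" using f by (simp add: scale_linear)
    then have "(c - 1) * Poly_Mapping.lookup f d = 0" for d by (metis lookup_scale lookup_zero)
    then show ?thesis using f poly_mapping_eqI[of f 0] by auto
  qed
  ultimately show "f = jw A n" by simp
qed

lemma ic_id:
  assumes "x \<in> tl_hom m n" "y \<in> tl_hom n k"
  shows "(y \<cdot> x) \<otimes> tl_id l = (y \<otimes> tl_id l) \<cdot> (x \<otimes> tl_id l)"
    "tl_id l \<otimes> (y \<cdot> x) = (tl_id l \<otimes> y) \<cdot> (tl_id l \<otimes> x)"
  using tl_interchange[OF assms(1) tl_generators_in_hom(1)[of l] assms(2) tl_generators_in_hom(1)[of l], of A]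
    tl_interchange[OF tl_generators_in_hom(1)[of l] assms(1) tl_generators_in_hom(1)[of l] assms(2), of A]
    comp_id(1)[OF tl_generators_in_hom(1)[of l]] by simp_all

text \<open>A turn-back on some of the strands is a turn-back on all of them, so the larger
  idempotent cannot distinguish the smaller one from the identity.\<close>

lemma jw_absorb:
  "(jw A n \<otimes> tl_id k) \<cdot> jw A (n + k) = jw A (n + k)" "(tl_id k \<otimes> jw A n) \<cdot> jw A (k + n) = jw A (k + n)"
proof -
  have "((y \<cdot> tcap a b) \<otimes> tl_id k) \<cdot> jw A (n + k) = 0" if "n = a + (2 + b)" "y \<in> tl_hom (a + b) n" for a b y
    using that(1) jw_tcap[of a "b + k" "n + k"] tl_good_hom[OF that(2)]
    by (simp add: ic_id(1)[OF tcap_in_hom(1) that(2)] tcap_tensor comp_assoc)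
  then show "(jw A n \<otimes> tl_id k) \<cdot> jw A (n + k) = jw A (n + k)"
    using linear_map_jw[of "\<lambda>x. (x \<otimes> tl_id k) \<cdot> jw A (n + k)" n] comp_id(1)[OF jw_in_hom] by (simp add: tl_tensor_id)
  have "(tl_id k \<otimes> (y \<cdot> tcap a b)) \<cdot> jw A (k + n) = 0" if "n = a + (2 + b)" "y \<in> tl_hom (a + b) n" for a b y
    using that(1) jw_tcap[of "k + a" b "k + n"] tl_good_hom[OF that(2)]
    by (simp add: ic_id(2)[OF tcap_in_hom(1) that(2)] tcap_tensor comp_assoc)
  then show "(tl_id k \<otimes> jw A n) \<cdot> jw A (k + n) = jw A (k + n)"
    using linear_map_jw[of "\<lambda>x. (tl_id k \<otimes> x) \<cdot> jw A (k + n)" n] comp_id(1)[OF jw_in_hom] by (simp add: tl_tensor_id)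
qed

text \<open>A turn-back at one end of the arc slides along it and dies on the idempotent at the
  other end, so either of the two idempotents may be erased.\<close>

lemma jw_slide:
  "(jw A k \<otimes> jw A k) \<cdot> tl_cup k = (jw A k \<otimes> tl_id k) \<cdot> tl_cup k"
  "(jw A k \<otimes> jw A k) \<cdot> tl_cup k = (tl_id k \<otimes> jw A k) \<cdot> tl_cup k"
proof -
  have "(jw A k \<otimes> (y \<cdot> tcap a b)) \<cdot> tl_cup k = 0" if k: "k = a + (2 + b)" and y: "y \<in> tl_hom (a + b) k" for a b y
  proof -
    have "jw A k \<otimes> (y \<cdot> tcap a b) = (jw A k \<otimes> y) \<cdot> (tl_id k \<otimes> tcap a b)"
      using tl_ic[OF tl_generators_in_hom(1)[of k] tcap_in_hom(1)[of a b] jw_in_hom[of A k] y refl refl, of A] comp_id(2)[OF jw_in_hom] by simp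
    moreover have "(tl_id k \<otimes> tcap a b) \<cdot> tl_cup k = (tcup b a \<otimes> tl_id (a + b)) \<cdot> tl_cup (a + b)"
      using tl_cup_slide[of a b A] k by (simp add: tcap_def tcup_def ac_simps)
    moreover have "(jw A k \<otimes> y) \<cdot> (tcup b a \<otimes> tl_id (a + b)) = 0"
    proof -
      have "(jw A k \<otimes> y) \<cdot> (tcup b a \<otimes> tl_id (a + b)) = (jw A k \<cdot> tcup b a) \<otimes> (y \<cdot> tl_id (a + b))"
        by (rule tl_ic, (rule tcap_in_hom tl_generators_in_hom jw_in_hom y)+) (use k in simp_all)
      then show ?thesis using jw_tcup[of b a k] k by simp
    qed
    ultimately show ?thesis
      using tl_good_hom[OF y] by (simp add: comp_assoc) (simp add: comp_assoc [symmetric])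
  qed
  then show "(jw A k \<otimes> jw A k) \<cdot> tl_cup k = (jw A k \<otimes> tl_id k) \<cdot> tl_cup k"
    by (intro linear_map_jw[of "\<lambda>x. (jw A k \<otimes> x) \<cdot> tl_cup k"]) simp_all
  have "((y \<cdot> tcap a b) \<otimes> jw A k) \<cdot> tl_cup k = 0" if k: "k = a + (2 + b)" and y: "y \<in> tl_hom (a + b) k" for a b y
  proof -
    have "(y \<cdot> tcap a b) \<otimes> jw A k = (y \<otimes> jw A k) \<cdot> (tcap a b \<otimes> tl_id k)"
      using tl_ic[OF tcap_in_hom(1)[of a b] tl_generators_in_hom(1)[of k] y jw_in_hom[of A k] refl refl, of A] comp_id(2)[OF jw_in_hom] by simp
    moreover have "(tcap a b \<otimes> tl_id k) \<cdot> tl_cup k = (tl_id (a + b) \<otimes> tcup b a) \<cdot> tl_cup (a + b)"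
      using tl_cup_slide'[of a b A] k by (simp add: tcap_def tcup_def ac_simps)
    moreover have "(y \<otimes> jw A k) \<cdot> (tl_id (a + b) \<otimes> tcup b a) = 0"
    proof -
      have "(y \<otimes> jw A k) \<cdot> (tl_id (a + b) \<otimes> tcup b a) = (y \<cdot> tl_id (a + b)) \<otimes> (jw A k \<cdot> tcup b a)"
        by (rule tl_ic, (rule tcap_in_hom tl_generators_in_hom jw_in_hom y)+) (use k in simp_all)
      then show ?thesis using jw_tcup[of b a k] k by simp
    qed
    ultimately show ?thesis
      using tl_good_hom[OF y] by (simp add: comp_assoc) (simp add: comp_assoc [symmetric])
  qed
  then show "(jw A k \<otimes> jw A k) \<cdot> tl_cup k = (tl_id k \<otimes> jw A k) \<cdot> tl_cup k"
    by (intro linear_map_jw[of "\<lambda>x. (x \<otimes> jw A k) \<cdot> tl_cup k"]) simp_all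
qed

text \<open>Schur's lemma: a diagram with a turn-back dies on one of the two idempotents, and a
  diagram without one is an identity, which exists for \<open>m = n\<close> only.\<close>

lemma jw_schur:
  assumes x: "x \<in> tl_hom m n"
  shows "jw A n \<cdot> x \<cdot> jw A m = (if m = n then scale (Poly_Mapping.lookup x (id_diagram n)) (jw A n) else 0)"
proof -
  have "jw A n \<cdot> (y \<cdot> tcap a b) \<cdot> jw A m = 0" if "m = a + (2 + b)" "y \<in> tl_hom (a + b) n" for a b y
    using jw_tcap[of a b m] that tl_good_hom[OF that(2)] by (simp add: comp_assoc)
  moreover have "jw A n \<cdot> (tcup a b \<cdot> y) \<cdot> jw A m = 0" if "n = a + (2 + b)" "y \<in> tl_hom m (a + b)" for a b y
  proof -
    have "jw A n \<cdot> (tcup a b \<cdot> y) \<cdot> jw A m = (jw A n \<cdot> tcup a b) \<cdot> y \<cdot> jw A m"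
      using tl_good_hom[OF that(2)] by (simp add: comp_assoc)
    then show ?thesis using jw_tcup[of a b n] that by simp
  qed
  moreover have "linear_map (\<lambda>x. jw A n \<cdot> x \<cdot> jw A m)" by simp
  ultimately have "jw A n \<cdot> x \<cdot> jw A m =
     (if m = n then scale (Poly_Mapping.lookup x (id_diagram n)) (jw A n \<cdot> tl_id n \<cdot> jw A m) else 0)"
    by (intro linear_map_through[OF x, of _ A]) blast+
  then show ?thesis using comp_id(1)[OF jw_in_hom] jw_idem by auto
qed

end

section \<open>Recoupling\<close>

text \<open>Half the sum of the labels minus one label is the number of strands joining the other
  two legs.\<close>

lemma admissibleE:
  assumes "admissible i j n"
  obtains a b c where "i = a + c" "j = c + b" "n = a + b"
proof -
  have "2 dvd i + j + n" using assms by (simp add: admissible_def)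
  then obtain p where "i + j + n = 2 * p" by (rule dvdE)
  then have "i = (p - j) + (p - n)" "j = (p - n) + (p - i)" "n = (p - j) + (p - i)"
    using assms unfolding admissible_def by linarith+
  then show ?thesis by (rule that)
qed

lemma admissible_sum: "admissible (a + c) (c + b) (a + b)"
  unfolding admissible_def by presburger

lemma finite_admissible: "finite {n. admissible i j n \<and> admissible k l n}"
  by (rule finite_subset[of _ "{..i + j}"]) (auto simp: admissible_def)

section \<open>Three-vertices and multiplicity one\<close>

context generic_parameter
begin

abbreviation mg :: "nat \<Rightarrow> nat \<Rightarrow> nat \<Rightarrow> tl" where "mg i j n \<equiv> vertex_merge i j n A"
abbreviation sp :: "nat \<Rightarrow> nat \<Rightarrow> nat \<Rightarrow> tl" where "sp n i j \<equiv> vertex_split n i j A"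
abbreviation jw2 :: "nat \<Rightarrow> nat \<Rightarrow> tl" where "jw2 i j \<equiv> jw A i \<otimes> jw A j"

text \<open>The vertex without its idempotents: \<open>a\<close> and \<open>b\<close> strands run
  from the legs to the stem and \<open>c\<close> strands join the legs. These numbers parametrise
  the admissible triples without any division.\<close>

definition core :: "nat \<Rightarrow> nat \<Rightarrow> nat \<Rightarrow> tl" where
  "core a c b = tl_id a \<otimes> tl_cap c \<otimes> tl_id b"

lemma core_in_hom [simp, intro]: "core a c b \<in> tl_hom (a + c + (c + b)) (a + b)"
  unfolding core_def by (rule tl_hom_cast, (rule tl_typ | simp)+)

lemma core_good [simp]: "tl_good (core a c b)" using tl_good_hom core_in_hom by blast

lemma jw2_in_hom [simp, intro]: "jw2 i j \<in> tl_hom (i + j) (i + j)"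
  by (intro tl_tensor_in_hom jw_in_hom)

lemma jw2_idem: "jw2 i j \<cdot> jw2 i j = jw2 i j"
  by (simp add: tl_interchange[OF jw_in_hom jw_in_hom jw_in_hom jw_in_hom] jw_idem)

lemma jw2_idem': "tl_good x \<Longrightarrow> jw2 i j \<cdot> jw2 i j \<cdot> x = jw2 i j \<cdot> x"
  by (simp add: comp_assoc [symmetric] jw2_idem)

lemma jw_idem': "tl_good x \<Longrightarrow> jw A n \<cdot> jw A n \<cdot> x = jw A n \<cdot> x"
  by (simp add: comp_assoc [symmetric] jw_idem)

lemma adj_jw2 [simp]: "adj (jw2 i j) = jw2 i j"
  by (simp add: adj_tensor[OF jw_in_hom jw_in_hom])

lemma adj_core: "adj (core a c b) = tl_id a \<otimes> tl_cup c \<otimes> tl_id b"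
  unfolding core_def
  by (simp add: adj_tensor[OF tl_generators_in_hom(1) tl_tensor_in_hom[OF tl_generators_in_hom(2) tl_generators_in_hom(1)]]
      adj_tensor[OF tl_generators_in_hom(2) tl_generators_in_hom(1)])

lemma merge_eq: "mg (a + c) (c + b) (a + b) = jw A (a + b) \<cdot> core a c b \<cdot> jw2 (a + c) (c + b)"
proof -
  have "(a + c + (a + b) - (c + b)) div 2 = a" "(a + c + (c + b) - (a + b)) div 2 = c"
    "(c + b + (a + b) - (a + c)) div 2 = b" by simp_all
  then show ?thesis unfolding vertex_merge_def core_def jones_wenzl_eq using admissible_sum by simp
qed

text \<open>With splitting known to be the reflection of merging, each property of
  \<open>vertex_split\<close> can be read off its counterpart for
  \<open>vertex_merge\<close>.\<close>

lemma split_eq_adj: "sp n i j = adj (mg i j n)"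
proof (cases "admissible i j n")
  case False
  then show ?thesis by (simp add: vertex_split_def vertex_merge_def)
next
  case True
  then obtain a b c where e: "i = a + c" "j = c + b" "n = a + b" by (rule admissibleE)
  have "(a + c + (a + b) - (c + b)) div 2 = a" "(a + c + (c + b) - (a + b)) div 2 = c"
    "(c + b + (a + b) - (a + c)) div 2 = b" by simp_all
  then have "sp n i j = jw2 (a + c) (c + b) \<cdot> adj (core a c b) \<cdot> jw A (a + b)"
    unfolding vertex_split_def adj_core jones_wenzl_eq e using admissible_sum by simp
  also have "\<dots> = adj (mg i j n)"
  proof -
    have "adj (core a c b \<cdot> jw2 (a + c) (c + b)) = jw2 (a + c) (c + b) \<cdot> adj (core a c b)"
      by (subst adj_comp[OF jw2_in_hom core_in_hom]) simp
    moreover have "adj (jw A (a + b) \<cdot> core a c b \<cdot> jw2 (a + c) (c + b)) =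
        adj (core a c b \<cdot> jw2 (a + c) (c + b)) \<cdot> jw A (a + b)"
      by (subst adj_comp[OF tl_comp_in_hom[OF jw2_in_hom core_in_hom] jw_in_hom]) simp
    moreover have "tl_good (adj (core a c b))" using tl_good_hom adj_in_hom core_in_hom by blast
    ultimately show ?thesis unfolding e merge_eq by (simp add: comp_assoc)
  qed
  finally show ?thesis .
qed

lemma merge_in_hom [simp, intro]: "mg i j n \<in> tl_hom (i + j) n"
proof (cases "admissible i j n")
  case False
  then show ?thesis by (simp add: vertex_merge_def)
next
  case True
  then obtain a b c where e: "i = a + c" "j = c + b" "n = a + b" by (rule admissibleE)
  show ?thesis unfolding e merge_eq by (intro tl_comp_in_hom[OF _ jw_in_hom] tl_comp_in_hom[OF _ core_in_hom] jw2_in_hom)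
qed

lemma split_in_hom [simp, intro]: "sp n i j \<in> tl_hom n (i + j)"
  unfolding split_eq_adj by (intro adj_in_hom merge_in_hom)

lemma vertex_good [simp]: "tl_good (mg i j n)" "tl_good (sp n i j)"
  using tl_good_hom merge_in_hom split_in_hom by blast+

lemma merge_absorb: "jw A n \<cdot> mg i j n = mg i j n" "mg i j n \<cdot> jw2 i j = mg i j n"
proof -
  have "jw A n \<cdot> mg i j n = mg i j n \<and> mg i j n \<cdot> jw2 i j = mg i j n"
  proof (cases "admissible i j n")
    case False
    then show ?thesis by (simp add: vertex_merge_def)
  next
    case True
    then obtain a b c where e: "i = a + c" "j = c + b" "n = a + b" by (rule admissibleE)
    show ?thesis unfolding e merge_eq by (simp add: comp_assoc jw_idem' jw2_idem)
  qed
  then show "jw A n \<cdot> mg i j n = mg i j n" "mg i j n \<cdot> jw2 i j = mg i j n" by blast+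
qed

lemma adj_merge: "adj (mg i j n) = sp n i j" and adj_split: "adj (sp n i j) = mg i j n"
  by (simp_all add: split_eq_adj adj_adj[OF merge_in_hom])

lemma split_absorb: "sp n i j \<cdot> jw A n = sp n i j" "jw2 i j \<cdot> sp n i j = sp n i j"
  using arg_cong[OF merge_absorb(1), of adj] arg_cong[OF merge_absorb(2), of adj]
  by (simp_all add: adj_comp[OF merge_in_hom jw_in_hom] adj_comp[OF jw2_in_hom merge_in_hom] adj_merge)

lemma core_step: "core a c b \<cdot> tcap (a + c) (c + b) = core a (Suc c) b"
proof -
  have cap: "tl_cap (Suc c) = tl_cap c \<cdot> tcap c c"
    using tl_cap_add[of c 1 A, unfolded Suc_eq_plus1 [symmetric]] by (simp add: tcap_def)
  have t: "tcap (a + c) (c + b) = tl_id a \<otimes> tcap c c \<otimes> tl_id b" by (simp add: tcap_tensor)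
  have c2: "tcap c c \<in> tl_hom (c + (2 + c)) (2 * c)" using tcap_in_hom(1)[of c c] by (simp add: mult_2)
  have "(tl_cap c \<otimes> tl_id b) \<cdot> (tcap c c \<otimes> tl_id b) = tl_cap (Suc c) \<otimes> tl_id b"
    unfolding cap by (rule ic_id(1)[OF c2 tl_generators_in_hom(2), symmetric])
  moreover have "(tl_id a \<otimes> tl_cap c \<otimes> tl_id b) \<cdot> (tl_id a \<otimes> tcap c c \<otimes> tl_id b) =
      tl_id a \<otimes> ((tl_cap c \<otimes> tl_id b) \<cdot> (tcap c c \<otimes> tl_id b))"
    by (rule ic_id(2)[OF tl_tensor_in_hom[OF c2 tl_generators_in_hom(1)] tl_tensor_in_hom[OF tl_generators_in_hom(2,1)], symmetric])
  ultimately show ?thesis unfolding t core_def by simp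
qed

text \<open>The idempotents on the legs absorb smaller ones on all strands but the two innermost. A
  cap on those two does not touch the smaller idempotents, so they slip past it.\<close>

lemma tcap_jw2_step:
  "tcap i j \<cdot> jw2 (Suc i) (Suc j) = jw2 i j \<cdot> tcap i j \<cdot> jw2 (Suc i) (Suc j)"
proof -
  have "jw2 (Suc i) (Suc j) = ((jw A i \<otimes> tl_id 1) \<otimes> (tl_id 1 \<otimes> jw A j)) \<cdot> jw2 (Suc i) (Suc j)"
  proof -
    have "((jw A i \<otimes> tl_id 1) \<otimes> (tl_id 1 \<otimes> jw A j)) \<cdot> jw2 (Suc i) (Suc j) =
       ((jw A i \<otimes> tl_id 1) \<cdot> jw A (Suc i)) \<otimes> ((tl_id 1 \<otimes> jw A j) \<cdot> jw A (Suc j))"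
      by (rule tl_ic, (rule tl_typ jw_in_hom)+) simp_all
    then show ?thesis using jw_absorb(1)[of i 1, unfolded Suc_eq_plus1 [symmetric]] jw_absorb(2)[of 1 j, unfolded plus_1_eq_Suc] by simp
  qed
  moreover have "tcap i j \<cdot> ((jw A i \<otimes> tl_id 1) \<otimes> (tl_id 1 \<otimes> jw A j)) = jw2 i j \<cdot> tcap i j"
  proof -
    have j: "(jw A i \<otimes> tl_id 1) \<otimes> (tl_id 1 \<otimes> jw A j) = jw A i \<otimes> tl_id 2 \<otimes> jw A j"
      using tensor_assoc[of "tl_id 1" "tl_id 1" "jw A j"] by (simp add: tensor_assoc tl_tensor_id)
    have in1: "tl_id 2 \<otimes> jw A j \<in> tl_hom (2 + j) (2 + j)" "tl_cap 1 \<otimes> tl_id j \<in> tl_hom (2 + j) j" 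
      by (rule tl_hom_cast, (rule tl_typ jw_in_hom | simp)+)+
    have c1: "tl_cap 1 \<cdot> tl_id 2 = tl_cap 1" by (rule comp_id(2)[OF tl_generators_in_hom(2)]) simp
    have "tcap i j \<cdot> (jw A i \<otimes> tl_id 2 \<otimes> jw A j) =
        (tl_id i \<cdot> jw A i) \<otimes> ((tl_cap 1 \<otimes> tl_id j) \<cdot> (tl_id 2 \<otimes> jw A j))"
      unfolding tcap_def by (rule tl_ic[OF jw_in_hom in1(1) tl_generators_in_hom(1) in1(2)]) simp_all
    also have "(tl_cap 1 \<otimes> tl_id j) \<cdot> (tl_id 2 \<otimes> jw A j) = (tl_cap 1 \<cdot> tl_id 2) \<otimes> (tl_id j \<cdot> jw A j)"
      by (rule tl_ic[OF tl_generators_in_hom(1) jw_in_hom tl_generators_in_hom(2) tl_generators_in_hom(1)]) simp_all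
    finally have L: "tcap i j \<cdot> (jw A i \<otimes> tl_id 2 \<otimes> jw A j) = jw A i \<otimes> tl_cap 1 \<otimes> jw A j"
      using comp_id(1)[OF jw_in_hom] c1 by simp
    have "jw2 i j = jw A i \<otimes> tl_id 0 \<otimes> jw A j" using tl_tensor_id_0(1)[OF jw_in_hom] by simp
    then have "jw2 i j \<cdot> tcap i j = (jw A i \<cdot> tl_id i) \<otimes> ((tl_id 0 \<otimes> jw A j) \<cdot> (tl_cap 1 \<otimes> tl_id j))"
      unfolding tcap_def using tl_ic[OF tl_generators_in_hom(1) in1(2) jw_in_hom tl_tensor_in_hom[OF tl_generators_in_hom(1)[of 0] jw_in_hom]]
      by simp
    also have "(tl_id 0 \<otimes> jw A j) \<cdot> (tl_cap 1 \<otimes> tl_id j) = (tl_id 0 \<cdot> tl_cap 1) \<otimes> (jw A j \<cdot> tl_id j)"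
      by (rule tl_ic[OF tl_generators_in_hom(2) tl_generators_in_hom(1) tl_generators_in_hom(1) jw_in_hom]) simp_all
    finally show ?thesis using L j comp_id(2)[OF jw_in_hom] comp_id(1)[OF tl_generators_in_hom(2)] by simp
  qed
  ultimately show ?thesis by (metis comp_assoc jw_good tcap_good(1) tl_good_tensor tl_good_generators(1))
qed

lemma merge_step:
  assumes "admissible i j n"
  shows "mg i j n \<cdot> tcap i j \<cdot> jw2 (Suc i) (Suc j) = mg (Suc i) (Suc j) n"
proof -
  obtain a b c where e: "i = a + c" "j = c + b" "n = a + b" using assms by (rule admissibleE)
  have "mg i j n \<cdot> tcap i j \<cdot> jw2 (Suc i) (Suc j) =
      jw A n \<cdot> core a c b \<cdot> jw2 i j \<cdot> tcap i j \<cdot> jw2 (Suc i) (Suc j)"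
    unfolding e merge_eq by (simp add: comp_assoc)
  also have "\<dots> = jw A n \<cdot> (core a c b \<cdot> tcap i j) \<cdot> jw2 (Suc i) (Suc j)"
    unfolding tcap_jw2_step[symmetric] by (simp add: comp_assoc)
  also have "\<dots> = mg (a + Suc c) (Suc c + b) (a + b)"
    unfolding merge_eq e core_step by simp
  finally show ?thesis by (simp add: e)
qed

text \<open>Multiplicity one. A cup at the bottom dies on the stem and a cap inside one leg dies on
  that leg; a surviving cap straddles the seam between the legs, uses up a strand of each, and
  \<open>tcap_jw2_step\<close> hands the rest to the shorter legs. A diagram without turn-backs is
  the vertex with no strand between its legs.\<close>

lemma merge_span:
  assumes "x \<in> tl_hom (i + j) n"
  shows "\<exists>c. jw A n \<cdot> x \<cdot> jw2 i j = scale c (mg i j n)"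
proof -
  have extend: "\<exists>c. jw A n \<cdot> x \<cdot> jw2 i j = scale c (mg i j n)"
    if step: "\<And>i' j' y. i = Suc i' \<Longrightarrow> j = Suc j' \<Longrightarrow> y \<in> tl_hom (i' + j') n \<Longrightarrow> \<exists>c. jw A n \<cdot> y \<cdot> jw2 i' j' = scale c (mg i' j' n)"
      and x: "x \<in> tl_hom (i + j) n" for i j x
    using x
  proof (induction x rule: tl_hom_induct)
    case zero
    then show ?case by (intro exI[of _ 0]) simp
  next
    case (add x y)
    then show ?case by (metis scale_linear(3) tl_comp_linear(1,2))
  next
    case (scale c x)
    then show ?case by (metis scale_simps(4) tl_comp_linear(3,4))
  next
    case (basis d)
    then show ?case
    proof (cases rule: basis_cases[where A = A])
      case id
      have "mg (i + 0) (0 + j) (i + j) = jw A n \<cdot> basis d \<cdot> jw2 i j"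
        unfolding merge_eq core_def using id tl_tensor_id_0[OF tl_generators_in_hom(1)]
        by (simp add: tl_cap_def cap_diagram_def tl_id_def id_diagram_def[of 0] tl_tensor_id[unfolded tl_id_def])
      then show ?thesis using id by (intro exI[of _ 1]) simp
    next
      case (bottom a b y)
      have "jw A n \<cdot> basis d \<cdot> jw2 i j = (jw A n \<cdot> tcup a b) \<cdot> y \<cdot> jw2 i j"
        using tl_good_hom[OF bottom(3)] by (simp add: bottom(4) comp_assoc)
      then show ?thesis using jw_tcup bottom(2) by (intro exI[of _ 0]) simp
    next
      case (top a b y)
      have d: "jw A n \<cdot> basis d \<cdot> jw2 i j = jw A n \<cdot> y \<cdot> tcap a b \<cdot> jw2 i j"
        using tl_good_hom[OF top(2)] by (simp add: top(3) comp_assoc)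
      \<comment> \<open>The position of the cap: inside the left leg, inside the right leg, or
        across the seam.\<close>
      consider b' where "i = a + (2 + b')" "b = b' + j" | a' where "j = a' + (2 + b)" "a = i + a'" | "i = Suc a" "j = Suc b"
      proof -
        consider "a + 2 \<le> i" | "i \<le> a" | "i = Suc a" by linarith
        then show ?thesis
        proof cases
          case 1
          then have "i = a + (2 + (i - a - 2))" "b = i - a - 2 + j" using top(1) by linarith+
          then show ?thesis by (rule that(1))
        next
          case 2
          then have "j = a - i + (2 + b)" "a = i + (a - i)" using top(1) by linarith+
          then show ?thesis by (rule that(2))
        next
          case 3
          then have "j = Suc b" using top(1) by linarith
          then show ?thesis using 3 that(3) by blast
        qed
      qed
      then show ?thesis
      proof cases
        case (1 b')
        have "tcap a b \<cdot> jw2 i j = (tcap a b' \<cdot> jw A i) \<otimes> (tl_id j \<cdot> jw A j)"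
          unfolding 1(2) tcap_tensor(1)[symmetric]
          by (rule tl_ic[OF jw_in_hom jw_in_hom tcap_in_hom(1) tl_generators_in_hom(1)]) (simp_all add: 1)
        then have "tcap a b \<cdot> jw2 i j = 0" using jw_tcap[of a b' i] 1 by simp
        then show ?thesis unfolding d by (intro exI[of _ 0]) simp
      next
        case (2 a')
        have "tcap a b \<cdot> jw2 i j = (tl_id i \<cdot> jw A i) \<otimes> (tcap a' b \<cdot> jw A j)"
          unfolding 2(2) tcap_tensor(2)[symmetric]
          by (rule tl_ic[OF jw_in_hom jw_in_hom tl_generators_in_hom(1) tcap_in_hom(1)]) (simp_all add: 2)
        then have "tcap a b \<cdot> jw2 i j = 0" using jw_tcap[of a' b j] 2 by simp
        then show ?thesis unfolding d by (intro exI[of _ 0]) simp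
      next
        case 3
        obtain c where c: "jw A n \<cdot> y \<cdot> jw2 a b = scale c (mg a b n)" using step 3 top(2) by blast
        have "jw A n \<cdot> basis d \<cdot> jw2 i j = (jw A n \<cdot> y \<cdot> jw2 a b) \<cdot> tcap a b \<cdot> jw2 i j"
        proof -
          have "jw A n \<cdot> basis d \<cdot> jw2 i j = jw A n \<cdot> y \<cdot> jw2 a b \<cdot> tcap a b \<cdot> jw2 i j"
          proof -
            have "tcap a b \<cdot> jw2 i j = jw2 a b \<cdot> tcap a b \<cdot> jw2 i j"
              unfolding 3 by (rule tcap_jw2_step)
            then show ?thesis unfolding d by (rule arg_cong)
          qed
          then show ?thesis using tl_good_hom[OF top(2)] by (simp add: comp_assoc)
        qed
        also have "\<dots> = scale c (mg a b n \<cdot> tcap a b \<cdot> jw2 (Suc a) (Suc b))"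
          unfolding c by (simp add: 3)
        finally have e: "jw A n \<cdot> basis d \<cdot> jw2 i j = scale c (mg a b n \<cdot> tcap a b \<cdot> jw2 (Suc a) (Suc b))" .
        show ?thesis
        proof (cases "admissible a b n")
          case True
          then show ?thesis unfolding e using merge_step 3 by auto
        next
          \<comment> \<open>The vertex with the shorter legs is 0 by convention here, so the
            contribution vanishes.\<close>
          case False
          then show ?thesis unfolding e by (intro exI[of _ 0]) (simp add: vertex_merge_def)
        qed
      qed
    qed
  qed
  show ?thesis
    using assms
  proof (induction i arbitrary: j x)
    case 0
    \<comment> \<open>With an empty left leg no cap straddles the seam, so the premise of
      \<open>extend\<close> about shorter legs is vacuous.\<close>
    show ?case by (rule extend[OF _ 0]) simp
  next
    case (Suc i)
    show ?case by (rule extend[OF _ Suc.prems]) (use Suc.IH in simp)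
  qed
qed

lemma split_span:
  assumes "x \<in> tl_hom n (i + j)"
  shows "\<exists>c. jw2 i j \<cdot> x \<cdot> jw A n = scale c (sp n i j)"
proof -
  obtain c where c: "jw A n \<cdot> adj x \<cdot> jw2 i j = scale c (mg i j n)"
    using merge_span[OF adj_in_hom[OF assms]] by blast
  have "adj (jw A n \<cdot> adj x \<cdot> jw2 i j) = jw2 i j \<cdot> x \<cdot> jw A n"
    using adj_comp[OF tl_comp_in_hom[OF jw2_in_hom[of i j] adj_in_hom[OF assms], of A] jw_in_hom[of A n], of A]
      adj_comp[OF jw2_in_hom[of i j] adj_in_hom[OF assms], of A] adj_adj[OF assms] tl_good_hom[OF assms]
    by (simp add: comp_assoc)
  then show ?thesis unfolding c by (auto simp: adj_merge intro!: exI[of _ c])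
qed

end

section \<open>Completeness\<close>

lemma basis_tcap:
  assumes "d \<in> diagrams (a + b) n"
  shows "basis d \<circ>\<^bsub>A\<^esub> tcap a b = ev A (mcomp (0, d) (capE a b))"
  unfolding ev_generators(1)[of d A] tcap_ev[of _ _ A] by (rule tl_comp_ev) (use ev0_arity[OF assms, of 0] in simp)

lemma tcup_basis:
  assumes "d \<in> diagrams m (a + b)"
  shows "tcup a b \<circ>\<^bsub>A\<^esub> basis d = ev A (mcomp (cupE a b) (0, d))"
  unfolding ev_generators(1)[of d A] tcap_ev[of _ _ A] by (rule tl_comp_ev) (use ev0_arity[OF assms, of 0] in simp)

lemma wt_capE_equal:
  assumes "wt (capE a b) u w \<noteq> 0" "length u = a + (2 + b)" "length w = a + b"
  shows "u ! a = u ! Suc a"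
proof -
  define u1 u2 u3 w1 w2 where "u1 = take a u" and "u2 = take 2 (drop a u)" and "u3 = drop 2 (drop a u)"
    and "w1 = take a w" and "w2 = drop a w"
  have u: "u = u1 @ u2 @ u3" and l: "length u1 = a" "length u2 = 2" "length u3 = b"
    using assms(2) by (simp_all add: u1_def u2_def u3_def del: drop_drop)
  have w: "w = w1 @ [] @ w2" and l': "length w1 = a" "length w2 = b"
    using assms(3) by (simp_all add: w1_def w2_def)
  have "wt (capE a b) u w = wt (mid a) u1 w1 * wt (mtens (mcap 1) (mid b)) (u2 @ u3) ([] @ w2)"
    unfolding capE_def u w by (rule wt_mtens_append) (simp_all only: mgood_simps mtops_simps mbots_simps l l')
  also have "wt (mtens (mcap 1) (mid b)) (u2 @ u3) ([] @ w2) = wt (mcap 1) u2 [] * wt (mid b) u3 w2"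
    by (rule wt_mtens_append) (simp_all add: l)
  finally have "wt (capE a b) u w = wt (mid a) u1 w1 * (wt (mcap 1) u2 [] * wt (mid b) u3 w2)" .
  then have "wt (mcap 1) u2 [] \<noteq> 0" using assms(1) by (metis mult_zero_left mult_zero_right)
  then have "rev u2 = u2" by simp
  moreover have "rev u2 ! 0 = u2 ! (length u2 - Suc 0)" by (rule rev_nth) (use l(2) in simp)
  ultimately have "u2 ! 0 = u2 ! Suc 0" using l(2) by (simp add: One_nat_def)
  moreover have "u ! (length u1 + 0) = (u2 @ u3) ! 0" "u ! (length u1 + Suc 0) = (u2 @ u3) ! Suc 0"
    unfolding u by (rule nth_append_length_plus)+
  moreover have "(u2 @ u3) ! 0 = u2 ! 0" "(u2 @ u3) ! Suc 0 = u2 ! Suc 0"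
    using l(2) by (simp_all add: nth_append)
  ultimately show ?thesis unfolding l(1) by simp
qed

text \<open>Every diagram in a composite that begins with this cap joins the points \<open>a\<close>
  and \<open>a + 1\<close>, so it fits no colouring that distinguishes them. A colouring of
  \<open>K\<close> that does so certifies that \<open>K\<close> is not among these diagrams.\<close>

lemma lookup_tcap:
  assumes K: "K \<in> diagrams (a + (2 + b)) n" and fit: "fits K u v" "u ! a \<noteq> u ! Suc a"
    and y: "y \<in> tl_hom (a + b) n"
  shows "Poly_Mapping.lookup (y \<circ>\<^bsub>A\<^esub> tcap a b) K = 0"
  using y
proof (induction y rule: tl_hom_induct)
  case (basis d)
  note D = ev0_arity[OF basis, of 0]
  have len: "length u = a + (2 + b)" using fit(1) K by (simp add: fits_def diagramsD)
  have "wt (0, d) w v * wt (capE a b) u w = 0" if "length w = a + b" for w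
    using wt_capE_equal[OF _ len that] fit(2) by auto
  then have "wt (mcomp (0, d) (capE a b)) u v = 0"
    using D by (simp add: mult.commute)
  then have "\<not> fits (snd (mcomp (0, d) (capE a b))) u v" by (simp add: wt_def)
  then have "snd (mcomp (0, d) (capE a b)) \<noteq> K" using fit(1) by blast
  then show ?case unfolding basis_tcap[OF basis] by (simp add: ev_def lookup_single when_def)
qed (auto simp: lookup_add)

lemma lookup_tcup:
  assumes K: "K \<in> diagrams m (a + (2 + b))" and fit: "fits K u v" "v ! a \<noteq> v ! Suc a"
    and y: "y \<in> tl_hom m (a + b)"
  shows "Poly_Mapping.lookup (tcup a b \<circ>\<^bsub>A\<^esub> y) K = 0"
  using y
proof (induction y rule: tl_hom_induct)
  case (basis d)
  note D = ev0_arity[OF basis, of 0]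
  have len: "length v = a + (2 + b)" using fit(1) K by (simp add: fits_def diagramsD)
  have "wt (cupE a b) w v = wt (capE a b) v w" for w
    using wt_mflip[of "capE a b" w v] by simp
  then have "wt (0, d) u w * wt (cupE a b) w v = 0" if "length w = a + b" for w
    using wt_capE_equal[OF _ len that] fit(2) by auto
  then have "wt (mcomp (cupE a b) (0, d)) u v = 0"
    using D by simp
  then have "\<not> fits (snd (mcomp (cupE a b) (0, d))) u v" by (simp add: wt_def)
  then have "snd (mcomp (cupE a b) (0, d)) \<noteq> K" using fit(1) by blast
  then show ?case unfolding tcup_basis[OF basis] by (simp add: ev_def lookup_single when_def)
qed (auto simp: lookup_add)

section \<open>The diagram at the core of a 3-vertex\<close>

definition core_diagram :: "nat \<Rightarrow> nat \<Rightarrow> nat \<Rightarrow> diagram" where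
  "core_diagram a c b = snd (mtens (mid a) (mtens (mcap c) (mid b)))"

lemma core_diagram_in: "core_diagram a c b \<in> diagrams (a + c + (c + b)) (a + b)"
proof -
  have "snd (mtens (mid a) (mtens (mcap c) (mid b))) \<in> diagrams (a + (2 * c + b)) (a + (0 + b))"
    by (intro mtens_mdg mid_mdg) (simp add: mcap_def cap_in_diagrams)
  then show ?thesis by (simp add: core_diagram_def mult_2 add.assoc)
qed

lemma fits_core_diagram:
  assumes "length x = a" "length y = c" "length z = b"
  shows "fits (core_diagram a c b) (x @ y @ rev y @ z) (x @ z)"
proof -
  have "wt (mtens (mid a) (mtens (mcap c) (mid b))) (x @ y @ rev y @ z) (x @ z) = 1"
    using assms by simp
  then show ?thesis by (auto simp: wt_def core_diagram_def)
qed

definition step_list :: "nat \<Rightarrow> nat \<Rightarrow> bool list" where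
  "step_list n s = replicate (Suc s) False @ replicate (n - Suc s) True"

lemma step_list: "Suc s < n \<Longrightarrow> length (step_list n s) = n \<and> step_list n s ! s \<noteq> step_list n s ! Suc s"
  by (auto simp: step_list_def nth_append simp del: replicate_Suc)

text \<open>Only the seam \<open>Suc s = a + c\<close> can carry an arc between neighbouring top
  points. Away from it, the leg containing \<open>s\<close> and \<open>Suc s\<close> is coloured
  with a single change between them, and the nested arcs pass the mirror image of these colours on
  to the other leg.\<close>

lemma core_diagram_separates_top:
  assumes "Suc s < a + c + (c + b)" "Suc s \<noteq> a + c"
  obtains u v where "fits (core_diagram a c b) u v" "u ! s \<noteq> u ! Suc s"
proof (cases "Suc s < a + c")
  case True
  let ?l = "step_list (a + c) s"
  let ?u = "take a ?l @ drop a ?l @ rev (drop a ?l) @ replicate b True"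
  have l: "length ?l = a + c" "?l ! s \<noteq> ?l ! Suc s" using step_list[OF True] by blast+
  have u: "?u = ?l @ rev (drop a ?l) @ replicate b True" by simp
  have "fits (core_diagram a c b) ?u (take a ?l @ replicate b True)"
    by (rule fits_core_diagram) (use l in auto)
  moreover have "?u ! s \<noteq> ?u ! Suc s"
    unfolding u using l True by (simp add: nth_append del: append_take_drop_id)
  ultimately show ?thesis by (rule that)
next
  case False
  define t where "t = s - (a + c)"
  have t: "s = a + c + t" "Suc t < c + b" using False assms by (simp_all add: t_def)
  let ?l = "step_list (c + b) t"
  let ?u = "replicate a True @ rev (take c ?l) @ rev (rev (take c ?l)) @ drop c ?l"
  have l: "length ?l = c + b" "?l ! t \<noteq> ?l ! Suc t" using step_list[OF t(2)] by blast+
  have u: "?u = (replicate a True @ rev (take c ?l)) @ ?l" by simp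
  have len: "length (replicate a True @ rev (take c ?l)) = a + c" using l by simp
  have "fits (core_diagram a c b) ?u (replicate a True @ drop c ?l)"
    by (rule fits_core_diagram) (use l in auto)
  moreover have "?u ! s = ?l ! t" "?u ! Suc s = ?l ! Suc t"
    unfolding u t(1) add_Suc_right[symmetric] by (simp_all only: len[symmetric] nth_append_length_plus)
  ultimately show ?thesis using that l by metis
qed

lemma core_diagram_separates_bot:
  assumes "Suc s < a + b"
  obtains u v where "fits (core_diagram a c b) u v" "v ! s \<noteq> v ! Suc s"
proof -
  let ?l = "step_list (a + b) s"
  have l: "length ?l = a + b" "?l ! s \<noteq> ?l ! Suc s" using step_list[OF assms] by blast+
  have "fits (core_diagram a c b) (take a ?l @ replicate c True @ rev (replicate c True) @ drop a ?l) (take a ?l @ drop a ?l)"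
    by (rule fits_core_diagram) (use l in auto)
  then show ?thesis using l that by simp
qed

context generic_parameter
begin

lemma core_basis: "core a c b = basis (core_diagram a c b)"
proof -
  have "core a c b = ev A (mtens (mid a) (mtens (mcap c) (mid b)))"
    by (simp add: core_def ev_generators(2-)[of _ A] tl_tensor_ev)
  then show ?thesis by (simp add: ev_def core_diagram_def) (simp add: mtens_def mid_def mcap_def)
qed

text \<open>Turn-backs on the legs never produce the diagram at the core of the 3-vertex.\<close>

lemma merge_nonzero:
  assumes "admissible i j n"
  shows "mg i j n \<noteq> 0"
proof -
  obtain a b c where e: "i = a + c" "j = c + b" "n = a + b" using assms by (rule admissibleE)
  define K where "K = core_diagram a c b"
  have Kd: "K \<in> diagrams (i + j) n" unfolding K_def e by (rule core_diagram_in)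
  define lk where "lk x = Poly_Mapping.lookup x K" for x :: tl
  \<comment> \<open>The principles for idempotents concern maps into linear combinations of
    diagrams. A coefficient becomes such a map when multiplied by the empty diagram, and
    \<open>tl_value\<close> reads it back.\<close>
  have lin: "linear_map (\<lambda>x. scale (lk (L x)) (tl_id 0))" if "linear_map L" for L
    using that by (simp add: linear_map_def lk_def lookup_add scale_linear)
  have inj: "c = c'" if "scale c (tl_id 0) = scale c' (tl_id 0)" for c c'
    using arg_cong[OF that, of tl_value] by (simp add: tl_value_id_0)
  \<comment> \<open>A cap across the seam has to be excluded, since the core may contain one. The
    turn-backs that come from the idempotents stay within one leg, so they satisfy this
    restriction.\<close>
  have top: "lk (y \<cdot> tcap s r) = 0" if "i + j = s + (2 + r)" "Suc s \<noteq> i" "y \<in> tl_hom (s + r) n" for s r y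
  proof -
    have s: "Suc s < a + c + (c + b)" "Suc s \<noteq> a + c" using that(1,2) unfolding e by linarith+
    obtain u v where "fits K u v" "u ! s \<noteq> u ! Suc s"
      using core_diagram_separates_top[OF s] unfolding K_def by blast
    then show ?thesis unfolding lk_def using lookup_tcap Kd that(1,3) by simp
  qed
  have bot: "lk (tcup s r \<cdot> y) = 0" if "n = s + (2 + r)" "y \<in> tl_hom (i + j) (s + r)" for s r y
  proof -
    have s: "Suc s < a + b" using that(1) unfolding e by linarith
    obtain u v where "fits K u v" "v ! s \<noteq> v ! Suc s"
      using core_diagram_separates_bot[OF s] unfolding K_def by blast
    then show ?thesis unfolding lk_def using lookup_tcup Kd that by simp
  qed
  have coreh: "core a c b \<in> tl_hom (i + j) n" unfolding e by (rule core_in_hom)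
  \<comment> \<open>The idempotents on the left leg, the right leg and the stem are exchanged for
    identities one by one, without affecting the coefficient of \<open>K\<close>. What remains is
    the core, where this coefficient is 1.\<close>
  have 1: "lk (jw A n \<cdot> core a c b \<cdot> (jw A i \<otimes> jw A j)) = lk (jw A n \<cdot> core a c b \<cdot> (tl_id i \<otimes> jw A j))"
  proof (rule inj, rule linear_map_jw[of "\<lambda>x. scale (lk (jw A n \<cdot> core a c b \<cdot> (x \<otimes> jw A j))) (tl_id 0)"])
    fix s r y assume i: "i = s + (2 + r)" and y: "y \<in> tl_hom (s + r) i"
    have "(y \<cdot> tcap s r) \<otimes> jw A j = (y \<otimes> jw A j) \<cdot> tcap s (r + j)"
      using tl_ic[OF tcap_in_hom(1)[of s r] tl_generators_in_hom(1)[of j] y jw_in_hom[of A j] refl refl, of A] comp_id(2)[OF jw_in_hom]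
      by (simp add: tcap_tensor)
    moreover have "tl_good (y \<otimes> jw A j)" using tl_good_hom[OF y] by simp
    moreover have "jw A n \<cdot> core a c b \<cdot> (y \<otimes> jw A j) \<in> tl_hom (s + (r + j)) n"
      by (intro tl_comp_in_hom[OF _ jw_in_hom] tl_comp_in_hom[OF _ coreh]) (rule tl_hom_cast[OF tl_tensor_in_hom[OF y jw_in_hom]]; simp)
    ultimately show "scale (lk (jw A n \<cdot> core a c b \<cdot> ((y \<cdot> tcap s r) \<otimes> jw A j))) (tl_id 0) = 0"
      using top[of s "r + j" "jw A n \<cdot> core a c b \<cdot> (y \<otimes> jw A j)"] i by (simp add: comp_assoc)
  qed (intro lin, simp)
  have 2: "lk (jw A n \<cdot> core a c b \<cdot> (tl_id i \<otimes> jw A j)) = lk (jw A n \<cdot> core a c b \<cdot> (tl_id i \<otimes> tl_id j))"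
  proof (rule inj, rule linear_map_jw[of "\<lambda>x. scale (lk (jw A n \<cdot> core a c b \<cdot> (tl_id i \<otimes> x))) (tl_id 0)"])
    fix s r y assume j: "j = s + (2 + r)" and y: "y \<in> tl_hom (s + r) j"
    have "tl_id i \<otimes> (y \<cdot> tcap s r) = (tl_id i \<otimes> y) \<cdot> tcap (i + s) r"
      using ic_id(2)[OF tcap_in_hom(1) y] by (simp add: tcap_tensor)
    moreover have "tl_good (tl_id i \<otimes> y)" using tl_good_hom[OF y] by simp
    moreover have "jw A n \<cdot> core a c b \<cdot> (tl_id i \<otimes> y) \<in> tl_hom (i + s + r) n"
      by (intro tl_comp_in_hom[OF _ jw_in_hom] tl_comp_in_hom[OF _ coreh]) (rule tl_hom_cast[OF tl_tensor_in_hom[OF tl_generators_in_hom(1) y]]; simp)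
    ultimately show "scale (lk (jw A n \<cdot> core a c b \<cdot> (tl_id i \<otimes> (y \<cdot> tcap s r)))) (tl_id 0) = 0"
      using top[of "i + s" r "jw A n \<cdot> core a c b \<cdot> (tl_id i \<otimes> y)"] j by (simp add: comp_assoc)
  qed (intro lin, simp)
  have 3: "lk (jw A n \<cdot> core a c b) = lk (tl_id n \<cdot> core a c b)"
  proof (rule inj, rule linear_map_jw'[of "\<lambda>x. scale (lk (x \<cdot> core a c b)) (tl_id 0)"])
    fix s r y assume n: "n = s + (2 + r)" and y: "y \<in> tl_hom n (s + r)"
    have "(tcup s r \<cdot> y) \<cdot> core a c b = tcup s r \<cdot> y \<cdot> core a c b"
      using tl_good_hom[OF y] by (simp add: comp_assoc)
    then show "scale (lk ((tcup s r \<cdot> y) \<cdot> core a c b)) (tl_id 0) = 0"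
      using bot[OF n tl_comp_in_hom[OF coreh y]] by simp
  qed (intro lin, simp)
  have "mg i j n = jw A n \<cdot> core a c b \<cdot> (jw A i \<otimes> jw A j)" unfolding e merge_eq ..
  moreover have "core a c b \<cdot> (tl_id i \<otimes> tl_id j) = core a c b"
    unfolding tl_tensor_id by (rule comp_id(2)[OF coreh refl])
  ultimately have "lk (mg i j n) = lk (core a c b)"
    using 1 2 3 comp_id(1)[OF coreh refl] by simp
  also have "\<dots> = 1" by (simp add: lk_def core_basis K_def)
  finally show ?thesis by (auto simp: lk_def)
qed

section \<open>Ladders: spanning, orthogonality and expansion\<close>

definition ladder :: "nat \<Rightarrow> nat \<Rightarrow> nat \<Rightarrow> nat \<Rightarrow> nat \<Rightarrow> tl" where
  "ladder i j k l n = sp n k l \<cdot> mg i j n"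

lemma ladder_in_hom [simp, intro]: "ladder i j k l n \<in> tl_hom (i + j) (k + l)"
  unfolding ladder_def by (intro tl_comp_in_hom[OF merge_in_hom split_in_hom])

lemma ladder_absorb: "jw2 k l \<cdot> ladder i j k l n = ladder i j k l n" "ladder i j k l n \<cdot> jw2 i j = ladder i j k l n"
  unfolding ladder_def by (simp_all add: comp_assoc merge_absorb) (simp add: comp_assoc[symmetric] split_absorb)

lemma adj_ladder: "adj (ladder i j k l n) = ladder k l i j n"
  unfolding ladder_def by (simp add: adj_comp[OF merge_in_hom split_in_hom] adj_merge adj_split)

text \<open>Induction on the number \<open>m\<close> of strands at a horizontal cut. Replacing the
  identity on the cut by \<open>jw A m\<close> costs terms with a narrower cut, and with the
  idempotent in place both halves are multiples of 3-vertices by multiplicity one. The initial cut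
  has width \<open>i + j\<close>.\<close>

lemma ladder_span:
  assumes "x \<in> tl_hom (i + j) (k + l)"
  shows "\<exists>c. jw2 k l \<cdot> x \<cdot> jw2 i j = (\<Sum>n | admissible i j n \<and> admissible k l n. scale (c n) (ladder i j k l n))"
proof -
  let ?N = "{n. admissible i j n \<and> admissible k l n}"
  define S where "S = {x. \<exists>c. x = (\<Sum>n\<in>?N. scale (c n) (ladder i j k l n))}"
  have S0: "0 \<in> S" unfolding S_def by (auto intro!: exI[of _ "\<lambda>_. 0"])
  have Sadd: "x + y \<in> S" if x: "x \<in> S" and y: "y \<in> S" for x y
  proof -
    obtain c c' where "x = (\<Sum>n\<in>?N. scale (c n) (ladder i j k l n))" "y = (\<Sum>n\<in>?N. scale (c' n) (ladder i j k l n))"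
      using x y by (auto simp: S_def)
    then show ?thesis unfolding S_def by (auto simp: scale_linear sum.distrib intro!: exI[of _ "\<lambda>n. c n + c' n"])
  qed
  have Sscale: "scale r x \<in> S" if x: "x \<in> S" for x r
  proof -
    obtain c where "x = (\<Sum>n\<in>?N. scale (c n) (ladder i j k l n))" using x by (auto simp: S_def)
    then show ?thesis unfolding S_def by (auto simp: scale_sum intro!: exI[of _ "\<lambda>n. r * c n"])
  qed
  have Sladder: "scale c (ladder i j k l n) \<in> S" for c n
  proof (cases "n \<in> ?N")
    case True
    have eq: "scale c (ladder i j k l n) = (\<Sum>m\<in>?N. scale (if m = n then c else 0) (ladder i j k l m))"
      using True finite_admissible by (simp add: if_distrib[of "\<lambda>c. scale c _"] cong: if_cong)
    show ?thesis unfolding S_def by (rule CollectI, rule exI[of _ "\<lambda>m. if m = n then c else 0"], rule eq)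
  next
    case False
    then have "ladder i j k l n = 0" by (auto simp: ladder_def vertex_merge_def vertex_split_def)
    then show ?thesis using S0 by simp
  qed
  have main: "jw2 k l \<cdot> y \<cdot> z \<cdot> jw2 i j \<in> S" if "y \<in> tl_hom m (k + l)" "z \<in> tl_hom (i + j) m" for m y z
    using that
  proof (induction m arbitrary: y z rule: less_induct)
    case (less m)
    define L where "L x = jw2 k l \<cdot> y \<cdot> x \<cdot> z \<cdot> jw2 i j" for x
    have good [simp]: "tl_good y" "tl_good z" using less.prems tl_good_hom by blast+
    \<comment> \<open>Modulo \<open>S\<close> only the identity coefficient of what sits on the cut
      matters, because other diagrams factor through fewer strands.\<close>
    have Lx: "L x - scale (Poly_Mapping.lookup x (id_diagram m)) (L (tl_id m)) \<in> S" if "x \<in> tl_hom m m" for x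
      using that
    proof (induction x rule: tl_hom_induct)
      case zero
      then show ?case using S0 by (simp add: L_def)
    next
      case (add x x')
      have "L (x + x') - scale (Poly_Mapping.lookup (x + x') (id_diagram m)) (L (tl_id m)) =
        (L x - scale (Poly_Mapping.lookup x (id_diagram m)) (L (tl_id m))) + (L x' - scale (Poly_Mapping.lookup x' (id_diagram m)) (L (tl_id m)))"
        by (simp add: L_def lookup_add scale_linear)
      then show ?case using Sadd add by simp
    next
      case (scale c x)
      have "L (scale c x) - scale (Poly_Mapping.lookup (scale c x) (id_diagram m)) (L (tl_id m)) =
        scale c (L x - scale (Poly_Mapping.lookup x (id_diagram m)) (L (tl_id m)))"
        by (simp add: L_def scale_linear)
      then show ?case using Sscale scale by simp
    next
      case (basis d)
      then show ?case
      proof (cases rule: endo_basis_cases[where A = A])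
        case id
        then show ?thesis using S0 by (simp add: tl_id_def)
      next
        case (top a b y')
        have "L (basis d) = jw2 k l \<cdot> (y \<cdot> y') \<cdot> (tcap a b \<cdot> z) \<cdot> jw2 i j"
          using tl_good_hom[OF top(3)] by (simp add: L_def top(4) comp_assoc)
        also have "\<dots> \<in> S"
          by (rule less.IH[of "a + b"]) (use top less.prems tcap_in_hom(1)[of a b] in \<open>auto intro: tl_comp_in_hom\<close>)
        finally show ?thesis using top(1) by (simp add: lookup_single when_def)
      qed
    qed
    have "L (jw A m) \<in> S"
    proof -
      obtain c where c: "jw2 k l \<cdot> y \<cdot> jw A m = scale c (sp m k l)" using split_span less.prems by blast
      obtain c' where c': "jw A m \<cdot> z \<cdot> jw2 i j = scale c' (mg i j m)" using merge_span less.prems by blast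
      have "L (jw A m) = (jw2 k l \<cdot> y \<cdot> jw A m) \<cdot> jw A m \<cdot> z \<cdot> jw2 i j"
        unfolding L_def by (simp add: comp_assoc jw_idem')
      then have "L (jw A m) = scale (c * c') (ladder i j k l m)" unfolding c c' by (simp add: ladder_def mult.commute)
      then show ?thesis using Sladder by simp
    qed
    moreover have "L (jw A m) - scale 1 (L (tl_id m)) \<in> S" using Lx[OF jw_in_hom[of A m]] by (simp add: lookup_jw)
    ultimately have "L (jw A m) + scale (- 1) (L (jw A m) - scale 1 (L (tl_id m))) \<in> S" using Sadd Sscale by blast
    moreover have "L (jw A m) + scale (- 1) (L (jw A m) - scale 1 (L (tl_id m))) = L (tl_id m)"
      by (rule poly_mapping_eqI) (simp add: lookup_add lookup_minus)
    moreover have "L (tl_id m) = jw2 k l \<cdot> y \<cdot> z \<cdot> jw2 i j"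
      unfolding L_def using comp_id(1)[OF tl_comp_in_hom[OF jw2_in_hom less.prems(2)] refl] by simp
    ultimately show ?case by simp
  qed
  have "jw2 k l \<cdot> x \<cdot> tl_id (i + j) \<cdot> jw2 i j \<in> S" by (rule main) (use assms in auto)
  then show ?thesis using comp_id(1)[OF jw2_in_hom refl] by (simp add: S_def)
qed

text \<open>The scalar to which a bigon reduces; by Schur's lemma the identity coefficient carries
  all the information.\<close>

definition bubble :: "nat \<Rightarrow> nat \<Rightarrow> nat \<Rightarrow> complex" where
  "bubble i j n = Poly_Mapping.lookup (mg i j n \<cdot> sp n i j) (id_diagram n)"

lemma merge_split: "mg i j m \<cdot> sp n i j = (if m = n then scale (bubble i j n) (jw A n) else 0)"
proof -
  have h: "mg i j m \<cdot> sp n i j \<in> tl_hom n m" by (rule tl_comp_in_hom[OF split_in_hom merge_in_hom])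
  have "mg i j m \<cdot> sp n i j = jw A m \<cdot> (mg i j m \<cdot> sp n i j) \<cdot> jw A n"
    by (simp add: comp_assoc split_absorb) (simp add: comp_assoc[symmetric] merge_absorb)
  also have "\<dots> = (if n = m then scale (Poly_Mapping.lookup (mg i j m \<cdot> sp n i j) (id_diagram m)) (jw A m) else 0)"
    by (rule jw_schur[OF h])
  finally show ?thesis by (auto simp: bubble_def)
qed

text \<open>Were the bubble zero, \<open>mg i j m\<close> would annihilate every ladder by Schur's
  lemma, hence also the identity of the two legs, which is a combination of ladders. Then the vertex
  itself would vanish, against \<open>merge_nonzero\<close>.\<close>

lemma bubble_nonzero:
  assumes "admissible i j m"
  shows "bubble i j m \<noteq> 0"
proof
  assume 0: "bubble i j m = 0"
  obtain c where c: "jw2 i j \<cdot> tl_id (i + j) \<cdot> jw2 i j =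
      (\<Sum>n | admissible i j n \<and> admissible i j n. scale (c n) (ladder i j i j n))"
    using ladder_span[OF tl_generators_in_hom(1)] by blast
  have "mg i j m \<cdot> ladder i j i j n = 0" for n
  proof -
    have "mg i j m \<cdot> ladder i j i j n = (mg i j m \<cdot> sp n i j) \<cdot> mg i j n"
      by (simp add: ladder_def comp_assoc)
    then show ?thesis using 0 by (cases "m = n") (simp_all add: merge_split)
  qed
  moreover have "mg i j m = mg i j m \<cdot> jw2 i j \<cdot> tl_id (i + j) \<cdot> jw2 i j"
    using comp_id(1)[OF jw2_in_hom refl] by (simp add: jw2_idem merge_absorb)
  ultimately have "mg i j m = 0" unfolding c by simp
  then show False using merge_nonzero[OF assms] by simp
qed

text \<open>The theta graph is a bubble on a loop labelled \<open>n\<close>; sliding leaves a single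
  idempotent on that loop, whose trace is \<open>Delta A n\<close>.\<close>

lemma theta_bubble: "theta A i j n = bubble i j n * Delta A n"
proof -
  have "theta A i j n = tl_value ((tl_cap n \<cdot> jw2 n n) \<cdot> (scale (bubble i j n) (jw A n) \<otimes> jw A n) \<cdot> jw2 n n \<cdot> tl_cup n)"
    unfolding theta_def arc_top_def arc_bot_def jones_wenzl_eq merge_split by simp
  also have "\<dots> = bubble i j n * tl_value (tl_cap n \<cdot> jw2 n n \<cdot> tl_cup n)"
    by (simp add: comp_assoc jw2_idem')
  also have "tl_cap n \<cdot> jw2 n n \<cdot> tl_cup n = tl_cap n \<cdot> (jw A n \<otimes> tl_id n) \<cdot> tl_cup n"
    unfolding jw_slide ..
  also have "tl_value \<dots> = Delta A n" using jw_trace unfolding tl_trace_def .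
  finally show ?thesis .
qed

lemma theta_nonzero: "admissible i j n \<Longrightarrow> theta A i j n \<noteq> 0"
  using bubble_nonzero Delta_nonzero by (simp add: theta_bubble)

text \<open>The inner vertices form a bubble, which is diagonal by Schur's lemma; cyclicity of the
  trace brings the outer ones together to a second bubble on a loop. Each \<open>theta\<close>
  contains a factor \<open>Delta A n\<close> but there is one loop only, whence the
  division.\<close>

lemma ladder_gram:
  "tl_trace A (i + j) (adj (ladder i j k l m) \<cdot> ladder i j k l n) =
     (if m = n then theta A i j n * theta A k l n / Delta A n else 0)"
proof -
  have "adj (ladder i j k l m) \<cdot> ladder i j k l n = sp m i j \<cdot> (mg k l m \<cdot> sp n k l) \<cdot> mg i j n"
    unfolding adj_ladder by (simp add: ladder_def comp_assoc)
  also have "\<dots> = (if m = n then scale (bubble k l n) (sp n i j \<cdot> mg i j n) else 0)"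
    unfolding merge_split by (simp add: merge_absorb)
  finally have "tl_trace A (i + j) (adj (ladder i j k l m) \<cdot> ladder i j k l n) =
      (if m = n then bubble k l n * tl_trace A (i + j) (sp n i j \<cdot> mg i j n) else 0)" by simp
  also have "tl_trace A (i + j) (sp n i j \<cdot> mg i j n) = tl_trace A n (mg i j n \<cdot> sp n i j)"
    by (rule tl_trace_cyclic[OF merge_in_hom split_in_hom])
  also have "\<dots> = bubble i j n * Delta A n" by (simp add: merge_split jw_trace)
  finally show ?thesis using Delta_nonzero by (simp add: theta_bubble)
qed

definition norm2 :: "nat \<Rightarrow> nat \<Rightarrow> nat \<Rightarrow> nat \<Rightarrow> nat \<Rightarrow> complex" where
  "norm2 i j k l n = theta A i j n * theta A k l n / Delta A n"

text \<open>Coefficients with respect to an orthogonal basis. The assumption \<open>absorb\<close>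
  says that \<open>x\<close> is a morphism between the objects cut out by the idempotents.\<close>

lemma ladder_expansion:
  assumes x: "x \<in> tl_hom (i + j) (k + l)" and absorb: "jw2 k l \<cdot> x \<cdot> jw2 i j = x"
  shows "x = (\<Sum>n | admissible i j n \<and> admissible k l n.
     scale (tl_trace A (i + j) (adj (ladder i j k l n) \<cdot> x) / norm2 i j k l n) (ladder i j k l n))"
proof -
  let ?N = "{n. admissible i j n \<and> admissible k l n}"
  obtain c where c: "x = (\<Sum>n\<in>?N. scale (c n) (ladder i j k l n))"
    using ladder_span[OF x] absorb by metis
  have "tl_trace A (i + j) (adj (ladder i j k l n) \<cdot> x) / norm2 i j k l n = c n" if n: "n \<in> ?N" for n
  proof -
    have "tl_trace A (i + j) (adj (ladder i j k l n) \<cdot> x) = (\<Sum>m\<in>?N. c m * (if n = m then norm2 i j k l m else 0))"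
      unfolding c by (auto simp: ladder_gram norm2_def intro!: sum.cong)
    also have "\<dots> = c n * norm2 i j k l n" using n finite_admissible by (simp add: if_distrib cong: if_cong)
    finally show ?thesis using n theta_nonzero Delta_nonzero by (simp add: norm2_def)
  qed
  then show ?thesis by (subst (1) c) (rule sum.cong; simp)
qed

end

section \<open>Rotation\<close>

context generic_parameter
begin

section \<open>Idempotents passing cups and caps\<close>

lemma cap2_in_hom: "tl_cap j \<in> tl_hom (j + j) 0" and cup2_in_hom: "tl_cup j \<in> tl_hom 0 (j + j)"
  using tl_generators_in_hom(2,3)[of j] by (simp_all add: mult_2)

lemma rot_in_hom [intro]:
  "x \<in> tl_hom (k + i) (l + j) \<Longrightarrow> tl_rot A i j k l x \<in> tl_hom (i + j) (k + l)"
  "x \<in> tl_hom (i + j) (k + l) \<Longrightarrow> tl_rot' A i j k l x \<in> tl_hom (k + i) (l + j)"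
proof -
  note id = tl_generators_in_hom(1)
  have mid: "tl_id k \<otimes> x \<otimes> tl_id j \<in> tl_hom (k + (m + j)) (k + (n + j))" if "x \<in> tl_hom m n" for m n
    by (intro tl_tensor_in_hom id that)
  have "tl_cup k \<otimes> tl_id (i + j) \<in> tl_hom (i + j) (k + (k + i + j))" "tl_id (k + l) \<otimes> tl_cap j \<in> tl_hom (k + (l + j + j)) (k + l)"
    using tl_tensor_in_hom[OF cup2_in_hom[of k] id[of "i + j"]] tl_tensor_in_hom[OF id[of "k + l"] cap2_in_hom[of j]]
    by (simp_all add: add.assoc)
  then show "tl_rot A i j k l x \<in> tl_hom (i + j) (k + l)" if "x \<in> tl_hom (k + i) (l + j)"
    unfolding tl_rot_def using mid[OF that] by blast
  have "tl_id (k + i) \<otimes> tl_cup j \<in> tl_hom (k + i) (k + (i + j + j))" "tl_cap k \<otimes> tl_id (l + j) \<in> tl_hom (k + (k + l + j)) (l + j)"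
    using tl_tensor_in_hom[OF id[of "k + i"] cup2_in_hom[of j]] tl_tensor_in_hom[OF cap2_in_hom[of k] id[of "l + j"]]
    by (simp_all add: add.assoc)
  then show "tl_rot' A i j k l x \<in> tl_hom (k + i) (l + j)" if "x \<in> tl_hom (i + j) (k + l)"
    unfolding tl_rot'_def using mid[OF that] by blast
qed

lemma cap_slide: "tl_cap k \<cdot> jw2 k k = tl_cap k \<cdot> (tl_id k \<otimes> jw A k)"
proof -
  have j: "tl_id k \<otimes> jw A k \<in> tl_hom (k + k) (k + k)" by (intro tl_tensor_in_hom jw_in_hom tl_generators_in_hom)
  show ?thesis
    using arg_cong[OF jw_slide(2)[of k], of adj]
    by (simp add: adj_comp[OF cup2_in_hom jw2_in_hom] adj_comp[OF cup2_in_hom j] adj_tensor[OF tl_generators_in_hom(1) jw_in_hom])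
qed

lemma ic3:
  assumes "x \<in> tl_hom m1 n1" "y \<in> tl_hom m2 n2" "z \<in> tl_hom m3 n3"
    "x' \<in> tl_hom n1 k1" "y' \<in> tl_hom n2 k2" "z' \<in> tl_hom n3 k3"
  shows "(x' \<otimes> y' \<otimes> z') \<cdot> (x \<otimes> y \<otimes> z) = (x' \<cdot> x) \<otimes> (y' \<cdot> y) \<otimes> (z' \<cdot> z)"
  using tl_interchange[OF assms(1) tl_tensor_in_hom[OF assms(2,3)] assms(4) tl_tensor_in_hom[OF assms(5,6)], of A]
    tl_interchange[OF assms(2,3,5,6), of A] by simp

lemma cup_layer: "z \<in> tl_hom (k + k) m \<Longrightarrow> w \<in> tl_hom n p \<Longrightarrow>
    (z \<otimes> w) \<cdot> (tl_cup k \<otimes> tl_id n) = (z \<cdot> tl_cup k) \<otimes> w"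
  "z \<in> tl_hom (k + k) m \<Longrightarrow> w \<in> tl_hom n p \<Longrightarrow>
    (w \<otimes> z) \<cdot> (tl_id n \<otimes> tl_cup k) = w \<otimes> (z \<cdot> tl_cup k)"
  by (subst tl_interchange[OF cup2_in_hom tl_generators_in_hom(1)]; simp add: comp_id(2)[OF _ refl])
    (subst tl_interchange[OF tl_generators_in_hom(1) cup2_in_hom]; simp add: comp_id(2)[OF _ refl])

lemma cap_layer: "z \<in> tl_hom m (k + k) \<Longrightarrow> w \<in> tl_hom p n \<Longrightarrow>
    (tl_cap k \<otimes> tl_id n) \<cdot> (z \<otimes> w) = (tl_cap k \<cdot> z) \<otimes> w"
  "z \<in> tl_hom m (k + k) \<Longrightarrow> w \<in> tl_hom p n \<Longrightarrow>
    (tl_id n \<otimes> tl_cap k) \<cdot> (w \<otimes> z) = w \<otimes> (tl_cap k \<cdot> z)"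
  by (subst tl_interchange[OF _ _ cap2_in_hom tl_generators_in_hom(1)]; simp add: comp_id(1)[OF _ refl])
    (subst tl_interchange[OF _ _ tl_generators_in_hom(1) cap2_in_hom]; simp add: comp_id(1)[OF _ refl])

lemma cup_natural:
  assumes w: "w \<in> tl_hom n p"
  shows "(tl_cup k \<otimes> tl_id p) \<cdot> w = (tl_id (k + k) \<otimes> w) \<cdot> (tl_cup k \<otimes> tl_id n)"
    "(tl_id p \<otimes> tl_cup k) \<cdot> w = (w \<otimes> tl_id (k + k)) \<cdot> (tl_id n \<otimes> tl_cup k)"
proof -
  have "(tl_cup k \<otimes> tl_id p) \<cdot> (tl_id 0 \<otimes> w) = (tl_cup k \<cdot> tl_id 0) \<otimes> (tl_id p \<cdot> w)"
    by (rule tl_interchange[OF tl_generators_in_hom(1) w cup2_in_hom tl_generators_in_hom(1)])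
  then show "(tl_cup k \<otimes> tl_id p) \<cdot> w = (tl_id (k + k) \<otimes> w) \<cdot> (tl_cup k \<otimes> tl_id n)"
    unfolding cup_layer(1)[OF tl_generators_in_hom(1) w]
    using tl_tensor_id_0(1)[OF w] comp_id[OF cup2_in_hom refl] comp_id[OF w refl] by simp
  have "(tl_id p \<otimes> tl_cup k) \<cdot> (w \<otimes> tl_id 0) = (tl_id p \<cdot> w) \<otimes> (tl_cup k \<cdot> tl_id 0)"
    by (rule tl_interchange[OF w tl_generators_in_hom(1) tl_generators_in_hom(1) cup2_in_hom])
  then show "(tl_id p \<otimes> tl_cup k) \<cdot> w = (w \<otimes> tl_id (k + k)) \<cdot> (tl_id n \<otimes> tl_cup k)"
    unfolding cup_layer(2)[OF tl_generators_in_hom(1) w]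
    using tl_tensor_id_0(2)[OF w] comp_id[OF cup2_in_hom refl] comp_id[OF w refl] by simp
qed

lemma cap_natural:
  assumes w: "w \<in> tl_hom n p"
  shows "w \<cdot> (tl_cap k \<otimes> tl_id n) = (tl_cap k \<otimes> tl_id p) \<cdot> (tl_id (k + k) \<otimes> w)"
    "w \<cdot> (tl_id n \<otimes> tl_cap k) = (tl_id p \<otimes> tl_cap k) \<cdot> (w \<otimes> tl_id (k + k))"
proof -
  have "(tl_id 0 \<otimes> w) \<cdot> (tl_cap k \<otimes> tl_id n) = (tl_id 0 \<cdot> tl_cap k) \<otimes> (w \<cdot> tl_id n)"
    by (rule tl_interchange[OF cap2_in_hom tl_generators_in_hom(1) tl_generators_in_hom(1) w])
  then show "w \<cdot> (tl_cap k \<otimes> tl_id n) = (tl_cap k \<otimes> tl_id p) \<cdot> (tl_id (k + k) \<otimes> w)"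
    unfolding cap_layer(1)[OF tl_generators_in_hom(1) w]
    using tl_tensor_id_0(1)[OF w] comp_id[OF cap2_in_hom refl] comp_id[OF w refl] by simp
  have "(w \<otimes> tl_id 0) \<cdot> (tl_id n \<otimes> tl_cap k) = (w \<cdot> tl_id n) \<otimes> (tl_id 0 \<cdot> tl_cap k)"
    by (rule tl_interchange[OF tl_generators_in_hom(1) cap2_in_hom w tl_generators_in_hom(1)])
  then show "w \<cdot> (tl_id n \<otimes> tl_cap k) = (tl_id p \<otimes> tl_cap k) \<cdot> (w \<otimes> tl_id (k + k))"
    unfolding cap_layer(2)[OF tl_generators_in_hom(1) w]
    using tl_tensor_id_0(2)[OF w] comp_id[OF cap2_in_hom refl] comp_id[OF w refl] by simp
qed

lemma jw2_absorb:
  assumes "jw2 i j \<cdot> x = x" "tl_good x"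
  shows "(jw A i \<otimes> tl_id j) \<cdot> x = x" "(tl_id i \<otimes> jw A j) \<cdot> x = x"
proof -
  have "(jw A i \<otimes> tl_id j) \<cdot> jw2 i j = jw2 i j" "(tl_id i \<otimes> jw A j) \<cdot> jw2 i j = jw2 i j"
    using tl_interchange[OF jw_in_hom[of A i] jw_in_hom[of A j] jw_in_hom[of A i] tl_generators_in_hom(1)[of j], of A]
      tl_interchange[OF jw_in_hom[of A i] jw_in_hom[of A j] tl_generators_in_hom(1)[of i] jw_in_hom[of A j], of A]
      jw_idem comp_id(1)[OF jw_in_hom refl] by simp_all
  then show "(jw A i \<otimes> tl_id j) \<cdot> x = x" "(tl_id i \<otimes> jw A j) \<cdot> x = x"
    using assms by (metis comp_assoc jw_good tl_good_generators(1) tl_good_tensor)+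
qed

lemma jw2_absorb':
  assumes "x \<cdot> jw2 i j = x" "tl_good x"
  shows "x \<cdot> (jw A i \<otimes> tl_id j) = x" "x \<cdot> (tl_id i \<otimes> jw A j) = x"
proof -
  have "jw2 i j \<cdot> (jw A i \<otimes> tl_id j) = jw2 i j" "jw2 i j \<cdot> (tl_id i \<otimes> jw A j) = jw2 i j"
    using tl_interchange[OF jw_in_hom[of A i] tl_generators_in_hom(1)[of j] jw_in_hom[of A i] jw_in_hom[of A j], of A]
      tl_interchange[OF tl_generators_in_hom(1)[of i] jw_in_hom[of A j] jw_in_hom[of A i] jw_in_hom[of A j], of A]
      jw_idem comp_id(2)[OF jw_in_hom refl] by simp_all
  then show "x \<cdot> (jw A i \<otimes> tl_id j) = x" "x \<cdot> (tl_id i \<otimes> jw A j) = x"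
    using assms by (metis comp_assoc jw_good tl_good_generators(1) tl_good_tensor)+
qed

lemma half_jw_in_hom: "jw A i \<otimes> tl_id j \<in> tl_hom (i + j) (i + j)" "tl_id i \<otimes> jw A j \<in> tl_hom (i + j) (i + j)"
  by (intro tl_tensor_in_hom jw_in_hom tl_generators_in_hom)+

text \<open>Morphisms of the idempotent completion between products of two labelled objects, seen in
  one of the two tensor factors.\<close>

definition balanced_mor :: "nat \<Rightarrow> nat \<Rightarrow> nat \<Rightarrow> nat \<Rightarrow> tl \<Rightarrow> bool" where
  "balanced_mor i j k l x \<longleftrightarrow> x \<in> tl_hom (i + j) (k + l) \<and> jw2 k l \<cdot> x = x \<and> x \<cdot> jw2 i j = x"

lemma ladder_mor: "balanced_mor i j k l (ladder i j k l n)"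
  by (simp add: balanced_mor_def ladder_absorb ladder_in_hom)

text \<open>The left-hand side is one tensor factor of the composite in the theorem. Both sides
  reduce to a layer in which \<open>x\<close> is flanked by \<open>jw A k\<close> and
  \<open>jw A j\<close>, between a bare cup and a bare cap: on the left the middle layer absorbs the
  idempotents of the other two, on the right the outer idempotents travel inwards.\<close>

lemma rot_sandwich:
  assumes x: "balanced_mor k i l j x"
  shows "(jw A k \<otimes> jw A l \<otimes> (tl_cap j \<cdot> jw2 j j)) \<cdot> (jw A k \<otimes> x \<otimes> jw A j) \<cdot>
      ((jw2 k k \<cdot> tl_cup k) \<otimes> jw A i \<otimes> jw A j) =
    jw2 k l \<cdot> tl_rot A i j k l x \<cdot> jw2 i j"
proof -
  have xh: "x \<in> tl_hom (k + i) (l + j)" and xa: "jw2 l j \<cdot> x = x" "x \<cdot> jw2 k i = x"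
    using x by (auto simp: balanced_mor_def)
  have g [simp]: "tl_good x" using tl_good_hom xh .
  note id = tl_generators_in_hom(1)
  let ?P = "tl_id (k + l) \<otimes> tl_cap j" and ?Q = "tl_cup k \<otimes> tl_id (i + j)"
  have bot: "jw A k \<otimes> jw A l \<otimes> (tl_cap j \<cdot> jw2 j j) = ?P \<cdot> (jw A k \<otimes> jw2 l j \<otimes> jw A j)"
    using cap_layer(2)[OF jw2_in_hom[of j j] jw2_in_hom[of k l]] by (simp add: tensor_assoc)
  have top: "(jw2 k k \<cdot> tl_cup k) \<otimes> jw A i \<otimes> jw A j = (jw A k \<otimes> jw2 k i \<otimes> jw A j) \<cdot> ?Q"
    using cup_layer(1)[OF jw2_in_hom[of k k] jw2_in_hom[of i j]] by (simp add: tensor_assoc)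
  have "(jw A k \<otimes> x \<otimes> jw A j) \<cdot> (jw A k \<otimes> jw2 k i \<otimes> jw A j) = jw A k \<otimes> x \<otimes> jw A j"
    using ic3[OF jw_in_hom[of A k] jw2_in_hom[of k i] jw_in_hom[of A j] jw_in_hom[of A k] xh jw_in_hom[of A j]] by (simp add: jw_idem xa)
  moreover have "(jw A k \<otimes> jw2 l j \<otimes> jw A j) \<cdot> (jw A k \<otimes> x \<otimes> jw A j) = jw A k \<otimes> x \<otimes> jw A j"
    using ic3[OF jw_in_hom[of A k] xh jw_in_hom[of A j] jw_in_hom[of A k] jw2_in_hom[of l j] jw_in_hom[of A j]] by (simp add: jw_idem xa)
  ultimately have L: "(?P \<cdot> (jw A k \<otimes> jw2 l j \<otimes> jw A j)) \<cdot> (jw A k \<otimes> x \<otimes> jw A j) \<cdot> ((jw A k \<otimes> jw2 k i \<otimes> jw A j) \<cdot> ?Q) =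
      ?P \<cdot> (jw A k \<otimes> x \<otimes> jw A j) \<cdot> ?Q"
    by (simp add: comp_assoc) (simp add: comp_assoc [symmetric])
  have P: "jw2 k l \<cdot> ?P = ?P \<cdot> (jw A k \<otimes> (jw A l \<otimes> tl_id j) \<otimes> tl_id j)"
    using cap_natural(2)[OF jw2_in_hom[of k l], of j] by (simp add: tensor_assoc tl_tensor_id)
  have Q: "?Q \<cdot> jw2 i j = (tl_id k \<otimes> (tl_id k \<otimes> jw A i) \<otimes> jw A j) \<cdot> ?Q"
    using cup_natural(1)[OF jw2_in_hom[of i j], of k] by (simp add: tensor_assoc tl_tensor_id [symmetric])
  have 1: "(tl_id k \<otimes> x \<otimes> tl_id j) \<cdot> (tl_id k \<otimes> (tl_id k \<otimes> jw A i) \<otimes> jw A j) = tl_id k \<otimes> x \<otimes> jw A j"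
    using ic3[OF id[of k] half_jw_in_hom(2)[of k i] jw_in_hom[of A j] id[of k] xh id[of j]]
    by (simp add: comp_id(1)[OF id refl] comp_id(1)[OF jw_in_hom refl] jw2_absorb'[OF xa(2)])
  have 2: "(jw A k \<otimes> (jw A l \<otimes> tl_id j) \<otimes> tl_id j) \<cdot> (tl_id k \<otimes> x \<otimes> jw A j) = jw A k \<otimes> x \<otimes> jw A j"
    using ic3[OF id[of k] xh jw_in_hom[of A j] jw_in_hom[of A k] half_jw_in_hom(1)[of l j] id[of j]]
    by (simp add: comp_id(2)[OF jw_in_hom refl] comp_id(1)[OF jw_in_hom refl] jw2_absorb[OF xa(1)])
  have "jw2 k l \<cdot> tl_rot A i j k l x \<cdot> jw2 i j =
      (jw2 k l \<cdot> ?P) \<cdot> (tl_id k \<otimes> x \<otimes> tl_id j) \<cdot> (?Q \<cdot> jw2 i j)"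
    by (simp add: tl_rot_def comp_assoc)
  also have "\<dots> = ?P \<cdot> ((jw A k \<otimes> (jw A l \<otimes> tl_id j) \<otimes> tl_id j) \<cdot>
      ((tl_id k \<otimes> x \<otimes> tl_id j) \<cdot> (tl_id k \<otimes> (tl_id k \<otimes> jw A i) \<otimes> jw A j))) \<cdot> ?Q"
    unfolding P Q by (simp add: comp_assoc)
  also have "\<dots> = ?P \<cdot> (jw A k \<otimes> x \<otimes> jw A j) \<cdot> ?Q"
    unfolding 1 2 ..
  finally show ?thesis unfolding bot top L ..
qed

text \<open>The idempotents that \<open>x\<close> carries on the bent legs can be duplicated and
  moved around the cup and the cap to the new outer ends. So the bare rotation
  \<open>tl_rot'\<close> already stays inside the idempotent completion.\<close>

lemma rot'_mor:
  assumes x: "balanced_mor i j k l x"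
  shows "balanced_mor k i l j (tl_rot' A i j k l x)"
proof -
  have xh: "x \<in> tl_hom (i + j) (k + l)" and xa: "jw2 k l \<cdot> x = x" "x \<cdot> jw2 i j = x"
    using x by (auto simp: balanced_mor_def)
  have g [simp]: "tl_good x" using tl_good_hom xh .
  note id = tl_generators_in_hom(1)
  let ?P = "tl_cap k \<otimes> tl_id (l + j)" and ?Q = "tl_id (k + i) \<otimes> tl_cup j"
  let ?r = "tl_rot' A i j k l x"
  have rh: "?r \<in> tl_hom (k + i) (l + j)" using xh by (rule rot_in_hom(2))
  have P: "jw2 l j \<cdot> ?P = ?P \<cdot> (tl_id k \<otimes> (tl_id k \<otimes> jw A l) \<otimes> jw A j)"
    using cap_natural(1)[OF jw2_in_hom[of l j], of k] by (simp add: tensor_assoc tl_tensor_id [symmetric])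
  have Q: "?Q \<cdot> jw2 k i = (jw A k \<otimes> (jw A i \<otimes> tl_id j) \<otimes> tl_id j) \<cdot> ?Q"
    using cup_natural(2)[OF jw2_in_hom[of k i], of j] by (simp add: tensor_assoc tl_tensor_id)
  have P': "?P \<cdot> (jw A k \<otimes> (jw A k \<otimes> tl_id l) \<otimes> tl_id j) = ?P \<cdot> (tl_id k \<otimes> (jw A k \<otimes> tl_id l) \<otimes> tl_id j)"
    using cap_layer(1)[OF jw2_in_hom[of k k] id[of "l + j"]] cap_layer(1)[OF half_jw_in_hom(2)[of k k] id[of "l + j"]]
    by (simp add: tensor_assoc tl_tensor_id [symmetric] cap_slide)
  have Q': "(tl_id k \<otimes> (tl_id i \<otimes> jw A j) \<otimes> jw A j) \<cdot> ?Q = (tl_id k \<otimes> (tl_id i \<otimes> jw A j) \<otimes> tl_id j) \<cdot> ?Q"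
    using cup_layer(2)[OF jw2_in_hom[of j j] id[of "k + i"]] cup_layer(2)[OF half_jw_in_hom(1)[of j j] id[of "k + i"]]
    by (simp add: tensor_assoc tl_tensor_id [symmetric] jw_slide(1))
  \<comment> \<open>Idempotents may be placed on the free ends of the bends: \<open>x\<close>
    supplies others on its own legs, and of two idempotents facing each other across a bend one can
    be erased.\<close>
  have mid: "?P \<cdot> (jw A k \<otimes> x \<otimes> jw A j) \<cdot> ?Q = ?r"
  proof -
    have "(tl_id k \<otimes> x \<otimes> tl_id j) \<cdot> (tl_id k \<otimes> (tl_id i \<otimes> jw A j) \<otimes> jw A j) = tl_id k \<otimes> x \<otimes> jw A j"
      using ic3[OF id[of k] half_jw_in_hom(2)[of i j] jw_in_hom[of A j] id[of k] xh id[of j]]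
      by (simp add: comp_id(1)[OF id refl] comp_id(1)[OF jw_in_hom refl] jw2_absorb'[OF xa(2)])
    moreover have "(jw A k \<otimes> (jw A k \<otimes> tl_id l) \<otimes> tl_id j) \<cdot> (tl_id k \<otimes> x \<otimes> jw A j) = jw A k \<otimes> x \<otimes> jw A j"
      using ic3[OF id[of k] xh jw_in_hom[of A j] jw_in_hom[of A k] half_jw_in_hom(1)[of k l] id[of j]]
      by (simp add: comp_id(2)[OF jw_in_hom refl] comp_id(1)[OF jw_in_hom refl] jw2_absorb[OF xa(1)])
    ultimately have "?P \<cdot> (jw A k \<otimes> x \<otimes> jw A j) \<cdot> ?Q =
        (?P \<cdot> (jw A k \<otimes> (jw A k \<otimes> tl_id l) \<otimes> tl_id j)) \<cdot> (tl_id k \<otimes> x \<otimes> tl_id j) \<cdot>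
          ((tl_id k \<otimes> (tl_id i \<otimes> jw A j) \<otimes> jw A j) \<cdot> ?Q)"
      by (simp add: comp_assoc) (simp add: comp_assoc [symmetric])
    also have "\<dots> = ?P \<cdot> ((tl_id k \<otimes> (jw A k \<otimes> tl_id l) \<otimes> tl_id j) \<cdot> ((tl_id k \<otimes> x \<otimes> tl_id j) \<cdot>
          (tl_id k \<otimes> (tl_id i \<otimes> jw A j) \<otimes> tl_id j))) \<cdot> ?Q"
      unfolding P' Q' by (simp add: comp_assoc)
    also have "(tl_id k \<otimes> x \<otimes> tl_id j) \<cdot> (tl_id k \<otimes> (tl_id i \<otimes> jw A j) \<otimes> tl_id j) = tl_id k \<otimes> x \<otimes> tl_id j"
      using ic3[OF id[of k] half_jw_in_hom(2)[of i j] id[of j] id[of k] xh id[of j]]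
      by (simp add: comp_id(1)[OF id refl] jw2_absorb'[OF xa(2)])
    also have "(tl_id k \<otimes> (jw A k \<otimes> tl_id l) \<otimes> tl_id j) \<cdot> (tl_id k \<otimes> x \<otimes> tl_id j) = tl_id k \<otimes> x \<otimes> tl_id j"
      using ic3[OF id[of k] xh id[of j] id[of k] half_jw_in_hom(1)[of k l] id[of j]]
      by (simp add: comp_id(2)[OF id refl] jw2_absorb[OF xa(1)])
    finally show ?thesis unfolding tl_rot'_def .
  qed
  have absorb: "jw2 l j \<cdot> ?r \<cdot> jw2 k i = ?r"
  proof -
    have 1: "(tl_id k \<otimes> x \<otimes> tl_id j) \<cdot> (jw A k \<otimes> (jw A i \<otimes> tl_id j) \<otimes> tl_id j) = jw A k \<otimes> x \<otimes> tl_id j"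
      using ic3[OF jw_in_hom[of A k] half_jw_in_hom(1)[of i j] id[of j] id[of k] xh id[of j]]
      by (simp add: comp_id(1)[OF id refl] comp_id(1)[OF jw_in_hom refl] jw2_absorb'[OF xa(2)])
    have 2: "(tl_id k \<otimes> (tl_id k \<otimes> jw A l) \<otimes> jw A j) \<cdot> (jw A k \<otimes> x \<otimes> tl_id j) = jw A k \<otimes> x \<otimes> jw A j"
      using ic3[OF jw_in_hom[of A k] xh id[of j] id[of k] half_jw_in_hom(2)[of k l] jw_in_hom[of A j]]
      by (simp add: comp_id(2)[OF jw_in_hom refl] comp_id(1)[OF jw_in_hom refl] jw2_absorb[OF xa(1)])
    have "jw2 l j \<cdot> ?r \<cdot> jw2 k i = (jw2 l j \<cdot> ?P) \<cdot> (tl_id k \<otimes> x \<otimes> tl_id j) \<cdot> (?Q \<cdot> jw2 k i)"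
      by (simp add: tl_rot'_def comp_assoc)
    also have "\<dots> = ?P \<cdot> ((tl_id k \<otimes> (tl_id k \<otimes> jw A l) \<otimes> jw A j) \<cdot>
        ((tl_id k \<otimes> x \<otimes> tl_id j) \<cdot> (jw A k \<otimes> (jw A i \<otimes> tl_id j) \<otimes> tl_id j))) \<cdot> ?Q"
      unfolding P Q by (simp add: comp_assoc)
    also have "\<dots> = ?r" unfolding 1 2 by (rule mid)
    finally show ?thesis .
  qed
  have gr: "tl_good ?r" using tl_good_hom rh .
  have "jw2 l j \<cdot> ?r = ?r" using absorb gr by (metis comp_assoc jw2_idem' jw_good tl_good_comp tl_good_tensor)
  moreover have "?r \<cdot> jw2 k i = ?r"
    using absorb gr by (metis comp_assoc jw2_idem jw_good tl_good_comp tl_good_tensor)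
  ultimately show ?thesis using rh by (simp add: balanced_mor_def)
qed

section \<open>Matrix of the rotation in the ladder bases\<close>

definition rotated :: "nat \<Rightarrow> nat \<Rightarrow> nat \<Rightarrow> nat \<Rightarrow> tl \<Rightarrow> tl" where
  "rotated i j k l x = jw2 k l \<cdot> tl_rot A i j k l x \<cdot> jw2 i j"

text \<open>Pairing a rotated ladder with a ladder closes up to a tetrahedral network; up to
  normalisation this is a 6j symbol.\<close>

definition tet :: "nat \<Rightarrow> nat \<Rightarrow> nat \<Rightarrow> nat \<Rightarrow> nat \<Rightarrow> nat \<Rightarrow> complex" where
  "tet i j k l n m = tl_trace A (i + j) (adj (ladder i j k l m) \<cdot> rotated i j k l (ladder k i l j n))"

lemma rotated_in_hom: "x \<in> tl_hom (k + i) (l + j) \<Longrightarrow> rotated i j k l x \<in> tl_hom (i + j) (k + l)"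
  unfolding rotated_def by (intro tl_comp_in_hom[OF _ jw2_in_hom] tl_comp_in_hom[OF jw2_in_hom] rot_in_hom)

lemma rotated_expansion:
  "rotated i j k l (ladder k i l j n) =
    (\<Sum>m | admissible i j m \<and> admissible k l m. scale (tet i j k l n m / norm2 i j k l m) (ladder i j k l m))"
  unfolding tet_def
proof (rule ladder_expansion)
  show "rotated i j k l (ladder k i l j n) \<in> tl_hom (i + j) (k + l)" by (intro rotated_in_hom ladder_in_hom)
  have "tl_good (tl_rot A i j k l (ladder k i l j n))" using tl_good_hom rot_in_hom(1) ladder_in_hom by blast
  then show "jw2 k l \<cdot> rotated i j k l (ladder k i l j n) \<cdot> jw2 i j = rotated i j k l (ladder k i l j n)"
    unfolding rotated_def by (simp add: comp_assoc jw2_idem jw2_idem')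
qed

text \<open>Reflecting the tetrahedron in the plane does not change its value.\<close>

lemma tet_eq: "tet i j k l n m = tl_trace A (k + i) (adj (ladder k i l j n) \<cdot> tl_rot' A i j k l (ladder i j k l m))"
proof -
  let ?D = "ladder i j k l m" and ?R = "tl_rot A i j k l (ladder k i l j n)"
  have R: "?R \<in> tl_hom (i + j) (k + l)" by (intro rot_in_hom ladder_in_hom)
  have aD: "adj ?D \<in> tl_hom (k + l) (i + j)" by (intro adj_in_hom ladder_in_hom)
  have g: "tl_good ?R" "tl_good (adj ?D)" using tl_good_hom R aD by blast+
  have ab: "adj ?D \<cdot> jw2 k l = adj ?D" "jw2 i j \<cdot> adj ?D = adj ?D" by (simp_all add: adj_ladder ladder_absorb)
  \<comment> \<open>The outer idempotents of \<open>rotated\<close> disappear into the ladder, those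
    below it directly and those above it after a cyclic move under the trace.\<close>
  have "adj ?D \<cdot> rotated i j k l (ladder k i l j n) = (adj ?D \<cdot> ?R) \<cdot> jw2 i j"
  proof -
    have "adj ?D \<cdot> rotated i j k l (ladder k i l j n) = (adj ?D \<cdot> jw2 k l) \<cdot> ?R \<cdot> jw2 i j"
      using g by (simp add: rotated_def comp_assoc)
    then show ?thesis using g by (simp add: ab comp_assoc)
  qed
  then have "tet i j k l n m = tl_trace A (i + j) (jw2 i j \<cdot> adj ?D \<cdot> ?R)"
    unfolding tet_def using tl_trace_cyclic[OF jw2_in_hom tl_comp_in_hom[OF R aD]] by simp
  also have "jw2 i j \<cdot> adj ?D \<cdot> ?R = adj ?D \<cdot> ?R"
    using g ab by (simp add: comp_assoc [symmetric])
  also have "tl_trace A (i + j) (adj ?D \<cdot> ?R) = tl_trace A (i + j) (adj (adj ?D \<cdot> ?R))"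
    by (rule tl_trace_adj [symmetric]) (rule tl_comp_in_hom[OF R aD])
  also have "adj (adj ?D \<cdot> ?R) = adj ?R \<cdot> ?D"
    by (simp add: adj_comp[OF R aD] adj_adj[OF ladder_in_hom])
  also have "tl_trace A (i + j) (adj ?R \<cdot> ?D) = tl_trace A (k + i) (adj (ladder k i l j n) \<cdot> tl_rot' A i j k l ?D)"
    by (rule tl_trace_rot) (intro ladder_in_hom)+
  finally show ?thesis .
qed

text \<open>By \<open>tet_eq\<close> the ladder \<open>m\<close> rotated backwards expands in the
  old ladders with coefficients \<open>tet\<close> over their norms; rotating forwards returns the
  ladder \<open>m\<close>. Pairing the result with the ladder \<open>m'\<close> gives the
  orthogonality relation of 6j symbols.\<close>

lemma tet_orthogonal:
  "(\<Sum>n | admissible k i n \<and> admissible l j n. tet i j k l n m * tet i j k l n m' / norm2 k i l j n) =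
     (if m = m' then norm2 i j k l m else 0)"
proof -
  let ?N = "{n. admissible k i n \<and> admissible l j n}"
  let ?Y = "tl_rot' A i j k l (ladder i j k l m)"
  have Y: "balanced_mor k i l j ?Y" by (intro rot'_mor ladder_mor)
  have Yh: "?Y \<in> tl_hom (k + i) (l + j)" using Y by (simp add: balanced_mor_def)
  have "jw2 l j \<cdot> ?Y \<cdot> jw2 k i = ?Y" using Y by (simp add: balanced_mor_def)
  then have "?Y = (\<Sum>n\<in>?N. scale (tet i j k l n m / norm2 k i l j n) (ladder k i l j n))"
    using ladder_expansion[OF Yh] unfolding tet_eq by simp
  moreover have "rotated i j k l (\<Sum>n\<in>?N. scale (c n) (ladder k i l j n)) = (\<Sum>n\<in>?N. scale (c n) (rotated i j k l (ladder k i l j n)))" for c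
    by (simp add: rotated_def)
  ultimately have "rotated i j k l ?Y = (\<Sum>n\<in>?N. scale (tet i j k l n m / norm2 k i l j n) (rotated i j k l (ladder k i l j n)))"
    by simp
  moreover have "rotated i j k l ?Y = ladder i j k l m"
    by (simp add: rotated_def tl_rot_rot' ladder_in_hom ladder_absorb)
  ultimately have "tl_trace A (i + j) (adj (ladder i j k l m') \<cdot> ladder i j k l m) =
      tl_trace A (i + j) (adj (ladder i j k l m') \<cdot> (\<Sum>n\<in>?N. scale (tet i j k l n m / norm2 k i l j n) (rotated i j k l (ladder k i l j n))))"
    by simp
  also have "\<dots> = (\<Sum>n\<in>?N. tet i j k l n m * tet i j k l n m' / norm2 k i l j n)"
    by (simp add: tet_def [of i j k l _ m'])
  finally show ?thesis by (auto simp: ladder_gram norm2_def)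
qed

end

section \<open>The balanced theory\<close>

lemmas box_linear [simp] = bilinear_ext_linear[where h = "\<lambda>(d :: diagram) (d' :: diagram). basis (d, d')", folded box_def]
lemmas tl2_comp_linear [simp] = bilinear_ext_linear[where 
    h = "\<lambda>(e, e') (d, d'). compose_basis A e d \<boxtimes> compose_basis (inverse A) e' d'" for A, folded tl2_comp_def]
lemmas tl2_tensor_linear [simp] = bilinear_ext_linear[where 
    h = "\<lambda>(d, d') (e, e'). basis (juxtapose d e, juxtapose d' e')", folded tl2_tensor_def]

lemma box_basis: "basis d \<boxtimes> basis e = basis (d, e)"
  by (simp add: box_def bilinear_ext_single)

lemma box_0 [simp]: "0 \<boxtimes> y = 0" "x \<boxtimes> 0 = 0"
  by (simp_all add: box_def)

lemma tl2_comp_0 [simp]: "tl2_comp 0 A y = 0" "tl2_comp x A 0 = 0"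
  by (simp_all add: tl2_comp_def)

lemma tl2_tensor_0 [simp]: "0 \<odot> y = 0" "x \<odot> 0 = 0"
  by (simp_all add: tl2_tensor_def)

text \<open>Each side is linear in each of the four arguments, and on single diagrams the claim is
  the definition of \<open>tl2_comp\<close>. The two factors can therefore be computed
  separately.\<close>

lemma box_comp: "(y \<boxtimes> y') \<bullet>\<^bsub>A\<^esub> (x \<boxtimes> x') = (y \<circ>\<^bsub>A\<^esub> x) \<boxtimes> (y' \<circ>\<^bsub>inverse A\<^esub> x')"
proof (induction x rule: poly_mapping_lin_induct)
  case d: (basis d)
  show ?case
  proof (induction x' rule: poly_mapping_lin_induct)
    case d': (basis d')
    show ?case
    proof (induction y rule: poly_mapping_lin_induct)
      case e: (basis e)
      show ?case
      proof (induction y' rule: poly_mapping_lin_induct)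
        case (basis e')
        show ?case
          unfolding box_basis by (simp add: tl2_comp_def tl_comp_def bilinear_ext_single)
      qed simp_all
    qed simp_all
  qed simp_all
qed simp_all

lemma box_tensor: "(x \<boxtimes> x') \<odot> (y \<boxtimes> y') = (x \<otimes> y) \<boxtimes> (x' \<otimes> y')"
proof (induction x rule: poly_mapping_lin_induct)
  case d: (basis d)
  show ?case
  proof (induction x' rule: poly_mapping_lin_induct)
    case d': (basis d')
    show ?case
    proof (induction y rule: poly_mapping_lin_induct)
      case e: (basis e)
      show ?case
      proof (induction y' rule: poly_mapping_lin_induct)
        case (basis e')
        show ?case
          unfolding box_basis by (simp add: tl2_tensor_def tl_tensor_def bilinear_ext_single box_basis)
      qed simp_all
    qed simp_all
  qed simp_all
qed simp_all

lemma compose_basis_inverse: "compose_basis (inverse A) = compose_basis A"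
proof -
  have "- (inverse A ^ 2) - inverse (inverse A) ^ 2 = - (A ^ 2) - inverse A ^ 2" by simp
  then show ?thesis by (intro ext) (simp only: compose_basis_def)
qed

lemma tl_comp_inverse: "y \<circ>\<^bsub>inverse A\<^esub> x = y \<circ>\<^bsub>A\<^esub> x"
  by (simp add: tl_comp_def compose_basis_inverse)

text \<open>The second tensor factor thus contains literally the same idempotents, arcs and vertices
  as the first, so both factors share one matrix \<open>tet\<close>.\<close>

lemma inverse_parameter:
  "jones_wenzl (inverse A) n = jones_wenzl A n" "arc_bot n (inverse A) = arc_bot n A" "arc_top n (inverse A) = arc_top n A"
  "vertex_merge i j n (inverse A) = vertex_merge i j n A" "vertex_split n i j (inverse A) = vertex_split n i j A"
  by (simp_all add: jones_wenzl_def arc_bot_def arc_top_def vertex_merge_def vertex_split_def tl_comp_inverse)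

context generic_parameter
begin

lemma balanced_generators:
  "idV A n = jw A n \<boxtimes> jw A n" "epsilon A k = (jw2 k k \<circ>\<^bsub>A\<^esub> tl_cup k) \<boxtimes> (jw2 k k \<circ>\<^bsub>A\<^esub> tl_cup k)"
  "eta A j = (tl_cap j \<circ>\<^bsub>A\<^esub> jw2 j j) \<boxtimes> (tl_cap j \<circ>\<^bsub>A\<^esub> jw2 j j)"
  unfolding idV_def epsilon_def eta_def balanced_def inverse_parameter
  by (simp_all add: arc_bot_def arc_top_def jones_wenzl_eq)

lemma bc_vertex_eq:
  "bc_vertex A i j k l =
    (\<Sum>n | admissible i j n \<and> admissible k l n. scale (1 / norm2 i j k l n) (ladder i j k l n \<boxtimes> ladder i j k l n))"
  unfolding bc_vertex_def balanced_def inverse_parameter tl_comp_inverse ladder_def norm2_def by simp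

text \<open>Both factors of a rotated ladder expand with the same coefficients \<open>tet\<close>.
  Summing over the old label \<open>n\<close> before the new labels \<open>m\<close> and
  \<open>m'\<close> meets the orthogonality relation, which removes the off-diagonal terms and
  cancels one of the two norms in the denominator.\<close>

lemma rotated_bc_vertex:
  "(\<Sum>n | admissible k i n \<and> admissible l j n.
      scale (1 / norm2 k i l j n) (rotated i j k l (ladder k i l j n) \<boxtimes> rotated i j k l (ladder k i l j n))) =
    bc_vertex A i j k l"
proof -
  let ?N = "{n. admissible k i n \<and> admissible l j n}" and ?M = "{m. admissible i j m \<and> admissible k l m}"
  let ?D = "ladder i j k l" and ?d = "norm2 i j k l" and ?e = "norm2 k i l j" and ?t = "tet i j k l"
  have d0: "?d m \<noteq> 0" if "m \<in> ?M" for m using that theta_nonzero Delta_nonzero by (simp add: norm2_def)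
  have "rotated i j k l (ladder k i l j n) \<boxtimes> rotated i j k l (ladder k i l j n) =
      (\<Sum>m\<in>?M. \<Sum>m'\<in>?M. scale (?t n m * ?t n m' / (?d m * ?d m')) (?D m \<boxtimes> ?D m'))" for n
    unfolding rotated_expansion box_linear(7,8) by (simp add: scale_sum, subst sum.swap, simp add: mult.commute)
  then have "(\<Sum>n\<in>?N. scale (1 / ?e n) (rotated i j k l (ladder k i l j n) \<boxtimes> rotated i j k l (ladder k i l j n))) =
      (\<Sum>n\<in>?N. \<Sum>m\<in>?M. \<Sum>m'\<in>?M. scale (?t n m * ?t n m' / ?e n * (1 / (?d m * ?d m'))) (?D m \<boxtimes> ?D m'))"
    by (simp add: scale_sum field_simps)
  also have "\<dots> = (\<Sum>m\<in>?M. \<Sum>m'\<in>?M. \<Sum>n\<in>?N. scale (?t n m * ?t n m' / ?e n * (1 / (?d m * ?d m'))) (?D m \<boxtimes> ?D m'))"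
    by (rule trans[OF sum.swap], rule sum.cong[OF refl], rule sum.swap)
  also have "\<dots> = (\<Sum>m\<in>?M. \<Sum>m'\<in>?M. scale ((\<Sum>n\<in>?N. ?t n m * ?t n m' / ?e n) * (1 / (?d m * ?d m'))) (?D m \<boxtimes> ?D m'))"
  proof -
    have "(\<Sum>n\<in>?N. scale (f n * c) x) = scale ((\<Sum>n\<in>?N. f n) * c) x" for f :: "nat \<Rightarrow> complex" and c and x :: tl2
      by (rule poly_mapping_eqI) (simp add: lookup_sum sum_distrib_right)
    then show ?thesis by (simp only:)
  qed
  also have "\<dots> = (\<Sum>m\<in>?M. \<Sum>m'\<in>?M. if m = m' then scale (1 / ?d m) (?D m \<boxtimes> ?D m) else 0)"
    unfolding tet_orthogonal using d0 by (intro sum.cong refl) auto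
  also have "\<dots> = (\<Sum>m\<in>?M. scale (1 / ?d m) (?D m \<boxtimes> ?D m))"
    using finite_admissible by (intro sum.cong refl) simp
  finally show ?thesis unfolding bc_vertex_eq .
qed

lemma bc_vertex_rotation:
  "bc_vertex A i j k l =
    (idV A k \<odot> idV A l \<odot> eta A j) \<bullet>\<^bsub>A\<^esub>
    (idV A k \<odot> bc_vertex A k i l j \<odot> idV A j) \<bullet>\<^bsub>A\<^esub>
    (epsilon A k \<odot> idV A i \<odot> idV A j)"
  \<comment> \<open>The instance of \<open>bc_vertex_eq\<close> expands the inner vertex only.
    Composition and juxtaposition act on the tensor factors separately, so the right-hand side
    becomes a weighted sum of rotated ladders paired with themselves.\<close>
  unfolding balanced_generators bc_vertex_eq[of k i l j] tl2_tensor_linear tl2_comp_linear box_tensor box_comp tl_comp_inverse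
    rot_sandwich[OF ladder_mor] rotated_def[symmetric]
  by (rule rotated_bc_vertex [symmetric])

end

theorem proposition3p2:
  fixes A :: complex and i j k l :: nat
  assumes "A \<noteq> 0"
    and "\<And>n. Delta A n \<noteq> 0"
  shows "bc_vertex A i j k l =
           (idV A k \<odot> idV A l \<odot> eta A j) \<bullet>\<^bsub>A\<^esub>
           (idV A k \<odot> bc_vertex A k i l j \<odot> idV A j) \<bullet>\<^bsub>A\<^esub>
           (epsilon A k \<odot> idV A i \<odot> idV A j)"
proof -
  interpret generic_parameter A by standard (use assms in auto)
  show ?thesis by (rule bc_vertex_rotation)
qed

end
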